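(* Let $\omega\subseteq\Omega$ be a union of elements of $\mathcal T_h$ such that $\operatorname{supp} f\subseteq\omega$, $\operatorname{supp}u_h^1\subseteq\omega$, and $\operatorname{supp}u_h^0\subseteq\omega$. Let $(u_h^n)_{n\ge0}\subset V_h$ be the corresponding solution of the Crank--Nicolson scheme. For any $n\in\mathbb N$ and $\ell\in\mathbb N$, we have $$|||u_h^{n+1/2}|||_{\Omega\setminus \mathtt N_\ell(\omega)}\le(\ell+1)^{n/2}\,\gamma^{\ell}\,\max_{k\le n}|||u_h^{k+1/2}|||$$ with $$0<\gamma=\sqrt{\frac{C_{\tau,h}+\frac12}{1+C_{\tau,h}}}<1$$ for a constant $$C_{\tau,h}\eqsim \beta\alpha^{-1}\Big(\frac{\tau}{h}+\frac{h}{\tau}\Big)$$ that also depends on $d$.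
   Context: Setting. $\Omega\subset\mathbb R^d$ is an open, bounded, connected Lipschitz polytope with $\operatorname{diam}(\Omega)\eqsim1$. $A\in L^\infty(\Omega)$ is a scalar coefficient with $0<\alpha\le A(x)\le\beta$ for almost every $x\in\Omega$. The function $f\in L^\infty(0,t_{\mathrm{fin}};L^2(\Omega))$ is the right-hand side of the wave equation $\partial_t^2u-\nabla\cdot(A\nabla u)=f$ in $\Omega\times(0,t_{\mathrm{fin}})$ with zero Dirichlet boundary conditions; its support is understood with respect to the space variable. For measurable $S\subseteq\Omega$ write $(\cdot,\cdot)_S$ and $\|\cdot\|_S$ for the inner product and norm of $L^2(S)$, $a_S(v,w):=(A\nabla v,\nabla w)_S$, $\|v\|_{a,S}^2:=a_S(v,v)$; the index is dropped if $S=\Omega$. Space discretization. $\mathcal T_h$ is a regular and quasi-uniform mesh of $\Omega$ into parallelepipeds with mesh size $h$, and $V_h\subset H^1_0(\Omega)$ is the first-order ($Q_1$) conforming finite element space on $\mathcal T_h$ with zero boundary values. Time discretization. $\tau>0$ is the time step size. For a sequence $(z^n)_{n\ge0}$ put $\hat\partial_\tau^2z^n:=\tau^{-2}(z^{n+1}-2z^n+z^{n-1})$, $\widehat{z^n}:=\frac14(z^{n+1}+2z^n+z^{n-1})$, and $z^{n+1/2}:=\frac12(z^{n+1}+z^n)$. Given initial conditions $u_h^0,u_h^1\in V_h$ and functions $f_h^k\in V_h$, where $f_h^k$ is an approximation of $f(k\tau)$ in $V_h$, e.g. its $L^2$-projection, the Crank--Nicolson scheme seeks $(u_h^n)_n\subset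 V_h$ such that for $n\ge1$ $$(\hat\partial_\tau^2u_h^n,v_h)+a(\widehat{u_h^n},v_h)=(\widehat{f_h^n},v_h)\quad\text{for all }v_h\in V_h.$$ Norm. For $S\subseteq\Omega$ and $v_h\in V_h$, $|||v_h|||_S^2:=\|v_h\|_{S}^2+\frac{\tau^2}{4}\|v_h\|_{a,S}^2$, and $|||\cdot|||:=|||\cdot|||_\Omega$. Patches. For $\omega\subseteq\Omega$, $\mathtt N(\omega)=\mathtt N_1(\omega)$ is the interior of the union of all closed elements $\overline K$, $K\in\mathcal T_h$, with $\overline K\cap\overline\omega\ne\emptyset$; $\mathtt N_\ell(\omega):=\mathtt N(\mathtt N_{\ell-1}(\omega))$ for $\ell\ge2$; $\mathtt N_0(\omega):=\operatorname{int}\omega$. Convention. The index $k$ in the maximum ranges over nonnegative integers. $\theta\lesssim\eta$ means $\theta\le C\eta$ with a generic constant $C>0$ that is independent of the discretization scales but might depend on $d$, $\alpha$, $\beta$; $\theta\eqsim\eta$ means $\theta\lesssim\eta\lesssim\theta$.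
   Formalization: The discrete right-hand sides f_h^k are taken to be the L²-projections of f(kτ) or elements of V_h supported in ω; for arbitrary approximations in V_h, whose support may lie far from ω, the estimate is false. *)

theory Defs
  imports "HOL-Analysis.Analysis"
begin

section \<open>Domain, mesh and finite element space\<close>

text \<open>Locally, up to a rotation, the domain is the strict epigraph of a Lipschitz function of the
  component orthogonal to the direction \<open>e\<close>.\<close>
definition lipschitz_boundary :: "(real^'d) set \<Rightarrow> bool" where
  "lipschitz_boundary \<Omega> \<longleftrightarrow>
     (\<forall>x\<in>frontier \<Omega>. \<exists>e r L \<phi>. norm e = 1 \<and> 0 < r \<and> L-lipschitz_on UNIV \<phi> \<and>
        (\<forall>y\<in>ball x r. y \<in> \<Omega> \<longleftrightarrow> \<phi> (y - (y \<bullet> e) *\<^sub>R e) < y \<bullet> e))"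

text \<open>``Polytope'' in the sense of a not necessarily convex polyhedral domain.\<close>
definition lipschitz_polytope :: "(real^'d) set \<Rightarrow> bool" where
  "lipschitz_polytope \<Omega> \<longleftrightarrow>
     open \<Omega> \<and> bounded \<Omega> \<and> connected \<Omega> \<and> \<Omega> \<noteq> {} \<and> lipschitz_boundary \<Omega> \<and>
     (\<exists>\<P>. finite \<P> \<and> (\<forall>P\<in>\<P>. polytope P) \<and> closure \<Omega> = \<Union>\<P>)"

definition affine_map :: "real^'d \<Rightarrow> real^'d^'d \<Rightarrow> real^'d \<Rightarrow> real^'d" where
  "affine_map b M x = b + M *v x"

definition parallelepiped :: "(real^'d) set \<Rightarrow> bool" where
  "parallelepiped K \<longleftrightarrow> (\<exists>b M. invertible M \<and> K = affine_map b M ` cbox 0 1)"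

definition mesh_size :: "(real^'d) set set \<Rightarrow> real" where
  "mesh_size \<T> = Max (diameter ` \<T>)"

text \<open>The mesh is represented by its closed elements. The intersection condition says that
  there are no hanging nodes; it implies that distinct elements have disjoint interiors. The
  parameter \<open>\<sigma>\<close> bounds the shape regularity (inscribed ball) and the quasi-uniformity.\<close>
definition regular_mesh :: "real \<Rightarrow> (real^'d) set \<Rightarrow> (real^'d) set set \<Rightarrow> bool" where
  "regular_mesh \<sigma> \<Omega> \<T> \<longleftrightarrow>
     finite \<T> \<and> (\<forall>K\<in>\<T>. parallelepiped K) \<and> \<Union>\<T> = closure \<Omega> \<and>
     (\<forall>K\<in>\<T>. \<forall>L\<in>\<T>. (K \<inter> L) face_of K \<and> (K \<inter> L) face_of L) \<and>
     (\<forall>K\<in>\<T>. \<exists>x. cball x (\<sigma> * diameter K) \<subseteq> K) \<and>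
     (\<forall>K\<in>\<T>. \<sigma> * mesh_size \<T> \<le> diameter K)"

text \<open>\<open>v\<close> is the affine push-forward of a polynomial of degree at most one in each variable;
  this does not depend on which affine map of the unit cube onto \<open>K\<close> is used.\<close>
definition Q1_on :: "(real^'d) set \<Rightarrow> (real^'d \<Rightarrow> real) \<Rightarrow> bool" where
  "Q1_on K v \<longleftrightarrow>
     (\<exists>b M c. invertible M \<and> K = affine_map b M ` cbox 0 1 \<and>
        (\<forall>x\<in>cbox 0 1. v (affine_map b M x) = (\<Sum>S\<in>(UNIV :: 'd set set). c S * (\<Prod>i\<in>S. x $ i))))"

text \<open>Functions in the finite element space are extended by zero to the whole space, so that
  global continuity encodes both conformity and the zero boundary values.\<close>
definition Q1_space :: "(real^'d) set \<Rightarrow> (real^'d) set set \<Rightarrow> (real^'d \<Rightarrow> real) set" where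
  "Q1_space \<Omega> \<T> =
     {v. continuous_on UNIV v \<and> (\<forall>x. x \<notin> \<Omega> \<longrightarrow> v x = 0) \<and> (\<forall>K\<in>\<T>. Q1_on K v)}"

definition patch :: "(real^'d) set set \<Rightarrow> (real^'d) set \<Rightarrow> (real^'d) set" where
  "patch \<T> \<omega> = interior (\<Union>{K\<in>\<T>. K \<inter> closure \<omega> \<noteq> {}})"

fun patches :: "(real^'d) set set \<Rightarrow> nat \<Rightarrow> (real^'d) set \<Rightarrow> (real^'d) set" where
  "patches \<T> 0 \<omega> = interior \<omega>"
| "patches \<T> (Suc 0) \<omega> = patch \<T> \<omega>"
| "patches \<T> (Suc (Suc l)) \<omega> = patch \<T> (patches \<T> (Suc l) \<omega>)"

text \<open>The elements are closed and may touch the boundary of the domain, hence the intersection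
  with \<open>\<Omega>\<close>.\<close>
definition union_of_elements :: "(real^'d) set \<Rightarrow> (real^'d) set set \<Rightarrow> (real^'d) set \<Rightarrow> bool" where
  "union_of_elements \<Omega> \<T> \<omega> \<longleftrightarrow> (\<exists>\<S>\<subseteq>\<T>. \<omega> = \<Omega> \<inter> \<Union>\<S>)"

section \<open>Function spaces, bilinear forms and norms\<close>

definition L2_fun :: "(real^'d) set \<Rightarrow> (real^'d \<Rightarrow> real) \<Rightarrow> bool" where
  "L2_fun S g \<longleftrightarrow> g \<in> borel_measurable (lebesgue_on S) \<and> integrable (lebesgue_on S) (\<lambda>x. (g x)\<^sup>2)"

definition L2_inner :: "(real^'d) set \<Rightarrow> (real^'d \<Rightarrow> real) \<Rightarrow> (real^'d \<Rightarrow> real) \<Rightarrow> real" where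
  "L2_inner S v w = (\<integral>x. v x * w x \<partial>(lebesgue_on S))"

text \<open>Functions in \<open>Q1_space\<close> are smooth in the interior of each element and globally continuous,
  so almost everywhere this classical gradient is the weak one. Its values on the element
  boundaries, a null set, are irrelevant.\<close>
definition grad :: "(real^'d \<Rightarrow> real) \<Rightarrow> real^'d \<Rightarrow> real^'d" where
  "grad v x = (\<chi> i. frechet_derivative v (at x) (axis i 1))"

definition coefficient :: "real \<Rightarrow> real \<Rightarrow> (real^'d) set \<Rightarrow> (real^'d \<Rightarrow> real) \<Rightarrow> bool" where
  "coefficient \<alpha> \<beta> \<Omega> A \<longleftrightarrow>
     A \<in> borel_measurable (lebesgue_on \<Omega>) \<and> (AE x in lebesgue_on \<Omega>. \<alpha> \<le> A x \<and> A x \<le> \<beta>)"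

definition energy_form ::
  "(real^'d \<Rightarrow> real) \<Rightarrow> (real^'d) set \<Rightarrow> (real^'d \<Rightarrow> real) \<Rightarrow> (real^'d \<Rightarrow> real) \<Rightarrow> real" where
  "energy_form A S v w = (\<integral>x. (A x *\<^sub>R grad v x) \<bullet> grad w x \<partial>(lebesgue_on S))"

definition triple_norm ::
  "(real^'d \<Rightarrow> real) \<Rightarrow> real \<Rightarrow> (real^'d) set \<Rightarrow> (real^'d \<Rightarrow> real) \<Rightarrow> real" where
  "triple_norm A \<tau> S v = sqrt (L2_inner S v v + \<tau>\<^sup>2 / 4 * energy_form A S v v)"

text \<open>Essential support. It is applied to sets \<open>\<omega>\<close> that are relatively closed in \<open>\<Omega>\<close>, for which
  vanishing a.e. outside of \<open>\<omega>\<close> is the same as the inclusion of the support, taken relative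
  to \<open>\<Omega>\<close>, in \<open>\<omega>\<close>.\<close>
definition supported_in :: "(real^'d) set \<Rightarrow> (real^'d) set \<Rightarrow> (real^'d \<Rightarrow> real) \<Rightarrow> bool" where
  "supported_in \<Omega> \<omega> v \<longleftrightarrow> (AE x in lebesgue_on \<Omega>. x \<notin> \<omega> \<longrightarrow> v x = 0)"

text \<open>Since the scheme samples \<open>f\<close> at discrete times, a representative is fixed
  whose value is a square integrable function at every time \<open>t \<ge> 0\<close>. Values at times
  beyond \<open>t\<^sub>f\<^sub>i\<^sub>n\<close> may be taken to be zero.\<close>
definition Linf_L2 :: "real \<Rightarrow> (real^'d) set \<Rightarrow> (real \<Rightarrow> real^'d \<Rightarrow> real) \<Rightarrow> bool" where
  "Linf_L2 t\<^sub>f\<^sub>i\<^sub>n \<Omega> f \<longleftrightarrow>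
     (\<forall>t\<ge>0. L2_fun \<Omega> (f t)) \<and>
     (\<lambda>(t, x). f t x) \<in> borel_measurable (lebesgue_on ({0<..<t\<^sub>f\<^sub>i\<^sub>n} \<times> \<Omega>)) \<and>
     (\<exists>B. AE t in lebesgue_on {0<..<t\<^sub>f\<^sub>i\<^sub>n}. L2_inner \<Omega> (f t) (f t) \<le> B)"

section \<open>The Crank--Nicolson scheme\<close>

definition second_diff :: "real \<Rightarrow> (nat \<Rightarrow> real^'d \<Rightarrow> real) \<Rightarrow> nat \<Rightarrow> real^'d \<Rightarrow> real" where
  "second_diff \<tau> z n x = (z (n + 1) x - 2 * z n x + z (n - 1) x) / \<tau>\<^sup>2"

definition weighted_avg :: "(nat \<Rightarrow> real^'d \<Rightarrow> real) \<Rightarrow> nat \<Rightarrow> real^'d \<Rightarrow> real" where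
  "weighted_avg z n x = (z (n + 1) x + 2 * z n x + z (n - 1) x) / 4"

definition half_step :: "(nat \<Rightarrow> real^'d \<Rightarrow> real) \<Rightarrow> nat \<Rightarrow> real^'d \<Rightarrow> real" where
  "half_step z n x = (z (n + 1) x + z n x) / 2"

definition L2_projection ::
  "(real^'d) set \<Rightarrow> (real^'d \<Rightarrow> real) set \<Rightarrow> (real^'d \<Rightarrow> real) \<Rightarrow> (real^'d \<Rightarrow> real) \<Rightarrow> bool" where
  "L2_projection \<Omega> V g p \<longleftrightarrow> p \<in> V \<and> (\<forall>v\<in>V. L2_inner \<Omega> p v = L2_inner \<Omega> g v)"

text \<open>Discrete right-hand sides: the \<open>L\<^sup>2\<close>-projection of the data \<open>g\<close>, which in general is not itself
  supported in \<open>\<omega>\<close>, or any other approximation that keeps the support of the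
  data inside \<open>\<omega>\<close>.\<close>
definition rhs_approx ::
  "(real^'d) set \<Rightarrow> (real^'d \<Rightarrow> real) set \<Rightarrow> (real^'d) set \<Rightarrow> (real^'d \<Rightarrow> real) \<Rightarrow> (real^'d \<Rightarrow> real) \<Rightarrow> bool"
  where "rhs_approx \<Omega> V \<omega> g p \<longleftrightarrow> p \<in> V \<and> (L2_projection \<Omega> V g p \<or> supported_in \<Omega> \<omega> p)"

definition crank_nicolson ::
  "(real^'d) set \<Rightarrow> (real^'d \<Rightarrow> real) set \<Rightarrow> (real^'d \<Rightarrow> real) \<Rightarrow> real \<Rightarrow>
   (nat \<Rightarrow> real^'d \<Rightarrow> real) \<Rightarrow> (nat \<Rightarrow> real^'d \<Rightarrow> real) \<Rightarrow> bool" where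
  "crank_nicolson \<Omega> V A \<tau> f\<^sub>h u \<longleftrightarrow>
     (\<forall>n. u n \<in> V) \<and>
     (\<forall>n\<ge>1. \<forall>v\<in>V. L2_inner \<Omega> (second_diff \<tau> u n) v + energy_form A \<Omega> (weighted_avg u n) v
                      = L2_inner \<Omega> (weighted_avg f\<^sub>h n) v)"

end

theory Submission
  imports Defs
begin

text \<open>Away from the data, the energy of a half step decays by a fixed factor from one layer of
  elements to the next, because each half step solves a coercive problem whose right-hand side
  consists of the two previous half steps. Write
  \<open>w n = half_step u n\<close> and \<open>B\<^sub>\<kappa>(w, v) = (w, v) + \<kappa> a(w, v)\<close> with \<open>\<kappa> = \<tau>\<^sup>2/4\<close>, so that
  \<open>B\<^sub>\<kappa>(w, w)\<close> is the squared triple norm. Adding the scheme at two consecutive steps eliminates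
  the values \<open>u n\<close> and leaves, for every test function \<open>v\<close> of the finite element space that
  vanishes on \<open>\<omega>\<close>, the three-term recurrence
  \<open>B\<^sub>\<kappa>(w (n+1), v) = 2 B\<^bsub>-\<kappa>\<^esub>(w n, v) - B\<^sub>\<kappa>(w (n-1), v)\<close> (\<open>half_step_recurrence\<close>). The data drop
  out even if the discrete right-hand side is a projection and not supported in \<open>\<omega>\<close>, since it
  is only tested with \<open>v\<close>.

  Take for \<open>v\<close> the function that has the nodal values of \<open>w (n+1)\<close> at the vertices off the
  \<open>l\<close>-th patch and zero at all others. It agrees with \<open>w (n+1)\<close> off the next patch, and vanishes
  on the \<open>l\<close>-th one, so the left-hand side is the energy off the next patch plus a contribution
  of the ring between both patches. On an element \<open>K\<close> of the ring an inverse estimate bounds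
  \<open>\<parallel>v\<parallel>\<close> and \<open>h \<parallel>\<nabla>v\<parallel>\<close> by the \<open>L\<^sup>2\<close> norm of \<open>w (n+1)\<close>. In a mixed product one factor \<open>\<tau>/2\<close>
  is absorbed by the energy norm of the other argument, and the other factor meets the
  \<open>1/h\<close> of the inverse estimate; this is why the constant grows only linearly in \<open>\<tau>/h\<close>
  (\<open>eform_truncation_bound\<close>). Young's inequality then yields
  \<open>(1 + C) x' \<le> (C + 1/2) (x + (y + z)/2)\<close>, where \<open>x'\<close> and \<open>x\<close> are the energies of \<open>w (n+1)\<close>
  off the next and off the \<open>l\<close>-th patch, and \<open>y\<close>, \<open>z\<close> those of the two previous half steps off the
  \<open>l\<close>-th patch (\<open>layer_decay\<close>). The \<open>1/2\<close> is the share of \<open>x'\<close> that Young's inequality leaves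
  on the right. An induction over \<open>n\<close> and \<open>l\<close> with
  \<open>(l+1)\<^sup>n + (l+1)\<^bsup>n-1\<^esup> \<le> (l+2)\<^sup>n\<close> gives the claim (\<open>energy_decay\<close>).

  Two ingredients need work of their own. That the truncated function belongs to the finite
  element space amounts to the existence of nodal basis functions, i.e. to the fact that the
  local ones of two elements agree on a common face (\<open>hatval_consistent\<close>) and vanish on the
  boundary of the domain (\<open>interior_point_if_hat_nonzero\<close>). The inverse estimate rests on the
  bound of nodal values by an \<open>L\<^sup>2\<close> norm (\<open>nodal_values_bound\<close>).\<close>

section \<open>Faces and vertices of parallelepipeds\<close>

lemma mem_unit_cube: "t \<in> cbox 0 (1 :: real^'d) \<longleftrightarrow> (\<forall>i. 0 \<le> t $ i \<and> t $ i \<le> 1)"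
  by (simp add: mem_box_cart)

text \<open>A segment of \<open>S\<close> that runs from \<open>y\<close> through a point \<open>x\<close> of the face and a little beyond lies
  in the face. All descriptions of faces of the cube below come from a suitable choice of \<open>x\<close>.\<close>
lemma face_of_extend:
  fixes F :: "'a :: real_vector set"
  assumes "F face_of S" "x \<in> F" "y \<in> S" "0 < e" "x + e *\<^sub>R (x - y) \<in> S"
  shows "y \<in> F"
proof (cases "x = y")
  case False
  let ?z = "x + e *\<^sub>R (x - y)"
  have "x = (1 - 1 / (1 + e)) *\<^sub>R y + (1 / (1 + e)) *\<^sub>R ?z"
  proof -
    have e: "1 + e \<noteq> 0" using assms by auto
    have "(1 + e) *\<^sub>R ((1 - 1 / (1 + e)) *\<^sub>R y + (1 / (1 + e)) *\<^sub>R ?z) = e *\<^sub>R y + ?z"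
      using e by (simp add: scaleR_add_right[of "1+e"] right_diff_distrib)
    also have "\<dots> = (1 + e) *\<^sub>R x" by (simp add: algebra_simps)
    finally show ?thesis using e by (metis scaleR_cancel_left)
  qed
  moreover have "y \<noteq> ?z"
  proof
    assume "y = ?z"
    then have "(1 + e) *\<^sub>R (x - y) = 0" by (simp add: algebra_simps)
    then show False using False \<open>0 < e\<close> by simp
  qed
  moreover have "0 < 1 / (1 + e)" "1 / (1 + e) < 1" using \<open>0 < e\<close> by auto
  ultimately have "x \<in> open_segment y ?z" unfolding in_segment(2) by blast
  then show ?thesis using face_ofD[OF assms(1)] assms by blast
qed (use assms in auto)

text \<open>The coordinates of the midpoint of \<open>0\<close> and \<open>t\<close> are at most \<open>1/2\<close>, which leaves room to extend
  the segment from \<open>axis i 1\<close> beyond it.\<close>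
lemma cube_face_support:
  fixes F :: "(real^'d) set"
  assumes F: "F face_of cbox 0 1" "0 \<in> F" and t: "t \<in> F" "0 < t $ i"
  shows "axis i 1 \<in> F"
proof -
  have tc: "t \<in> cbox 0 1" using F t face_of_imp_subset by blast
  have m: "(1/2) *\<^sub>R t \<in> F"
    using convexD[OF face_of_imp_convex[OF F(1)] F(2) t(1), of "1/2" "1/2"] by simp
  show ?thesis
  proof (rule face_of_extend[OF F(1) m])
    show "axis i 1 \<in> cbox 0 (1 :: real^'d)" by (auto simp: mem_unit_cube axis_def)
    show "0 < t $ i / 2" using t by simp
    have "0 \<le> t $ j / 2 + t $ i * (t $ j / 2 - axis i 1 $ j) / 2 \<and>
          t $ j / 2 + t $ i * (t $ j / 2 - axis i 1 $ j) / 2 \<le> 1" for j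
    proof (cases "j = i")
      case True
      have "t $ i * t $ i \<le> 1 * 1" using tc unfolding mem_unit_cube by (intro mult_mono) auto
      then show ?thesis using True by (simp add: axis_def field_simps)
    next
      case False
      have "t $ i * t $ j \<le> 1 * 1" using tc unfolding mem_unit_cube by (intro mult_mono) auto
      moreover have "0 \<le> t $ i * t $ j" using tc unfolding mem_unit_cube by auto
      moreover have "0 \<le> t $ j" "t $ j \<le> 1" using tc unfolding mem_unit_cube by auto
      ultimately show ?thesis using False by (simp add: axis_def field_simps)
    qed
    then show "(1/2) *\<^sub>R t + (t $ i / 2) *\<^sub>R ((1/2) *\<^sub>R t - axis i 1) \<in> cbox 0 1"
      by (simp add: mem_unit_cube)
  qed
qed

text \<open>Together with the previous lemma: a face through the origin is determined by the edges at the
  origin that it contains. By induction over the edges, the midpoint of the far corner spanned by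
  the earlier edges and of the new edge is a relative interior point of the larger subcube.\<close>
lemma cube_face_spanned:
  fixes F :: "(real^'d) set"
  assumes F: "F face_of cbox 0 1" "0 \<in> F" and t: "t \<in> cbox 0 1" "\<And>i. 0 < t $ i \<Longrightarrow> axis i 1 \<in> F"
  shows "t \<in> F"
proof -
  have span: "\<forall>t\<in>cbox 0 1. (\<forall>i. i \<notin> I \<longrightarrow> t $ i = 0) \<longrightarrow> t \<in> F" if "\<And>i. i \<in> I \<Longrightarrow> axis i 1 \<in> F" for I
    using finite[of I] that
  proof (induction I)
    case empty
    have "t = 0" if "\<forall>i. t $ i = 0" for t :: "real^'d" using that by (simp add: vec_eq_iff)
    then show ?case using F(2) by auto
  next
    case (insert j I)
    show ?case
    proof (intro ballI impI)
      fix t :: "real^'d" assume t: "t \<in> cbox 0 1" "\<forall>i. i \<notin> insert j I \<longrightarrow> t $ i = 0"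
      define a :: "real^'d" where "a = (\<chi> i. if i \<in> I then 1 else 0)"
      have "a \<in> F" using insert by (auto simp: a_def mem_unit_cube)
      then have m: "(1/2) *\<^sub>R a + (1/2) *\<^sub>R axis j 1 \<in> F"
        using convexD[OF face_of_imp_convex[OF F(1)], of a "axis j 1" "1/2" "1/2"] insert by simp
      show "t \<in> F"
      proof (rule face_of_extend[OF F(1) m t(1)])
        show "(0::real) < 1" by simp
        show "(1/2) *\<^sub>R a + (1/2) *\<^sub>R axis j 1 + 1 *\<^sub>R ((1/2) *\<^sub>R a + (1/2) *\<^sub>R axis j 1 - t) \<in> cbox 0 1"
          using t insert.hyps unfolding mem_unit_cube
          by (auto simp: a_def axis_def)
      qed
    qed
  qed
  have z: "\<forall>i. i \<notin> {i. 0 < t $ i} \<longrightarrow> t $ i = 0"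
    using t(1) unfolding mem_unit_cube mem_Collect_eq by (meson order_antisym not_le)
  have "axis i 1 \<in> F" if "i \<in> {i. 0 < t $ i}" for i
    using t(2) that by (simp only: mem_Collect_eq)
  from span[of "{i. 0 < t $ i}", OF this, THEN bspec, OF _ t(1), THEN mp, OF _ z]
  show ?thesis .
qed

lemma cube_face_contains_0:
  fixes F :: "(real^'d) set"
  assumes F: "F face_of cbox 0 1" and t: "t \<in> F" "\<And>i. t $ i < 1"
  shows "0 \<in> F"
proof -
  define e where "e = Min (range (\<lambda>i. 1 - t $ i))"
  have e: "0 < e" "\<And>i. e \<le> 1 - t $ i" using t by (auto simp: e_def)
  have tc: "t \<in> cbox 0 1" using F t face_of_imp_subset by blast
  show ?thesis
  proof (rule face_of_extend[OF F t(1) _ e(1)])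
    show "t + e *\<^sub>R (t - 0) \<in> cbox 0 1" unfolding mem_unit_cube
    proof
      fix i
      have "e * t $ i \<le> e * 1" using tc e unfolding mem_unit_cube by (intro mult_left_mono) auto
      moreover have "0 \<le> e * t $ i" "0 \<le> t $ i" using tc e(1) unfolding mem_unit_cube by auto
      ultimately have "0 \<le> t $ i + e * t $ i" "t $ i + e * t $ i \<le> 1"
        using e(2)[of i] by linarith+
      then show "0 \<le> (t + e *\<^sub>R (t - 0)) $ i \<and> (t + e *\<^sub>R (t - 0)) $ i \<le> 1"
        by (simp only: vector_add_component vector_scaleR_component diff_zero real_scaleR_def)
    qed
  qed (auto simp: mem_unit_cube)
qed

lemma cube_corner_face: "{0} face_of cbox 0 (1 :: real^'d)"
proof -
  have "a = 0 \<and> b = 0" if ab: "a \<in> cbox 0 1" "b \<in> cbox 0 1" "0 \<in> open_segment a b" for a b :: "real^'d"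
  proof -
    obtain u where u: "0 < u" "u < 1" "0 = (1 - u) *\<^sub>R a + u *\<^sub>R b"
      using ab by (auto simp: in_segment)
    have "a $ i = 0 \<and> b $ i = 0" for i
    proof -
      have "(1 - u) * a $ i + u * b $ i = 0" using arg_cong[OF u(3), of "\<lambda>x. x $ i"] by simp
      moreover have "0 \<le> (1 - u) * a $ i" "0 \<le> u * b $ i" using ab u unfolding mem_unit_cube by auto
      ultimately have "(1 - u) * a $ i = 0" "u * b $ i = 0" by linarith+
      then show ?thesis using u by auto
    qed
    then show ?thesis by (simp add: vec_eq_iff)
  qed
  then show ?thesis by (auto simp: face_of_def mem_unit_cube)
qed

lemma cube_vertex_coords:
  assumes "{q} face_of cbox 0 (1 :: real^'d)"
  shows "q $ i = 0 \<or> q $ i = 1"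
proof (rule ccontr)
  assume n: "\<not> ?thesis"
  have qc: "q \<in> cbox 0 1" using face_of_imp_subset[OF assms] by auto
  then have q: "0 < q $ i" "q $ i < 1" using n unfolding mem_unit_cube by (metis order_less_le)+
  define y where "y = q - axis i (q $ i)"
  have "y \<in> {q}"
  proof (rule face_of_extend[OF assms])
    show "y \<in> cbox 0 1" using qc by (auto simp: y_def mem_unit_cube axis_def)
    show "0 < (1 - q $ i) / q $ i" using q by simp
    show "q + ((1 - q $ i) / q $ i) *\<^sub>R (q - y) \<in> cbox 0 1"
      using qc q by (auto simp: y_def mem_unit_cube axis_def)
  qed auto
  then have "axis i (q $ i) = 0" by (simp add: y_def)
  then show False using q by (simp add: axis_eq_0_iff)
qed

text \<open>An affine chart of \<open>K\<close> by the unit cube in which the origin corresponds to \<open>p\<close>; thus \<open>p\<close> is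
  a vertex of \<open>K\<close>. Such charts exist for every vertex, and the nodal basis function of \<open>p\<close>
  has the same formula in each of them.\<close>
definition corner :: "(real^'d) set \<Rightarrow> real^'d \<Rightarrow> real^'d^'d \<Rightarrow> bool" where
  "corner K p M \<longleftrightarrow> invertible M \<and> K = affine_map p M ` cbox 0 1"

definition verts :: "(real^'d) set \<Rightarrow> (real^'d) set" where
  "verts K = {p. \<exists>M. corner K p M}"

definition flip_matrix :: "'d set \<Rightarrow> real^'d^'d \<Rightarrow> real^'d^'d" where
  "flip_matrix S M = (\<chi> i j. if j \<in> S then - M $ i $ j else M $ i $ j)"

definition ind :: "'d set \<Rightarrow> real^'d" where
  "ind S = (\<chi> i. if i \<in> S then 1 else 0)"

text \<open>The reflection of the unit cube that exchanges the corners \<open>0\<close> and \<open>ind S\<close>.\<close>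
definition flip :: "'d set \<Rightarrow> real^'d \<Rightarrow> real^'d" where
  "flip S x = (\<chi> i. if i \<in> S then 1 - x $ i else x $ i)"

lemma inj_affine_map: "invertible M \<Longrightarrow> inj (affine_map p M)"
  by (auto simp: affine_map_def inj_def dest: injD[OF inj_matrix_vector_mult])

lemma affine_map_eq_iff [simp]: "invertible M \<Longrightarrow> affine_map p M x = affine_map p M y \<longleftrightarrow> x = y"
  using inj_affine_map by (auto simp: inj_def)

lemma affine_map_0 [simp]: "affine_map p M 0 = p"
  by (simp add: affine_map_def)

lemma affine_map_face_iff:
  assumes "invertible M"
  shows "affine_map p M ` F face_of affine_map p M ` C \<longleftrightarrow> F face_of C"
proof -
  have "affine_map p M ` X = (+) p ` ((*v) M ` X)" for X
    by (auto simp: affine_map_def image_image)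
  then show ?thesis
    by (simp add: face_of_linear_image inj_matrix_vector_mult assms)
qed

lemma corner_pull_face:
  assumes "corner K p M" "F face_of K"
  shows "{t \<in> cbox 0 1. affine_map p M t \<in> F} face_of cbox 0 1"
proof -
  have "affine_map p M ` {t \<in> cbox 0 1. affine_map p M t \<in> F} = F"
    using face_of_imp_subset[OF assms(2)] assms(1) by (auto simp: corner_def)
  then show ?thesis
    using assms affine_map_face_iff[of M p "{t \<in> cbox 0 1. affine_map p M t \<in> F}" "cbox 0 1"]
    by (simp add: corner_def)
qed

lemma corner_face_iff:
  assumes K: "corner K p M" and F: "F face_of K" "p \<in> F" and t: "t \<in> cbox 0 1"
  shows "affine_map p M t \<in> F \<longleftrightarrow> (\<forall>i. 0 < t $ i \<longrightarrow> affine_map p M (axis i 1) \<in> F)"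
proof -
  let ?F = "{t \<in> cbox 0 1. affine_map p M t \<in> F}"
  have f: "?F face_of cbox 0 1" "0 \<in> ?F"
    using corner_pull_face[OF K F(1)] F(2) by (auto simp: mem_unit_cube)
  have "axis i 1 \<in> cbox 0 (1 :: real^'d)" for i by (auto simp: mem_unit_cube axis_def)
  then show ?thesis
    using cube_face_support[OF f] cube_face_spanned[OF f] t by blast
qed

text \<open>Used contrapositively: the nodal basis function of \<open>p\<close>, whose zeros in \<open>K\<close> are the points with
  some coordinate equal to one, vanishes on every face that does not contain \<open>p\<close>.\<close>
lemma corner_in_face:
  assumes K: "corner K p M" and F: "F face_of K" "affine_map p M t \<in> F"
    and t: "t \<in> cbox 0 1" "\<And>i. t $ i < 1"
  shows "p \<in> F"
  using cube_face_contains_0[OF corner_pull_face[OF K F(1)], of t] F t by auto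

lemma corner_face: "corner K p M \<Longrightarrow> {p} face_of K"
  using affine_map_face_iff[of M p "{0}" "cbox 0 1"] cube_corner_face by (auto simp: corner_def)

lemma corner_mem: "corner K p M \<Longrightarrow> p \<in> K"
  using corner_face face_of_imp_subset by blast

lemma invertible_flip_matrix:
  fixes M :: "real^'d^'d"
  assumes "invertible M"
  shows "invertible (flip_matrix S M)"
proof -
  define s :: "real^'d \<Rightarrow> real^'d" where "s x = (\<chi> j. if j \<in> S then - x $ j else x $ j)" for x
  have "s (s x) = x" for x by (simp add: s_def vec_eq_iff)
  then have "bij s" by (intro o_bij[of s s]) auto
  moreover have "(*v) (flip_matrix S M) = (*v) M \<circ> s"
    by (auto simp: fun_eq_iff flip_matrix_def s_def matrix_vector_mult_def vec_eq_iff intro!: sum.cong)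
  ultimately show ?thesis using assms by (simp add: invertible_eq_bij bij_comp)
qed

lemma affine_map_flip:
  fixes M :: "real^'d^'d"
  shows "affine_map (affine_map p M (ind S)) (flip_matrix S M) x = affine_map p M (flip S x)"
proof -
  have "(\<Sum>j\<in>UNIV. M $ i $ j * ind S $ j) + (\<Sum>j\<in>UNIV. flip_matrix S M $ i $ j * x $ j)
      = (\<Sum>j\<in>UNIV. M $ i $ j * flip S x $ j)" for i
    unfolding sum.distrib[symmetric]
    by (rule sum.cong) (auto simp: flip_matrix_def flip_def ind_def right_diff_distrib)
  then show ?thesis by (simp add: affine_map_def matrix_vector_mult_def vec_eq_iff)
qed

lemma flip_flip [simp]: "flip S (flip S x) = x"
  by (simp add: flip_def vec_eq_iff)

lemma flip_cube_iff [simp]: "flip S x \<in> cbox 0 1 \<longleftrightarrow> x \<in> cbox 0 1"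
proof -
  have "0 \<le> flip S x $ i \<and> flip S x $ i \<le> 1 \<longleftrightarrow> 0 \<le> x $ i \<and> x $ i \<le> 1" for i
    by (auto simp: flip_def)
  then show ?thesis unfolding mem_unit_cube by simp
qed

lemma corner_flip:
  assumes "corner K p M"
  shows "corner K (affine_map p M (ind S)) (flip_matrix S M)"
proof -
  have "flip S ` cbox 0 1 = cbox 0 1"
    by (metis (no_types, lifting) flip_cube_iff flip_flip image_iff subsetI subset_antisym image_subsetI)
  then have "K = (\<lambda>x. affine_map p M (flip S x)) ` cbox 0 1"
    using assms by (metis corner_def image_image)
  then show ?thesis
    using assms by (simp add: corner_def invertible_flip_matrix affine_map_flip)
qed

text \<open>Vertices have an intrinsic description as extreme points, hence they do not depend on the
  chart.\<close>
lemma singleton_face_coords: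
  assumes K: "corner K b M" and f: "{p} face_of K"
  shows "p \<in> range (\<lambda>S. affine_map b M (ind S))"
proof -
  obtain q where q: "p = affine_map b M q" "q \<in> cbox 0 1"
    using K face_of_imp_subset[OF f] by (auto simp: corner_def)
  have "{t \<in> cbox 0 1. affine_map b M t \<in> {p}} = {q}"
    using q K by (auto simp: corner_def)
  then have "{q} face_of cbox 0 1" using corner_pull_face[OF K f] by simp
  then have "q = ind {i. q $ i = 1}" using cube_vertex_coords by (auto simp: ind_def vec_eq_iff)
  then show ?thesis using q(1) by (metis rangeI)
qed

lemma verts_eq:
  assumes K: "corner K b M"
  shows "verts K = range (\<lambda>S. affine_map b M (ind S))"
proof (intro equalityI subsetI)
  fix p assume "p \<in> verts K"
  then show "p \<in> range (\<lambda>S. affine_map b M (ind S))"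
    using singleton_face_coords[OF K] by (auto simp: verts_def corner_face)
qed (use corner_flip[OF K] in \<open>auto simp: verts_def\<close>)

lemma inj_ind: "inj (ind :: ('d::finite) set \<Rightarrow> _)"
proof (rule injI)
  fix S T :: "('d::finite) set" assume eq: "ind S = ind T"
  have "i \<in> S \<longleftrightarrow> i \<in> T" for i
    using arg_cong[OF eq, of "\<lambda>x. x $ i"] by (auto simp: ind_def split: if_splits)
  then show "S = T" by auto
qed

lemma bij_betw_verts:
  assumes "corner K b M"
  shows "bij_betw (\<lambda>S. affine_map b M (ind S)) UNIV (verts K)"
  unfolding bij_betw_def verts_eq[OF assms]
  using assms by (auto simp: inj_def corner_def dest: injD[OF inj_ind])

lemma finite_verts: "parallelepiped K \<Longrightarrow> finite (verts K)"
  by (metis verts_eq corner_def parallelepiped_def finite finite_imageI)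

lemma parallelepiped_corner: "parallelepiped K \<longleftrightarrow> (\<exists>b M. corner K b M)"
  by (simp add: parallelepiped_def corner_def)

section \<open>Nodal basis functions\<close>

text \<open>Edges are intrinsic: the edge of \<open>K\<close> from \<open>p\<close> in direction \<open>i\<close> is a face of \<open>K\<close>, hence
  of the common face and of \<open>L\<close>. It therefore contains an edge of \<open>L\<close> at \<open>p\<close>; by symmetry the
  converse inclusion holds for these two edges, so they coincide.\<close>
lemma common_face_edge:
  fixes p :: "real^'d"
  assumes K: "corner K p M" and L: "corner L p N"
    and F: "(K \<inter> L) face_of K" "(K \<inter> L) face_of L"
    and i: "affine_map p M (axis i 1) \<in> L"
  shows "\<exists>j. affine_map p N (axis j 1) = affine_map p M (axis i 1)"
proof -
  have seg_face: "closed_segment q (affine_map q Q (axis k 1)) face_of R"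
    if "corner R q Q" for R and q :: "real^'d" and Q k
  proof -
    \<comment> \<open>an edge at a corner is a face: it is the image of an edge of the cube\<close>
    have "{t \<in> cbox 0 1. \<forall>j. j \<noteq> k \<longrightarrow> t $ j = 0} face_of cbox 0 (1 :: real^'d)"
      (is "?A face_of _")
    proof -
      have "a \<in> ?A \<and> b \<in> ?A"
        if ab: "a \<in> cbox 0 1" "b \<in> cbox 0 1" "x \<in> open_segment a b" "x \<in> ?A" for a b x
      proof -
        obtain u where u: "0 < u" "u < 1" "x = (1 - u) *\<^sub>R a + u *\<^sub>R b"
          using ab by (auto simp: in_segment)
        have "a $ i = 0 \<and> b $ i = 0" if "i \<noteq> k" for i
        proof -
          have "(1 - u) * a $ i + u * b $ i = 0"
            using arg_cong[OF u(3), of "\<lambda>x. x $ i"] ab that by simp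
          moreover have "0 \<le> (1 - u) * a $ i" "0 \<le> u * b $ i" using ab u unfolding mem_unit_cube by auto
          ultimately have "(1 - u) * a $ i = 0" "u * b $ i = 0" by linarith+
          then show ?thesis using u by auto
        qed
        then show ?thesis using ab by auto
      qed
      moreover have "convex ?A"
      proof (rule convexI)
        fix x y :: "real^'d" and u v :: real
        assume "x \<in> ?A" "y \<in> ?A" "0 \<le> u" "0 \<le> v" "u + v = 1"
        then show "u *\<^sub>R x + v *\<^sub>R y \<in> ?A"
          using convexD[OF convex_box(1)[of 0 1], of x y u v] by simp
      qed
      ultimately show ?thesis unfolding face_of_def by blast
    qed
    moreover have "affine_map q Q ` ?A = closed_segment q (affine_map q Q (axis k 1))"
    proof -
      have "?A = (\<lambda>u. u *\<^sub>R axis k 1) ` {0..1}"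
      proof (intro equalityI subsetI)
        fix t :: "real^'d" assume t: "t \<in> ?A"
        then have "t = (t $ k) *\<^sub>R axis k 1" by (auto simp: vec_eq_iff axis_def)
        moreover have "t $ k \<in> {0..1}" using t unfolding mem_unit_cube by auto
        ultimately show "t \<in> (\<lambda>u. u *\<^sub>R axis k 1) ` {0..1}" by (metis imageI)
      qed (auto simp: mem_unit_cube axis_def)
      moreover have "affine_map q Q (u *\<^sub>R axis k 1) = (1 - u) *\<^sub>R q + u *\<^sub>R affine_map q Q (axis k 1)" for u
        by (simp add: affine_map_def algebra_simps matrix_vector_mult_scaleR)
      ultimately show ?thesis unfolding closed_segment_image_interval by (simp add: image_image)
    qed
    ultimately show ?thesis using affine_map_face_iff[of Q q ?A "cbox 0 1"] that by (simp add: corner_def)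
  qed
  let ?a = "affine_map p M (axis i 1)"
  have pF: "p \<in> K \<inter> L" using K L corner_mem by blast
  have aK: "?a \<in> K" using K by (auto simp: corner_def mem_unit_cube axis_def)
  have sub: "closed_segment p x \<subseteq> K \<inter> L" if "x \<in> K \<inter> L" for x
    using that pF face_of_imp_convex[OF F(1)] by (meson closed_segment_subset)
  have GL: "closed_segment p ?a face_of L"
    using face_of_trans[OF face_of_subset[OF seg_face[OF K] sub] F(2)] i aK by auto
  obtain t where t: "t \<in> cbox 0 1" "?a = affine_map p N t" using i L by (auto simp: corner_def)
  have ne: "?a \<noteq> p"
    using K affine_map_eq_iff[of M p "axis i 1" 0] by (auto simp: corner_def axis_eq_0_iff)
  then have "t \<noteq> 0" using t by auto
  then obtain j where j: "0 < t $ j" using t unfolding mem_unit_cube vec_eq_iff by (metis order_less_le zero_index)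
  let ?b = "affine_map p N (axis j 1)"
  have "\<forall>k. 0 < t $ k \<longrightarrow> affine_map p N (axis k 1) \<in> closed_segment p ?a"
    using corner_face_iff[OF L GL _ t(1)] t(2) ends_in_segment by (metis (no_types))
  then have b: "?b \<in> closed_segment p ?a" using j by blast
  have bF: "?b \<in> K \<inter> L" using b sub[of ?a] aK i by blast
  have HK: "closed_segment p ?b face_of K"
    using face_of_trans[OF face_of_subset[OF seg_face[OF L] sub[OF bF]] F(1)] by auto
  obtain l where l: "0 \<le> l" "l \<le> 1" "?b = (1 - l) *\<^sub>R p + l *\<^sub>R ?a"
    using b by (auto simp: in_segment)
  have bl: "?b = affine_map p M (l *\<^sub>R axis i 1)"
    unfolding l(3) by (simp add: affine_map_def algebra_simps matrix_vector_mult_scaleR)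
  have "?b \<noteq> p"
    using L affine_map_eq_iff[of N p "axis j 1" 0] by (auto simp: corner_def axis_eq_0_iff)
  then have "l \<noteq> 0" using bl by auto
  then have "0 < (l *\<^sub>R axis i (1::real)) $ i" using l by simp
  moreover have "l *\<^sub>R axis i 1 \<in> cbox 0 (1 :: real^'d)" using l by (auto simp: mem_unit_cube axis_def)
  ultimately have "?a \<in> closed_segment p ?b"
    using corner_face_iff[OF K HK, of "l *\<^sub>R axis i 1"] bl by (metis ends_in_segment)
  then obtain m where m: "0 \<le> m" "m \<le> 1" "?a = (1 - m) *\<^sub>R p + m *\<^sub>R ?b"
    by (auto simp: in_segment)
  \<comment> \<open>each of the two edge vectors is a multiple of the other one with a factor in \<open>[0,1]\<close>\<close>
  have am: "?a - p = m *\<^sub>R (?b - p)" by (subst m(3)) (simp add: algebra_simps)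
  have bm: "?b - p = l *\<^sub>R (?a - p)" by (subst l(3)) (simp add: algebra_simps)
  have "?a - p = (m * l) *\<^sub>R (?a - p)" using am bm by simp
  then have "m * l = 1" using ne by (metis right_minus_eq scaleR_cancel_right scaleR_one)
  then have "m = 1" using l m by (metis mult.commute mult_left_le order_antisym)
  then show ?thesis using m by auto
qed

text \<open>The nodal basis function of the corner \<open>0\<close> on the unit cube.\<close>
definition hatval :: "real^'d \<Rightarrow> real" where
  "hatval t = (\<Prod>i\<in>UNIV. 1 - t $ i)"

text \<open>The local basis functions of two elements at a common vertex agree on the common face. A point
  of the common face only has coordinates along the edges in that face. These edges are the same
  for both elements up to a bijection, and so, by uniqueness of coordinates, are the
  factors different from one in the two products.\<close>
lemma hatval_consistent:
  fixes s t :: "real^'d"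
  assumes K: "corner K p M" and L: "corner L p N"
    and F: "(K \<inter> L) face_of K" "(K \<inter> L) face_of L"
    and s: "s \<in> cbox 0 1" and t: "t \<in> cbox 0 1" and eq: "affine_map p M s = affine_map p N t"
  shows "hatval s = hatval t"
proof -
  let ?a = "\<lambda>i. affine_map p M (axis i 1)" and ?b = "\<lambda>j. affine_map p N (axis j 1)"
  define E where "E = {i. ?a i \<in> K \<inter> L}"
  define E' where "E' = {j. ?b j \<in> K \<inter> L}"
  have pF: "p \<in> K \<inter> L" using K L corner_mem by blast
  have aK: "?a i \<in> K" for i using K by (auto simp: corner_def mem_unit_cube axis_def)
  have bL: "?b i \<in> L" for i using L by (auto simp: corner_def mem_unit_cube axis_def)
  have inF: "affine_map p M s \<in> K \<inter> L"
    using K L s t eq unfolding corner_def by (metis IntI imageI)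
  have sE: "s $ i = 0" if "i \<notin> E" for i
    using that corner_face_iff[OF K F(1) pF s] inF s unfolding E_def mem_unit_cube
    by (metis (mono_tags, lifting) mem_Collect_eq order_less_le)
  have tE: "t $ i = 0" if "i \<notin> E'" for i
    using that corner_face_iff[OF L F(2) pF t] inF t eq unfolding E'_def mem_unit_cube
    by (metis (mono_tags, lifting) mem_Collect_eq order_less_le)
  have "\<exists>i\<in>E. ?a i = ?b j" if "j \<in> E'" for j
    using common_face_edge[OF L K, of j] F that aK unfolding E'_def E_def
    by (metis Int_commute Int_iff mem_Collect_eq)
  then obtain f where f: "\<And>j. j \<in> E' \<Longrightarrow> f j \<in> E \<and> ?a (f j) = ?b j" by metis
  have axis_inj: "i = j" if "axis i (1::real) = axis j 1" for i j :: 'd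
    using that by (auto simp: axis_eq_axis)
  have inj: "inj_on f E'"
  proof (rule inj_onI)
    fix i j assume "i \<in> E'" "j \<in> E'" "f i = f j"
    then have "?b i = ?b j" using f by metis
    then show "i = j" using L axis_inj by (auto simp: corner_def)
  qed
  have surj: "f ` E' = E"
  proof (intro equalityI subsetI)
    fix i assume i: "i \<in> E"
    then obtain j where j: "?b j = ?a i"
      using common_face_edge[OF K L F] unfolding E_def by blast
    then have jE: "j \<in> E'" using i by (simp add: E_def E'_def)
    then have "?a (f j) = ?a i" using f j by simp
    then have "f j = i" using K axis_inj by (auto simp: corner_def)
    then show "i \<in> f ` E'" using jE by auto
  qed (use f in auto)
  have col: "M *v axis (f j) 1 = N *v axis j 1" if "j \<in> E'" for j
    using f[OF that] by (simp add: affine_map_def)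
  have exp: "x = (\<Sum>i\<in>A. x $ i *\<^sub>R axis i 1)" if "\<And>i. i \<notin> A \<Longrightarrow> x $ i = 0" for A and x :: "real^'d"
  proof -
    have "(\<Sum>i\<in>A. x $ i * axis i 1 $ k) = x $ k" for k
      using that[of k] by (auto simp: axis_def if_distrib cong: if_cong)
    then show ?thesis by (simp add: vec_eq_iff)
  qed
  have Mv: "M *v (\<Sum>i\<in>A. c i *\<^sub>R v i) = (\<Sum>i\<in>A. c i *\<^sub>R (M *v v i))" for M :: "real^'d^'d" and c and v and A :: "'d set"
    by (simp add: linear_sum[OF matrix_vector_mul_linear] matrix_vector_mult_scaleR)
  have "M *v s = (\<Sum>i\<in>E. s $ i *\<^sub>R (M *v axis i 1))"
    by (subst exp[OF sE]) (simp_all add: Mv)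
  also have "\<dots> = (\<Sum>j\<in>E'. s $ f j *\<^sub>R (M *v axis (f j) 1))"
    using sum.reindex[OF inj] surj by (metis (no_types, lifting) comp_apply sum.cong)
  also have "\<dots> = (\<Sum>j\<in>E'. s $ f j *\<^sub>R (N *v axis j 1))" by (simp add: col)
  also have "\<dots> = N *v (\<Sum>j\<in>E'. s $ f j *\<^sub>R axis j 1)" by (simp add: Mv)
  finally have "affine_map p N t = affine_map p N (\<Sum>j\<in>E'. s $ f j *\<^sub>R axis j 1)"
    unfolding eq[symmetric] by (simp add: affine_map_def)
  then have teq: "t = (\<Sum>j\<in>E'. s $ f j *\<^sub>R axis j 1)"
    using L by (simp add: corner_def)
  have ts: "t $ j = s $ f j" if "j \<in> E'" for j
    using that by (subst teq) (simp add: axis_def if_distrib cong: if_cong)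
  have "hatval s = (\<Prod>i\<in>E. 1 - s $ i)"
    unfolding hatval_def by (rule prod.mono_neutral_right) (auto simp: sE)
  also have "\<dots> = (\<Prod>j\<in>E'. 1 - s $ f j)" using prod.reindex[OF inj] surj by (metis (no_types, lifting) comp_apply prod.cong)
  also have "\<dots> = (\<Prod>j\<in>E'. 1 - t $ j)" by (simp add: ts)
  also have "\<dots> = hatval t"
    unfolding hatval_def by (rule prod.mono_neutral_left) (auto simp: tE)
  finally show ?thesis .
qed

text \<open>The nodal basis function of the corner \<open>ind S\<close> on the unit cube.\<close>
definition psi :: "'d set \<Rightarrow> real^'d \<Rightarrow> real" where
  "psi S x = (\<Prod>i\<in>S. x $ i) * (\<Prod>i\<in>-S. 1 - x $ i)"

lemma psi_conv: "psi S x = (\<Prod>i\<in>UNIV. if i \<in> S then x $ i else 1 - x $ i)"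
  by (simp add: psi_def prod.If_cases Compl_eq)

lemma hatval_flip: "hatval (flip S x) = psi S x"
  unfolding psi_conv hatval_def by (rule prod.cong) (auto simp: flip_def)

lemma psi_ind: "psi S (ind T) = (if S = T then 1 else 0)"
proof (cases "S = T")
  case False
  then obtain i where "i \<in> S \<longleftrightarrow> i \<notin> T" by blast
  then have "(if i \<in> S then ind T $ i else 1 - ind T $ i) = (0::real)" by (auto simp: ind_def)
  then have "psi S (ind T) = 0" unfolding psi_conv by (intro prod_zero bexI[of _ i]) simp_all
  then show ?thesis using False by simp
qed (auto simp: psi_conv ind_def intro!: prod.neutral)

text \<open>Expand \<open>\<Prod>\<^sub>i (x\<^sub>i + (1 - x\<^sub>i))\<close>, where the second summand is dropped for \<open>i \<in> S\<close>.\<close>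
lemma monomial_eq_sum_psi:
  "(\<Prod>i\<in>S. x $ i) = (\<Sum>T\<in>UNIV. (\<Prod>i\<in>S. ind T $ i) * psi T x)"
proof -
  have "(\<Prod>i\<in>S. x $ i) = (\<Prod>i\<in>UNIV. x $ i + (if i \<in> S then 0 else 1 - x $ i))"
  proof -
    have "(\<Prod>i\<in>UNIV. x $ i + (if i \<in> S then 0 else 1 - x $ i)) = (\<Prod>i\<in>UNIV. if i \<in> S then x $ i else 1)"
      by (rule prod.cong) auto
    then show ?thesis by (simp add: prod.If_cases)
  qed
  also have "\<dots> = (\<Sum>T\<in>UNIV. (\<Prod>i\<in>T. x $ i) * (\<Prod>i\<in>-T. if i \<in> S then 0 else 1 - x $ i))"
    by (subst prod_add) (auto simp: Compl_eq_Diff_UNIV)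
  also have "\<dots> = (\<Sum>T\<in>UNIV. (\<Prod>i\<in>S. ind T $ i) * psi T x)"
  proof (rule sum.cong[OF refl])
    fix T :: "'a set"
    show "(\<Prod>i\<in>T. x $ i) * (\<Prod>i\<in>-T. if i \<in> S then 0 else 1 - x $ i) = (\<Prod>i\<in>S. ind T $ i) * psi T x"
    proof (cases "S \<subseteq> T")
      case True
      then have "(\<Prod>i\<in>S. ind T $ i :: real) = 1" by (auto simp: ind_def intro!: prod.neutral)
      moreover have "(\<Prod>i\<in>-T. if i \<in> S then 0 else 1 - x $ i) = (\<Prod>i\<in>-T. 1 - x $ i)"
        using True by (intro prod.cong) auto
      ultimately show ?thesis by (simp add: psi_def)
    next
      case False
      then obtain i where i: "i \<in> S" "i \<notin> T" by auto
      then have z1: "(\<Prod>i\<in>S. ind T $ i :: real) = 0" by (intro prod_zero) (auto simp: ind_def)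
      have z2: "(\<Prod>i\<in>-T. if i \<in> S then 0 else 1 - x $ i) = 0"
        using i by (intro prod_zero) auto
      show ?thesis by (simp only: z1 z2 mult_zero_left mult_zero_right)
    qed
  qed
  finally show ?thesis .
qed

lemma multilinear_interpolation:
  fixes c :: "'d::finite set \<Rightarrow> real" and x :: "real^'d"
  shows "(\<Sum>S\<in>UNIV. c S * (\<Prod>i\<in>S. x $ i)) =
    (\<Sum>T\<in>UNIV. (\<Sum>S\<in>UNIV. c S * (\<Prod>i\<in>S. ind T $ i)) * psi T x)"
proof -
  have "(\<Sum>S\<in>UNIV. c S * (\<Prod>i\<in>S. x $ i)) = (\<Sum>S\<in>UNIV. \<Sum>T\<in>UNIV. c S * (\<Prod>i\<in>S. ind T $ i) * psi T x)"
    by (subst monomial_eq_sum_psi) (simp add: sum_distrib_left mult.assoc)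
  also have "\<dots> = (\<Sum>T\<in>UNIV. \<Sum>S\<in>UNIV. c S * (\<Prod>i\<in>S. ind T $ i) * psi T x)"
    by (rule sum.swap)
  finally show ?thesis by (simp add: sum_distrib_right)
qed

text \<open>Each factor of \<open>psi\<close> has the form \<open>s\<^sub>i x\<^sub>i + g\<^sub>i\<close>, so the product expands into monomials.\<close>
lemma psi_multilinear: "\<exists>c. \<forall>x. psi S x = (\<Sum>T\<in>UNIV. c T * (\<Prod>i\<in>T. x $ i))"
proof -
  define s :: "'a \<Rightarrow> real" where "s i = (if i \<in> S then 1 else -1)" for i
  define g :: "'a \<Rightarrow> real" where "g i = (if i \<in> S then 0 else 1)" for i
  have "psi S x = (\<Sum>T\<in>UNIV. ((\<Prod>i\<in>T. s i) * (\<Prod>i\<in>-T. g i)) * (\<Prod>i\<in>T. x $ i))" for x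
  proof -
    have "psi S x = (\<Prod>i\<in>UNIV. s i * x $ i + g i)"
      unfolding psi_conv by (rule prod.cong) (auto simp: s_def g_def)
    also have "\<dots> = (\<Sum>T\<in>UNIV. (\<Prod>i\<in>T. s i * x $ i) * (\<Prod>i\<in>-T. g i))"
      by (subst prod_add) (auto simp: Compl_eq_Diff_UNIV)
    finally show ?thesis by (simp add: prod.distrib mult_ac)
  qed
  then show ?thesis by (intro exI allI)
qed

lemma hatval_range: "x \<in> cbox 0 1 \<Longrightarrow> 0 \<le> hatval x \<and> hatval x \<le> 1"
  unfolding hatval_def mem_unit_cube by (intro conjI prod_nonneg prod_le_1) auto

text \<open>The value \<open>y\<close> at \<open>x\<close> of the basis function of \<open>p\<close>, computed in an arbitrary element that
  contains \<open>x\<close> and has \<open>p\<close> as a vertex. The relation is functional on conforming meshes.\<close>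
definition hat_rel :: "(real^'d) set set \<Rightarrow> real^'d \<Rightarrow> real^'d \<Rightarrow> real \<Rightarrow> bool" where
  "hat_rel \<T> p x y \<longleftrightarrow>
     (\<exists>K\<in>\<T>. \<exists>M. \<exists>t\<in>cbox 0 1. corner K p M \<and> x = affine_map p M t \<and> y = hatval t)"

text \<open>The nodal basis function of the vertex \<open>p\<close>, equal to zero on all elements that do not have
  \<open>p\<close> as a vertex. On the mesh \<open>{K}\<close> it is the local basis function of \<open>K\<close>, and this is
  identically zero if \<open>p\<close> is not a vertex of \<open>K\<close>.\<close>
definition hat :: "(real^'d) set set \<Rightarrow> real^'d \<Rightarrow> real^'d \<Rightarrow> real" where
  "hat \<T> p x = (if \<exists>y. hat_rel \<T> p x y then SOME y. hat_rel \<T> p x y else 0)"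

definition conforming :: "(real^'d) set set \<Rightarrow> bool" where
  "conforming \<T> \<longleftrightarrow> (\<forall>K\<in>\<T>. parallelepiped K) \<and>
     (\<forall>K\<in>\<T>. \<forall>L\<in>\<T>. (K \<inter> L) face_of K \<and> (K \<inter> L) face_of L)"

lemma hat_rel_unique:
  assumes "conforming \<T>" "hat_rel \<T> p x y" "hat_rel \<T> p x z"
  shows "y = z"
proof -
  from assms(2) obtain K M s where K: "K \<in> \<T>" "corner K p M" "s \<in> cbox 0 1" "x = affine_map p M s" "y = hatval s"
    unfolding hat_rel_def by blast
  from assms(3) obtain L N t where L: "L \<in> \<T>" "corner L p N" "t \<in> cbox 0 1" "x = affine_map p N t" "z = hatval t"
    unfolding hat_rel_def by blast
  show ?thesis
    using hatval_consistent[OF K(2) L(2) _ _ K(3) L(3)] K L assms(1) by (simp add: conforming_def)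
qed

lemma hat_eqI: "conforming \<T> \<Longrightarrow> hat_rel \<T> p x y \<Longrightarrow> hat \<T> p x = y"
  unfolding hat_def using hat_rel_unique by (metis someI)

lemma hat_corner:
  assumes "conforming \<T>" "K \<in> \<T>" "corner K p M" "t \<in> cbox 0 1"
  shows "hat \<T> p (affine_map p M t) = hatval t"
  using assms by (intro hat_eqI) (auto simp: hat_rel_def)

lemma convex_parallelepiped: "parallelepiped K \<Longrightarrow> convex K"
proof -
  assume "parallelepiped K"
  then obtain b M where "K = affine_map b M ` cbox 0 1" unfolding parallelepiped_def by blast
  then have "K = (+) b ` ((*v) M ` cbox 0 1)" by (auto simp: affine_map_def image_image)
  then show ?thesis by (simp add: convex_linear_image convex_translation)
qed

lemma compact_parallelepiped: "parallelepiped K \<Longrightarrow> compact K"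
proof -
  assume "parallelepiped K"
  then obtain b M where "K = affine_map b M ` cbox 0 1" unfolding parallelepiped_def by blast
  moreover have "continuous_on UNIV (affine_map b M)" unfolding affine_map_def
    by (intro continuous_intros linear_continuous_on_compose matrix_vector_mul_linear) 
  ultimately show ?thesis by (metis compact_cbox compact_continuous_image continuous_on_subset subset_UNIV)
qed

lemma conforming_single: "parallelepiped K \<Longrightarrow> conforming {K}"
  by (simp add: conforming_def face_of_refl convex_parallelepiped)

lemma verts_iff_face:
  assumes "parallelepiped K"
  shows "p \<in> verts K \<longleftrightarrow> {p} face_of K"
proof
  assume f: "{p} face_of K"
  obtain b M where K: "corner K b M" using assms parallelepiped_corner by blast
  show "p \<in> verts K" using singleton_face_coords[OF K f] verts_eq[OF K] by blast
qed (auto simp: verts_def corner_face)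

text \<open>Without hanging nodes, a vertex of one element is a vertex of every element that contains it:
  extreme points pass to the common face and, since faces of faces are faces, to the other
  element.\<close>
lemma vertex_of_intersecting:
  assumes "conforming \<T>" "K \<in> \<T>" "L \<in> \<T>" "p \<in> verts L" "p \<in> K"
  shows "p \<in> verts K"
proof -
  have f: "{p} face_of L" using assms by (auto simp: verts_def corner_face)
  then have "{p} face_of (K \<inter> L)"
    using assms face_of_imp_subset[OF f] by (intro face_of_subset[OF f]) auto
  then have "{p} face_of K"
    using assms face_of_trans by (metis conforming_def)
  then show ?thesis using assms verts_iff_face by (metis conforming_def)
qed

text \<open>The second case is the substantial one: if \<open>p\<close> is no vertex of \<open>K\<close>, then the basis function
  computed in another element \<open>L\<close> has to vanish on the common face. Otherwise \<open>p\<close> would belong to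
  that face and be a vertex of \<open>K\<close>.\<close>
lemma hat_local:
  assumes T: "conforming \<T>" "K \<in> \<T>" "x \<in> K"
  shows "hat \<T> p x = hat {K} p x"
proof (cases "p \<in> verts K")
  case True
  then obtain M where M: "corner K p M" by (auto simp: verts_def)
  then obtain t where "t \<in> cbox 0 1" "x = affine_map p M t" using T(3) by (auto simp: corner_def)
  moreover have "conforming {K}" using T(1,2) by (intro conforming_single) (simp add: conforming_def)
  ultimately show ?thesis using hat_corner[OF T(1,2) M] hat_corner[OF _ _ M, of "{K}"] by simp
next
  case False
  have "y = 0" if "hat_rel \<T> p x y" for y
  proof -
    from that obtain L M t where L: "L \<in> \<T>" "corner L p M" "t \<in> cbox 0 1" "x = affine_map p M t" "y = hatval t"
      unfolding hat_rel_def by blast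
    show ?thesis
    proof (rule ccontr)
      assume "y \<noteq> 0"
      then have "t $ i \<noteq> 1" for i using L by (auto simp: hatval_def)
      then have t: "t $ i < 1" for i using L(3) unfolding mem_unit_cube by (metis order_less_le)
      have "x \<in> L" using L by (auto simp: corner_def)
      then have "p \<in> K \<inter> L"
        using corner_in_face[OF L(2) _ _ L(3) t, of "K \<inter> L"] T L by (auto simp: conforming_def)
      then show False
        using vertex_of_intersecting[OF T(1,2) L(1), of p] False L(2) by (auto simp: verts_def)
    qed
  qed
  then have "hat \<T> p x = 0" unfolding hat_def by (metis someI)
  moreover have "hat {K} p x = 0" using False by (auto simp: hat_def hat_rel_def verts_def)
  ultimately show ?thesis by simp
qed

lemma hat_off: "p \<notin> verts K \<Longrightarrow> hat {K} p x = 0"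
  by (auto simp: hat_def hat_rel_def verts_def)

lemma corner_parallelepiped: "corner K b M \<Longrightarrow> parallelepiped K"
  using parallelepiped_corner by blast

lemma hat_psi:
  assumes K: "corner K b M" and x: "x \<in> cbox 0 1"
  shows "hat {K} (affine_map b M (ind S)) (affine_map b M x) = psi S x"
proof -
  have "hat {K} (affine_map b M (ind S)) (affine_map (affine_map b M (ind S)) (flip_matrix S M) (flip S x))
     = hatval (flip S x)"
    using x by (intro hat_corner[OF conforming_single[OF corner_parallelepiped[OF K]] _ corner_flip[OF K]]) auto
  then show ?thesis by (simp add: affine_map_flip hatval_flip)
qed

lemma sum_verts_psi:
  assumes K: "corner K b M" and x: "x \<in> cbox 0 1"
  shows "(\<Sum>p\<in>verts K. a p * hat {K} p (affine_map b M x)) = (\<Sum>S\<in>UNIV. a (affine_map b M (ind S)) * psi S x)"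
  using sum.reindex_bij_betw[OF bij_betw_verts[OF K], of "\<lambda>p. a p * hat {K} p (affine_map b M x)"]
  by (simp add: hat_psi[OF K x])

text \<open>A description of the local space that refers to no chart. It makes the local space linear, and
  gives each function of the space by its nodal values.\<close>
lemma Q1_on_iff:
  assumes "parallelepiped K"
  shows "Q1_on K v \<longleftrightarrow> (\<forall>x\<in>K. v x = (\<Sum>p\<in>verts K. v p * hat {K} p x))"
proof
  assume "Q1_on K v"
  then obtain b M c where c: "corner K b M"
    and v: "\<And>x. x \<in> cbox 0 1 \<Longrightarrow> v (affine_map b M x) = (\<Sum>S\<in>UNIV. c S * (\<Prod>i\<in>S. x $ i))"
    unfolding Q1_on_def corner_def by blast
  have "ind T \<in> cbox 0 1" for T :: "'a set" by (auto simp: mem_unit_cube ind_def)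
  then have "v (affine_map b M x) = (\<Sum>p\<in>verts K. v p * hat {K} p (affine_map b M x))" if "x \<in> cbox 0 1" for x
    unfolding sum_verts_psi[OF c that] using that by (simp add: v multilinear_interpolation[of c x])
  then show "\<forall>x\<in>K. v x = (\<Sum>p\<in>verts K. v p * hat {K} p x)" using c by (auto simp: corner_def)
next
  assume v: "\<forall>x\<in>K. v x = (\<Sum>p\<in>verts K. v p * hat {K} p x)"
  obtain b M where c: "corner K b M" using assms parallelepiped_corner by blast
  obtain C :: "'a set \<Rightarrow> 'a set \<Rightarrow> real" where C: "\<And>S x. psi S x = (\<Sum>T\<in>UNIV. C S T * (\<Prod>i\<in>T. x $ i))"
    using psi_multilinear by metis
  define d where "d T = (\<Sum>S\<in>UNIV. v (affine_map b M (ind S)) * C S T)" for T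
  have "v (affine_map b M x) = (\<Sum>S\<in>UNIV. d S * (\<Prod>i\<in>S. x $ i))" if x: "x \<in> cbox 0 1" for x
  proof -
    have "affine_map b M x \<in> K" using c x by (auto simp: corner_def)
    then have "v (affine_map b M x) = (\<Sum>S\<in>UNIV. v (affine_map b M (ind S)) * psi S x)"
      using v sum_verts_psi[OF c x] by simp
    also have "\<dots> = (\<Sum>S\<in>UNIV. \<Sum>T\<in>UNIV. v (affine_map b M (ind S)) * C S T * (\<Prod>i\<in>T. x $ i))"
      by (simp add: C sum_distrib_left mult.assoc)
    also have "\<dots> = (\<Sum>T\<in>UNIV. \<Sum>S\<in>UNIV. v (affine_map b M (ind S)) * C S T * (\<Prod>i\<in>T. x $ i))"
      by (rule sum.swap)
    finally show ?thesis by (simp add: d_def sum_distrib_right)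
  qed
  then show "Q1_on K v" using c unfolding Q1_on_def corner_def by blast
qed

lemma hat_vertex:
  assumes "parallelepiped K" "p \<in> verts K" "q \<in> verts K"
  shows "hat {K} p q = (if p = q then 1 else 0)"
proof -
  obtain b M where c: "corner K b M" using assms parallelepiped_corner by blast
  obtain S T where "p = affine_map b M (ind S)" "q = affine_map b M (ind T)"
    using assms verts_eq[OF c] by auto
  moreover have "ind T \<in> cbox 0 1" by (auto simp: mem_unit_cube ind_def)
  ultimately show ?thesis
    using hat_psi[OF c, of "ind T" S] c by (auto simp: psi_ind corner_def dest: injD[OF inj_ind])
qed

lemma Q1_on_nodal:
  assumes K: "parallelepiped K" and v: "\<And>x. x \<in> K \<Longrightarrow> v x = (\<Sum>p\<in>verts K. a p * hat {K} p x)"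
  shows "Q1_on K v"
proof -
  have "v q = a q" if q: "q \<in> verts K" for q
  proof -
    have "q \<in> K" using q by (auto simp: verts_def corner_mem)
    then have "v q = (\<Sum>p\<in>verts K. a p * (if p = q then 1 else 0))"
      using v hat_vertex[OF K _ q] by simp
    also have "\<dots> = a q" using finite_verts[OF K] q by (simp add: if_distrib cong: if_cong)
    finally show ?thesis .
  qed
  then show ?thesis unfolding Q1_on_iff[OF K] using v by simp
qed

lemma Q1_on_lincomb:
  assumes "parallelepiped K" "Q1_on K v" "Q1_on K w"
  shows "Q1_on K (\<lambda>x. a * v x + b * w x)"
proof (rule Q1_on_nodal[OF assms(1)])
  fix x assume x: "x \<in> K"
  have "v x = (\<Sum>p\<in>verts K. v p * hat {K} p x)" "w x = (\<Sum>p\<in>verts K. w p * hat {K} p x)"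
    using assms x Q1_on_iff[OF assms(1)] by auto
  then show "a * v x + b * w x = (\<Sum>p\<in>verts K. (a * v p + b * w p) * hat {K} p x)"
    by (simp add: algebra_simps sum.distrib sum_distrib_left)
qed

lemma matrix_inv:
  fixes M :: "real^'n^'n"
  assumes "invertible M"
  shows "matrix_inv M ** M = mat 1" "M ** matrix_inv M = mat 1"
  using someI_ex[OF assms[unfolded invertible_def]] by (simp_all add: matrix_inv_def)

lemma hat_formula:
  assumes c: "corner K p M" and x: "x \<in> K"
  shows "hat {K} p x = hatval (matrix_inv M *v (x - p))"
    and "matrix_inv M *v (x - p) \<in> cbox 0 1"
proof -
  obtain t where t: "t \<in> cbox 0 1" "x = affine_map p M t" using c x by (auto simp: corner_def)
  have "matrix_inv M ** M = mat 1" using c matrix_inv[of M] by (simp add: corner_def)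
  then have "matrix_inv M *v (x - p) = t"
    using t by (simp add: affine_map_def matrix_vector_mul_assoc)
  then show "hat {K} p x = hatval (matrix_inv M *v (x - p))" "matrix_inv M *v (x - p) \<in> cbox 0 1"
    using hat_corner[OF conforming_single[OF corner_parallelepiped[OF c]] _ c t(1)] t by auto
qed

lemma hat_range:
  assumes "x \<in> K"
  shows "0 \<le> hat {K} p x \<and> hat {K} p x \<le> 1"
proof (cases "p \<in> verts K")
  case True
  then obtain M where c: "corner K p M" by (auto simp: verts_def)
  show ?thesis unfolding hat_formula(1)[OF c assms] by (rule hatval_range[OF hat_formula(2)[OF c assms]])
qed (simp add: hat_off)

lemma continuous_on_hatval_affine:
  "continuous_on S (\<lambda>x. hatval (N *v (x - p)))"
  unfolding hatval_def matrix_vector_mult_def by (intro continuous_intros)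

lemma continuous_on_hat: "continuous_on K (hat {K} p)"
proof (cases "p \<in> verts K")
  case True
  then obtain M where c: "corner K p M" by (auto simp: verts_def)
  show ?thesis
    by (rule continuous_on_eq[OF continuous_on_hatval_affine]) (simp add: hat_formula(1)[OF c])
qed (simp add: hat_off)

section \<open>Boundary values of the nodal basis functions\<close>

text \<open>The domain lies locally on one side of its boundary: below a boundary point, on the line in
  direction \<open>e\<close>, there are interior points of the complement. This excludes slits, where functions
  of the finite element space would have to vanish inside the closure.\<close>
lemma lipschitz_boundary_interior_closure:
  assumes "open \<Omega>" "lipschitz_boundary \<Omega>"
  shows "interior (closure \<Omega>) = \<Omega>"
proof (rule ccontr)
  assume "interior (closure \<Omega>) \<noteq> \<Omega>"
  then obtain x where x: "x \<in> interior (closure \<Omega>)" "x \<notin> \<Omega>"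
    using assms(1) interior_maximal[OF closure_subset] by blast
  then have "x \<in> frontier \<Omega>" using assms(1) interior_subset by (auto simp: frontier_def interior_open)
  then obtain e r L \<phi> where e: "norm e = 1" and r: "0 < r" and lip: "L-lipschitz_on UNIV \<phi>"
    and \<phi>: "\<And>y. y \<in> ball x r \<Longrightarrow> y \<in> \<Omega> \<longleftrightarrow> \<phi> (y - (y \<bullet> e) *\<^sub>R e) < y \<bullet> e"
    using assms(2) unfolding lipschitz_boundary_def by blast
  obtain d where d: "0 < d" "ball x d \<subseteq> closure \<Omega>" using x(1) mem_interior by blast
  define s where "s = min d r / 2"
  have s: "0 < s" "s < d" "s < r" using d r by (auto simp: s_def)
  have ee: "e \<bullet> e = 1" using e by (simp add: dot_square_norm)
  let ?y = "x - s *\<^sub>R e"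
  let ?g = "\<lambda>z. \<phi> (z - (z \<bullet> e) *\<^sub>R e) - z \<bullet> e"
  have "continuous_on UNIV ?g"
    by (intro continuous_intros continuous_on_compose2[OF lipschitz_on_continuous_on[OF lip]]) auto
  then have op: "open {z. 0 < ?g z}"
    using open_Collect_less[of "\<lambda>_. 0" ?g] by (simp add: continuous_on_const)
  have proj: "?y - (?y \<bullet> e) *\<^sub>R e = x - (x \<bullet> e) *\<^sub>R e" by (simp add: inner_diff_left ee algebra_simps)
  have "x \<bullet> e \<le> \<phi> (x - (x \<bullet> e) *\<^sub>R e)" using \<phi>[of x] r x(2) by auto
  then have "?y \<in> {z. 0 < ?g z}"
    unfolding mem_Collect_eq proj using s by (simp add: inner_diff_left ee)
  moreover have "?y \<in> ball x r" "?y \<in> ball x d" using s e by (auto simp: dist_norm)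
  ultimately have "?y \<in> {z. 0 < ?g z} \<inter> ball x r" "?y \<in> closure \<Omega>" using d by auto
  moreover have "({z. 0 < ?g z} \<inter> ball x r) \<inter> \<Omega> = {}" using \<phi> by force
  moreover have "open ({z. 0 < ?g z} \<inter> ball x r)" using op by auto
  ultimately show False using open_Int_closure_eq_empty by blast
qed

text \<open>Points \<open>z\<close> close to \<open>p\<close> on the segment to \<open>x\<close> are surrounded by elements
  that contain \<open>z\<close>, and each of these contains the whole segment, because its intersection with the
  element of \<open>x\<close> is a face with a point in the relative interior of the segment. In the chart of
  such an element at \<open>p\<close> all coordinates of \<open>x\<close> are smaller than one, as the basis function does
  not vanish there; hence small translations that keep \<open>z\<close> in the element also keep \<open>x\<close> in it. So
  the elements that surround \<open>z\<close> also surround \<open>x\<close>.\<close>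
lemma interior_point_if_hat_nonzero:
  assumes T: "conforming \<T>" "finite \<T>" and p: "p \<in> interior (\<Union>\<T>)" and nz: "hat \<T> p x \<noteq> 0"
  shows "x \<in> interior (\<Union>\<T>)"
proof (cases "x = p")
  case False
  obtain L0 M0 t0 where L0: "L0 \<in> \<T>" "corner L0 p M0" "t0 \<in> cbox 0 1" "x = affine_map p M0 t0"
    using nz unfolding hat_def hat_rel_def by (metis (no_types, lifting))
  then have xL0: "x \<in> L0" by (auto simp: corner_def)
  obtain r where r: "0 < r" "ball p r \<subseteq> \<Union>\<T>" using p mem_interior by blast
  define s where "s = min (1/2) (r / (2 * norm (x - p)))"
  have s: "0 < s" "s < 1" using r False by (auto simp: s_def min_less_iff_disj)
  define z where "z = p + s *\<^sub>R (x - p)"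
  have "norm (s *\<^sub>R (x - p)) < r"
  proof -
    have "s * norm (x - p) \<le> r / (2 * norm (x - p)) * norm (x - p)"
      by (intro mult_right_mono) (auto simp: s_def)
    also have "\<dots> < r" using False r by simp
    finally show ?thesis using s by simp
  qed
  then have zb: "z \<in> ball p r" by (simp add: z_def dist_norm)
  have zseg: "z \<in> open_segment p x"
    using s False unfolding in_segment z_def by (intro conjI exI[of _ s]) (auto simp: algebra_simps)
  have loc: "\<forall>\<^sub>F v in nhds 0. z + v \<in> L \<longrightarrow> x + v \<in> L" if L: "L \<in> \<T>" for L
  proof (cases "z \<in> L")
    case True
    have "(L0 \<inter> L) face_of L0" using T L L0 by (auto simp: conforming_def)
    moreover have "z \<in> L0"
    proof -
      have "open_segment p x \<subseteq> L0"
        using xL0 corner_mem[OF L0(2)] convex_parallelepiped[OF corner_parallelepiped[OF L0(2)]]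
        by (meson convex_contains_segment open_closed_segment order_trans subsetI)
      then show ?thesis using zseg by blast
    qed
    ultimately have pxL: "p \<in> L" "x \<in> L"
      using face_ofD[OF _ zseg, of "L0 \<inter> L" L0] True xL0 corner_mem[OF L0(2)] by auto
    then obtain M where c: "corner L p M"
      using vertex_of_intersecting[OF T(1) L L0(1)] L0(2) by (auto simp: verts_def)
    obtain t where t: "t \<in> cbox 0 1" "x = affine_map p M t" using pxL c by (auto simp: corner_def)
    then have "hatval t \<noteq> 0" using hat_corner[OF T(1) L c] nz by simp
    then have "t $ i \<noteq> 1" for i by (auto simp: hatval_def)
    then have t1: "t $ i < 1" for i using t unfolding mem_unit_cube by (metis order_less_le)
    have inv: "matrix_inv M ** M = mat 1" "M ** matrix_inv M = mat 1"
      using c matrix_inv[of M] by (simp_all add: corner_def)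
    have "\<forall>\<^sub>F v in nhds 0. (matrix_inv M *v v) $ i < 1 - t $ i" for i
    proof -
      have "((\<lambda>v. (matrix_inv M *v v) $ i) \<longlongrightarrow> (matrix_inv M *v 0) $ i) (nhds 0)"
        unfolding matrix_vector_mult_def
        by (intro tendsto_intros filterlim_ident)
      then show ?thesis using t1[of i] by (intro order_tendstoD(2)) auto
    qed
    then have "\<forall>\<^sub>F v in nhds 0. \<forall>i. (matrix_inv M *v v) $ i < 1 - t $ i"
      by (rule eventually_all_finite)
    then show ?thesis
    proof eventually_elim
      case (elim v)
      show ?case
      proof
        assume "z + v \<in> L"
        then obtain \<tau> where \<tau>: "\<tau> \<in> cbox 0 1" "z + v = affine_map p M \<tau>" using c by (auto simp: corner_def)
        let ?\<mu> = "matrix_inv M *v v"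
        have "M *v \<tau> = s *\<^sub>R (M *v t) + v" using \<tau>(2) t(2) by (simp add: z_def affine_map_def)
        then have "matrix_inv M *v (M *v \<tau>) = s *\<^sub>R (matrix_inv M *v (M *v t)) + ?\<mu>"
          by (simp add: matrix_vector_right_distrib matrix_vector_mult_scaleR)
        then have \<tau>eq: "\<tau> = s *\<^sub>R t + ?\<mu>" by (simp add: matrix_vector_mul_assoc inv)
        have "t + ?\<mu> \<in> cbox 0 1"
        proof (unfold mem_unit_cube, intro allI conjI)
          fix i
          have "0 \<le> \<tau> $ i" using \<tau>(1) by (simp add: mem_unit_cube)
          then have "0 \<le> s * t $ i + ?\<mu> $ i" unfolding \<tau>eq by simp
          moreover have "s * t $ i \<le> 1 * t $ i" using t s unfolding mem_unit_cube by (intro mult_right_mono) auto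
          ultimately show "0 \<le> (t + ?\<mu>) $ i" by simp
          show "(t + ?\<mu>) $ i \<le> 1" using elim[rule_format, of i] by simp
        qed
        moreover have "x + v = affine_map p M (t + ?\<mu>)"
          using t(2) by (simp add: affine_map_def matrix_vector_right_distrib matrix_vector_mul_assoc inv)
        ultimately show "x + v \<in> L" using c by (auto simp: corner_def)
      qed
    qed
  next
    case False
    have "open (- L)" using T(1) L compact_parallelepiped compact_imp_closed by (auto simp: conforming_def)
    moreover have "((\<lambda>v. z + v) \<longlongrightarrow> z + 0) (nhds 0)" by (intro tendsto_intros filterlim_ident)
    ultimately have "\<forall>\<^sub>F v in nhds 0. z + v \<in> - L" using False by (intro topological_tendstoD) auto
    then show ?thesis by eventually_elim auto
  qed
  have "\<forall>\<^sub>F v in nhds 0. \<forall>L\<in>\<T>. z + v \<in> L \<longrightarrow> x + v \<in> L"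
    using loc by (intro eventually_ball_finite T(2)) auto
  moreover have "\<forall>\<^sub>F v in nhds 0. z + v \<in> ball p r"
  proof -
    have "((\<lambda>v. z + v) \<longlongrightarrow> z + 0) (nhds 0)" by (intro tendsto_intros filterlim_ident)
    then show ?thesis using zb by (intro topological_tendstoD) auto
  qed
  ultimately have "\<forall>\<^sub>F v in nhds 0. x + v \<in> \<Union>\<T>"
    by eventually_elim (use r in blast)
  then obtain d where d: "0 < d" "\<And>v. dist v 0 < d \<Longrightarrow> x + v \<in> \<Union>\<T>"
    unfolding eventually_nhds_metric by blast
  have "ball x d \<subseteq> \<Union>\<T>"
  proof
    fix y assume "y \<in> ball x d"
    then have "x + (y - x) \<in> \<Union>\<T>" by (intro d) (simp add: dist_norm norm_minus_commute)
    then show "y \<in> \<Union>\<T>" by simp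
  qed
  then show ?thesis using d(1) mem_interior by blast
qed (use p in simp)

text \<open>On the boundary of the domain the basis function is zero by the preceding two lemmas, so that
  extension by zero is continuous.\<close>
lemma hat_in_Q1_space:
  assumes \<Omega>: "open \<Omega>" "lipschitz_boundary \<Omega>" and T: "conforming \<T>" "finite \<T>" "\<Union>\<T> = closure \<Omega>"
    and p: "p \<in> \<Omega>"
  shows "hat \<T> p \<in> Q1_space \<Omega> \<T>"
proof -
  have int: "interior (\<Union>\<T>) = \<Omega>" using lipschitz_boundary_interior_closure[OF \<Omega>] T(3) by simp
  have zero: "hat \<T> p x = 0" if "x \<notin> \<Omega>" for x
    using interior_point_if_hat_nonzero[OF T(1,2), of p x] that p int by auto
  have par: "parallelepiped K" if "K \<in> \<T>" for K using T(1) that by (simp add: conforming_def)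
  have "continuous_on (\<Union>K\<in>\<T>. K) (hat \<T> p)"
  proof (rule continuous_on_closed_Union[OF T(2)])
    fix K assume K: "K \<in> \<T>"
    show "closed K" using par[OF K] compact_parallelepiped compact_imp_closed by blast
    show "continuous_on K (hat \<T> p)"
      using continuous_on_hat[of K p] by (rule continuous_on_eq) (simp add: hat_local[OF T(1) K])
  qed
  moreover have "continuous_on (- \<Omega>) (hat \<T> p)"
    using continuous_on_const[of "- \<Omega>" 0] by (rule continuous_on_eq) (simp add: zero)
  moreover have "(\<Union>K\<in>\<T>. K) \<union> - \<Omega> = UNIV" using T(3) closure_subset by auto
  ultimately have "continuous_on UNIV (hat \<T> p)"
    using continuous_on_closed_Un[of "\<Union>K\<in>\<T>. K" "- \<Omega>"] \<Omega>(1) T(3) by auto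
  moreover have "Q1_on K (hat \<T> p)" if K: "K \<in> \<T>" for K
  proof (rule Q1_on_nodal[OF par[OF K]])
    fix x assume "x \<in> K"
    have "(\<Sum>q\<in>verts K. (if q = p then 1 else 0) * hat {K} q x) = hat {K} p x"
      using finite_verts[OF par[OF K]] hat_off[of p K x]
      by (cases "p \<in> verts K") (auto simp: if_distrib[of "\<lambda>c. c * _"] cong: if_cong)
    then show "hat \<T> p x = (\<Sum>q\<in>verts K. (if q = p then 1 else 0) * hat {K} q x)"
      using hat_local[OF T(1) K \<open>x \<in> K\<close>] by simp
  qed
  ultimately show ?thesis using zero by (simp add: Q1_space_def)
qed

section \<open>Estimates on a single element\<close>

lemma psi_near_corner:
  fixes t :: "real^'d"
  assumes "t \<in> cbox 0 1" "\<And>i. t $ i \<le> \<theta>"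
  shows "\<bar>psi S t - psi S 0\<bar> \<le> real CARD('d) * \<theta>"
proof -
  let ?f = "\<lambda>t i. if i \<in> S then t $ i else 1 - t $ i"
  have "norm ((\<Prod>i\<in>UNIV. ?f t i) - (\<Prod>i\<in>UNIV. ?f 0 i)) \<le> (\<Sum>i\<in>UNIV. norm (?f t i - ?f 0 i))"
    using assms(1) unfolding mem_unit_cube by (intro norm_prod_diff) auto
  also have "\<dots> \<le> (\<Sum>i\<in>(UNIV :: 'd set). \<theta>)"
    using assms unfolding mem_unit_cube by (intro sum_mono) auto
  finally show ?thesis by (simp add: psi_conv)
qed

text \<open>The ratio for which the values of a function of the local space on the element, shrunk towards
  the vertex with the largest nodal value, differ from that value by at most one half of it. There
  are \<open>2\<^sup>d\<close> nodal values, and each basis function varies by at most \<open>d \<theta>\<close> on the shrunk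
  element.\<close>
definition shrink_ratio :: "nat \<Rightarrow> real" where
  "shrink_ratio d = 1 / (2 * real d * 2 ^ d)"

lemma near_vertex_lower_bound:
  fixes K :: "(real^'d) set"
  assumes c: "corner K p M" and v: "Q1_on K v"
    and max: "\<And>q. q \<in> verts K \<Longrightarrow> \<bar>v q\<bar> \<le> \<bar>v p\<bar>" and x: "x \<in> K"
  shows "\<bar>v p\<bar> / 2 \<le> \<bar>v (p + shrink_ratio CARD('d) *\<^sub>R (x - p))\<bar>"
proof -
  let ?d = "CARD('d)" and ?\<theta> = "shrink_ratio CARD('d)"
  have par: "parallelepiped K" using c corner_parallelepiped by blast
  have d: "0 < ?d" by simp
  have \<theta>: "0 < ?\<theta>" "?\<theta> \<le> 1"
  proof -
    have "1 * 1 \<le> real ?d * 2 ^ ?d" using d by (intro mult_mono) auto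
    then show "0 < ?\<theta>" "?\<theta> \<le> 1" by (auto simp: shrink_ratio_def divide_le_eq)
  qed
  obtain t where t: "t \<in> cbox 0 1" "x = affine_map p M t" using x c by (auto simp: corner_def)
  have st: "?\<theta> *\<^sub>R t \<in> cbox 0 1"
    using t(1) \<theta> unfolding mem_unit_cube by (auto intro: mult_le_one)
  have eq: "p + ?\<theta> *\<^sub>R (x - p) = affine_map p M (?\<theta> *\<^sub>R t)"
    using t(2) by (simp add: affine_map_def matrix_vector_mult_scaleR)
  have nod: "v (affine_map p M s) = (\<Sum>S\<in>UNIV. v (affine_map p M (ind S)) * psi S s)" if "s \<in> cbox 0 1" for s
  proof -
    have "affine_map p M s \<in> K" using that c by (auto simp: corner_def)
    then show ?thesis using v Q1_on_iff[OF par] sum_verts_psi[OF c that] by simp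
  qed
  have "v (affine_map p M (?\<theta> *\<^sub>R t)) - v (affine_map p M 0)
      = (\<Sum>S\<in>UNIV. v (affine_map p M (ind S)) * (psi S (?\<theta> *\<^sub>R t) - psi S 0))"
    using nod[OF st] nod[of 0] by (simp add: mem_unit_cube sum_subtractf right_diff_distrib)
  also have "\<bar>\<dots>\<bar> \<le> (\<Sum>S\<in>UNIV. \<bar>v (affine_map p M (ind S)) * (psi S (?\<theta> *\<^sub>R t) - psi S 0)\<bar>)"
    by (rule sum_abs)
  also have "\<dots> \<le> (\<Sum>S\<in>(UNIV :: 'd set set). \<bar>v p\<bar> * (real ?d * ?\<theta>))"
  proof (rule sum_mono)
    fix S :: "'d set"
    have "affine_map p M (ind S) \<in> verts K" using verts_eq[OF c] by auto
    moreover have "(?\<theta> *\<^sub>R t) $ i \<le> ?\<theta>" for i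
      using t(1) \<theta> unfolding mem_unit_cube by (auto intro: mult_left_le)
    ultimately show "\<bar>v (affine_map p M (ind S)) * (psi S (?\<theta> *\<^sub>R t) - psi S 0)\<bar> \<le> \<bar>v p\<bar> * (real ?d * ?\<theta>)"
      unfolding abs_mult using psi_near_corner[OF st, of ?\<theta> S] max by (intro mult_mono) auto
  qed
  also have "\<dots> = \<bar>v p\<bar> / 2"
    using d by (simp add: shrink_ratio_def card_UNIV_set field_simps)
  finally have "\<bar>v (affine_map p M (?\<theta> *\<^sub>R t)) - v p\<bar> \<le> \<bar>v p\<bar> / 2" by simp
  then show ?thesis unfolding eq by linarith
qed

lemma bounded_measurable_integrable:
  fixes f :: "'a::euclidean_space \<Rightarrow> real"
  assumes "S \<in> lmeasurable" "f \<in> borel_measurable (lebesgue_on S)" "AE x in lebesgue_on S. \<bar>f x\<bar> \<le> B"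
  shows "integrable (lebesgue_on S) f"
  using finite_measure.integrable_const_bound[OF finite_measure_lebesgue_on[OF assms(1)], of f B] assms by simp

lemma continuous_bounded_integrable:
  fixes f :: "'a::euclidean_space \<Rightarrow> real"
  assumes "S \<in> lmeasurable" "bounded S" "continuous_on UNIV f"
  shows "integrable (lebesgue_on S) f"
proof -
  have "compact (f ` closure S)"
    using assms compact_closure by (intro compact_continuous_image continuous_on_subset[OF assms(3)]) auto
  then obtain B where "\<And>x. x \<in> closure S \<Longrightarrow> norm (f x) \<le> B"
    by (metis bounded_iff compact_imp_bounded imageI)
  then have "\<bar>f x\<bar> \<le> B" if "x \<in> S" for x using that closure_subset by auto
  then show ?thesis
    using assms(1) continuous_on_subset[OF assms(3)]
    by (intro bounded_measurable_integrable[of _ _ B] continuous_imp_measurable_on_sets_lebesgue AE_I2)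
      (auto simp: space_restrict_space)
qed

definition nodal_const :: "nat \<Rightarrow> real" where
  "nodal_const d = 4 * 4 ^ d / shrink_ratio d ^ d"

text \<open>The shrunk element has the fixed share \<open>shrink_ratio d ^ d\<close> of the measure of \<open>K\<close>, and on it the
  function is at least half the largest nodal value. Only a homothety of \<open>K\<close> enters, so the constant
  does not depend on the shape of the element.\<close>
lemma nodal_values_bound:
  fixes K :: "(real^'d) set"
  assumes par: "parallelepiped K" and v: "Q1_on K v" "continuous_on UNIV v"
  shows "(\<Sum>p\<in>verts K. \<bar>v p\<bar>)\<^sup>2 * measure lebesgue (interior K)
    \<le> nodal_const CARD('d) * (\<integral>x. (v x)\<^sup>2 \<partial>lebesgue_on (interior K))"
proof -
  let ?d = "CARD('d)" and ?\<theta> = "shrink_ratio CARD('d)" and ?m = "measure lebesgue (interior K)"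
  have \<theta>: "0 < ?\<theta>" "?\<theta> \<le> 1"
  proof -
    have "1 * 1 \<le> real ?d * 2 ^ ?d" by (intro mult_mono) auto
    then show "0 < ?\<theta>" "?\<theta> \<le> 1" by (auto simp: shrink_ratio_def divide_le_eq)
  qed
  have fin: "finite (verts K)" using finite_verts[OF par] .
  have ne: "verts K \<noteq> {}" using par by (auto simp: parallelepiped_corner verts_def)
  obtain p where p: "p \<in> verts K" and max: "\<And>q. q \<in> verts K \<Longrightarrow> \<bar>v q\<bar> \<le> \<bar>v p\<bar>"
  proof -
    let ?I = "(\<lambda>q. \<bar>v q\<bar>) ` verts K"
    have "Max ?I \<in> ?I" using fin ne by (intro Max_in) auto
    then obtain p where "p \<in> verts K" "Max ?I = \<bar>v p\<bar>" by blast
    moreover have "\<bar>v q\<bar> \<le> Max ?I" if "q \<in> verts K" for q using fin that by (intro Max_ge) auto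
    ultimately show ?thesis using that by metis
  qed
  obtain M where c: "corner K p M" using p by (auto simp: verts_def)
  have bd: "bounded K" using compact_parallelepiped[OF par] compact_imp_bounded by blast
  have lm: "interior K \<in> lmeasurable" using lmeasurable_interior[OF bd] .
  \<comment> \<open>the interior of \<open>K\<close>, shrunk towards the vertex \<open>p\<close> with the largest nodal value\<close>
  define H where "H = (\<lambda>x. ?\<theta> *\<^sub>R x + (1 - ?\<theta>) *\<^sub>R p) ` interior K"
  have Hform: "?\<theta> *\<^sub>R x + (1 - ?\<theta>) *\<^sub>R p = p + ?\<theta> *\<^sub>R (x - p)" for x by (simp add: algebra_simps)
  have Hsub: "H \<subseteq> interior K"
  proof
    fix y assume "y \<in> H"
    then obtain x where x: "x \<in> interior K" "y = p + ?\<theta> *\<^sub>R (x - p)" unfolding H_def Hform by blast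
    have *: "p - ?\<theta> *\<^sub>R (p - x) \<in> interior K"
      using mem_interior_convex_shrink[OF convex_parallelepiped[OF par] x(1) corner_mem[OF c] \<theta>] .
    have "y = p - ?\<theta> *\<^sub>R (p - x)" unfolding x(2) by (simp add: algebra_simps)
    then show "y \<in> interior K" using * by simp
  qed
  have Hlow: "(v p)\<^sup>2 / 4 \<le> (v y)\<^sup>2" if yH: "y \<in> H" for y
  proof -
    obtain x where x: "x \<in> interior K" "y = p + ?\<theta> *\<^sub>R (x - p)" using yH unfolding H_def Hform by blast
    then have "\<bar>v p\<bar> / 2 \<le> \<bar>v y\<bar>" using near_vertex_lower_bound[OF c v(1) max, of x] interior_subset by blast
    then have "(\<bar>v p\<bar> / 2)\<^sup>2 \<le> \<bar>v y\<bar>\<^sup>2" by (intro power_mono) auto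
    then show ?thesis by (simp add: power_divide)
  qed
  have Hopen: "open H"
  proof -
    have "H = (+) ((1 - ?\<theta>) *\<^sub>R p) ` ((*\<^sub>R) ?\<theta> ` interior K)"
      by (auto simp: H_def image_image add.commute)
    then show ?thesis using \<theta> by (simp add: open_scaling open_translation)
  qed
  have Hm: "H \<in> lmeasurable" using Hopen Hsub bd by (meson bounded_subset interior_subset lmeasurable_open)
  have "measure lebesgue H = ?\<theta> ^ ?d * ?m"
    using \<theta> by (simp add: H_def measure_lebesgue_affine)
  then have "(v p)\<^sup>2 / 4 * (?\<theta> ^ ?d * ?m) = (\<integral>x. (v p)\<^sup>2 / 4 * indicator H x \<partial>lebesgue_on (interior K))"
    using Hsub Hm lm by (simp add: measure_restrict_space inf_absorb1 fmeasurableD space_restrict_space)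
  also have "\<dots> \<le> (\<integral>x. (v x)\<^sup>2 \<partial>lebesgue_on (interior K))"
  proof (rule integral_mono)
    show "integrable (lebesgue_on (interior K)) (\<lambda>x. (v x)\<^sup>2)"
      using bd by (intro continuous_bounded_integrable lm continuous_intros v bounded_interior)
    have "H \<in> sets (lebesgue_on (interior K))" using Hsub Hm lm by (simp add: sets_restrict_space_iff fmeasurableD)
    then show "integrable (lebesgue_on (interior K)) (\<lambda>x. (v p)\<^sup>2 / 4 * indicator H x)"
      by (intro bounded_measurable_integrable[OF lm, of _ "(v p)\<^sup>2 / 4"] AE_I2) (auto simp: indicator_def)
  qed (use Hlow in \<open>auto simp: indicator_def\<close>)
  finally have main: "(v p)\<^sup>2 / 4 * (?\<theta> ^ ?d * ?m) \<le> (\<integral>x. (v x)\<^sup>2 \<partial>lebesgue_on (interior K))" .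
  have "(\<Sum>q\<in>verts K. \<bar>v q\<bar>) \<le> real (card (verts K)) * \<bar>v p\<bar>" by (rule sum_bounded_above) (rule max)
  moreover have "card (verts K) = 2 ^ ?d"
    using bij_betw_same_card[OF bij_betw_verts[OF c]] by (simp add: card_UNIV_set)
  ultimately have "(\<Sum>q\<in>verts K. \<bar>v q\<bar>)\<^sup>2 \<le> (2 ^ ?d * \<bar>v p\<bar>)\<^sup>2" by (intro power_mono sum_nonneg) auto
  also have "\<dots> = 4 ^ ?d * (v p)\<^sup>2"
  proof -
    have "(2 ^ ?d)\<^sup>2 = (4 :: real) ^ ?d" by (simp add: power2_eq_square flip: power_mult_distrib)
    then show ?thesis by (simp add: power_mult_distrib)
  qed
  finally have "(\<Sum>q\<in>verts K. \<bar>v q\<bar>)\<^sup>2 * ?m \<le> 4 ^ ?d * (v p)\<^sup>2 * ?m" by (intro mult_right_mono) auto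
  also have "\<dots> = nodal_const ?d * ((v p)\<^sup>2 / 4 * (?\<theta> ^ ?d * ?m))"
    using \<theta> by (simp add: nodal_const_def)
  also have "\<dots> \<le> nodal_const ?d * (\<integral>x. (v x)\<^sup>2 \<partial>lebesgue_on (interior K))"
    using main \<theta> by (intro mult_left_mono) (auto simp: nodal_const_def)
  finally show ?thesis .
qed

text \<open>A coordinate of the chart takes values in \<open>[0,1]\<close> on the ball, so it increases by at most one
  along a diameter.\<close>
lemma chart_coordinate_lipschitz:
  assumes c: "corner K p M" and ball: "cball z \<rho> \<subseteq> K" "0 < \<rho>"
  shows "\<bar>(matrix_inv M *v w) $ i\<bar> \<le> norm w / (2 * \<rho>)"
proof (cases "w = 0")
  case False
  let ?N = "matrix_inv M"
  define u where "u = (\<rho> / norm w) *\<^sub>R w"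
  have "norm u = \<rho>" using False ball by (simp add: u_def)
  then have "z + u \<in> K" "z - u \<in> K" using ball by (auto simp: subset_iff dist_norm)
  then have "?N *v (z + u - p) \<in> cbox 0 1" "?N *v (z - u - p) \<in> cbox 0 1"
    using hat_formula(2)[OF c] by auto
  then have "\<bar>(?N *v (z + u - p)) $ i - (?N *v (z - u - p)) $ i\<bar> \<le> 1"
    unfolding mem_unit_cube by (smt (verit))
  moreover have "?N *v (z + u - p) - ?N *v (z - u - p) = (2 * \<rho> / norm w) *\<^sub>R (?N *v w)"
    by (simp add: u_def algebra_simps matrix_vector_mult_scaleR flip: matrix_vector_mult_diff_distrib scaleR_add_left)
  ultimately have "\<bar>((2 * \<rho> / norm w) *\<^sub>R (?N *v w)) $ i\<bar> \<le> 1"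
    by (simp only: flip: vector_minus_component)
  then have "\<bar>(2 * \<rho> / norm w) * (?N *v w) $ i\<bar> \<le> 1"
    by (simp only: real_scaleR_def vector_scaleR_component)
  then show ?thesis using False ball by (simp add: abs_mult field_simps)
qed simp

lemma hat_lipschitz:
  fixes K :: "(real^'d) set"
  assumes ball: "cball z \<rho> \<subseteq> K" "0 < \<rho>" and xy: "x \<in> K" "y \<in> K"
  shows "\<bar>hat {K} p x - hat {K} p y\<bar> \<le> real CARD('d) / (2 * \<rho>) * norm (x - y)"
proof (cases "p \<in> verts K")
  case True
  then obtain M where c: "corner K p M" by (auto simp: verts_def)
  let ?s = "matrix_inv M *v (x - p)" and ?t = "matrix_inv M *v (y - p)"
  have "norm (hatval ?s - hatval ?t) \<le> (\<Sum>i\<in>UNIV. norm ((1 - ?s $ i) - (1 - ?t $ i)))"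
    unfolding hatval_def using hat_formula(2)[OF c xy(1)] hat_formula(2)[OF c xy(2)]
    unfolding mem_unit_cube by (intro norm_prod_diff) auto
  also have "\<dots> \<le> (\<Sum>i\<in>(UNIV :: 'd set). norm (x - y) / (2 * \<rho>))"
  proof (rule sum_mono)
    fix i
    have "matrix_inv M *v (y - p) - matrix_inv M *v (x - p) = matrix_inv M *v (y - x)"
      by (simp flip: matrix_vector_mult_diff_distrib)
    then have "(1 - ?s $ i) - (1 - ?t $ i) = (matrix_inv M *v (y - x)) $ i"
      by (simp flip: vector_minus_component)
    then show "norm ((1 - ?s $ i) - (1 - ?t $ i)) \<le> norm (x - y) / (2 * \<rho>)"
      using chart_coordinate_lipschitz[OF c ball, of "y - x" i] by (simp add: norm_minus_commute)
  qed
  finally show ?thesis by (simp add: hat_formula(1)[OF c] xy)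
qed (use ball in \<open>simp add: hat_off\<close>)

lemma nodal_sup_bound:
  assumes v: "\<And>x. x \<in> K \<Longrightarrow> v x = (\<Sum>p\<in>verts K. a p * hat {K} p x)" and x: "x \<in> K"
  shows "\<bar>v x\<bar> \<le> (\<Sum>p\<in>verts K. \<bar>a p\<bar>)"
proof -
  have "\<bar>v x\<bar> \<le> (\<Sum>p\<in>verts K. \<bar>a p * hat {K} p x\<bar>)" unfolding v[OF x] by (rule sum_abs)
  also have "\<dots> \<le> (\<Sum>p\<in>verts K. \<bar>a p\<bar>)"
    using hat_range[OF x] by (intro sum_mono) (simp add: abs_mult mult_left_le)
  finally show ?thesis .
qed

lemma nodal_lipschitz_bound:
  fixes K :: "(real^'d) set"
  assumes v: "\<And>x. x \<in> K \<Longrightarrow> v x = (\<Sum>p\<in>verts K. a p * hat {K} p x)"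
    and ball: "cball z \<rho> \<subseteq> K" "0 < \<rho>" and xy: "x \<in> K" "y \<in> K"
  shows "\<bar>v x - v y\<bar> \<le> (\<Sum>p\<in>verts K. \<bar>a p\<bar>) * (real CARD('d) / (2 * \<rho>)) * norm (x - y)"
proof -
  have "\<bar>v x - v y\<bar> = \<bar>\<Sum>p\<in>verts K. a p * (hat {K} p x - hat {K} p y)\<bar>"
    by (simp add: v xy right_diff_distrib sum_subtractf)
  also have "\<dots> \<le> (\<Sum>p\<in>verts K. \<bar>a p * (hat {K} p x - hat {K} p y)\<bar>)" by (rule sum_abs)
  also have "\<dots> \<le> (\<Sum>p\<in>verts K. \<bar>a p\<bar> * (real CARD('d) / (2 * \<rho>) * norm (x - y)))"
    unfolding abs_mult using hat_lipschitz[OF ball xy] by (intro sum_mono mult_left_mono) auto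
  also have "\<dots> = (\<Sum>p\<in>verts K. \<bar>a p\<bar>) * (real CARD('d) / (2 * \<rho>) * norm (x - y))"
    by (rule sum_distrib_right[symmetric])
  finally show ?thesis by (simp only: mult.assoc)
qed

text \<open>Difference quotients along a fixed sequence of steps. They serve twice: they carry Lipschitz
  bounds over to the gradient, and they show that the gradient is measurable.\<close>
lemma grad_component_limit:
  fixes v :: "real^'d \<Rightarrow> real"
  assumes "v differentiable (at x)"
  shows "(\<lambda>n. (v (x + (1 / real (Suc n)) *\<^sub>R axis i 1) - v x) / (1 / real (Suc n))) \<longlonglongrightarrow> grad v x $ i"
proof -
  let ?D = "frechet_derivative v (at x)"
  have D: "(v has_derivative ?D) (at x)" using assms frechet_derivative_works by blast
  have "((\<lambda>s. v (x + s *\<^sub>R axis i 1)) has_derivative (\<lambda>s. ?D (s *\<^sub>R axis i 1))) (at 0)"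
    by (rule has_derivative_compose[where g = v and f = "\<lambda>s. x + s *\<^sub>R axis i 1"])
      (auto intro!: derivative_eq_intros simp: D)
  moreover have "?D (s *\<^sub>R axis i 1) = ?D (axis i 1) * s" for s
    using linear_scale[OF has_derivative_linear[OF D]] by simp
  ultimately have "((\<lambda>s. v (x + s *\<^sub>R axis i 1)) has_field_derivative ?D (axis i 1)) (at 0)"
    by (simp add: has_field_derivative_def)
  then have "((\<lambda>s. (v (x + s *\<^sub>R axis i 1) - v x) / s) \<longlongrightarrow> ?D (axis i 1)) (at 0)"
    by (simp add: DERIV_def)
  moreover have "filterlim (\<lambda>n. 1 / real (Suc n)) (at 0) sequentially"
    unfolding filterlim_at using LIMSEQ_Suc[OF lim_1_over_n] by auto
  ultimately show ?thesis
    unfolding grad_def vec_lambda_beta by (rule filterlim_compose)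
qed

lemma grad_bound:
  fixes v :: "real^'d \<Rightarrow> real"
  assumes dv: "v differentiable (at x)" and x: "x \<in> interior K"
    and lip: "\<And>x y. x \<in> K \<Longrightarrow> y \<in> K \<Longrightarrow> \<bar>v x - v y\<bar> \<le> L * norm (x - y)"
  shows "norm (grad v x) \<le> real CARD('d) * L"
proof -
  have "\<bar>grad v x $ i\<bar> \<le> L" for i
  proof -
    let ?q = "\<lambda>n. (v (x + (1 / real (Suc n)) *\<^sub>R axis i 1) - v x) / (1 / real (Suc n))"
    have "(\<lambda>n. x + (1 / real (Suc n)) *\<^sub>R axis i 1) \<longlonglongrightarrow> x + 0 *\<^sub>R axis i 1"
      using LIMSEQ_Suc[OF lim_1_over_n] by (intro tendsto_intros) auto
    then have "\<forall>\<^sub>F n in sequentially. x + (1 / real (Suc n)) *\<^sub>R axis i 1 \<in> interior K"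
      using x by (intro topological_tendstoD) auto
    then have "\<forall>\<^sub>F n in sequentially. \<bar>?q n\<bar> \<le> L"
    proof eventually_elim
      case (elim n)
      have "\<bar>v (x + (1 / real (Suc n)) *\<^sub>R axis i 1) - v x\<bar> \<le> L * norm (x + (1 / real (Suc n)) *\<^sub>R axis i 1 - x)"
        using elim x interior_subset by (intro lip) blast+
      also have "\<dots> = L * (1 / real (Suc n))" by simp
      finally show ?case by (simp only: abs_divide) (simp add: field_simps)
    qed
    then show ?thesis
      using tendsto_upperbound[OF tendsto_rabs[OF grad_component_limit[OF dv, of i]]] by simp
  qed
  then have "(\<Sum>i\<in>UNIV. \<bar>grad v x $ i\<bar>) \<le> (\<Sum>i\<in>(UNIV :: 'd set). L)" by (intro sum_mono) auto
  then show ?thesis using norm_le_l1_cart[of "grad v x"] by simp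
qed

lemma differentiable_hatval_affine:
  fixes N :: "real^'d^'d"
  shows "(\<lambda>x. hatval (N *v (x - p))) differentiable (at x)"
proof -
  have d: "((\<lambda>x. 1 - (N *v (x - p)) $ i) has_derivative (\<lambda>h. - ((N *v h) $ i))) (at x)" for i
  proof -
    have "bounded_linear (\<lambda>h. (N *v h) $ i)"
      using bounded_linear_compose[OF bounded_linear_vec_nth matrix_vector_mul_bounded_linear] .
    moreover have "((\<lambda>x. x - p) has_derivative (\<lambda>h. h)) (at x)"
      by (auto intro!: derivative_eq_intros)
    ultimately have "((\<lambda>x. (N *v (x - p)) $ i) has_derivative (\<lambda>h. (N *v h) $ i)) (at x)"
      by (rule bounded_linear.has_derivative)
    then show ?thesis by (auto intro!: derivative_eq_intros)
  qed
  show ?thesis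
    unfolding hatval_def differentiable_def by (rule exI, rule has_derivative_prod, rule d)
qed

lemma Q1_on_differentiable:
  assumes par: "parallelepiped K" and v: "Q1_on K v" and x: "x \<in> interior K"
  shows "v differentiable (at x)"
proof -
  have "\<exists>M. corner K p M" if "p \<in> verts K" for p using that by (simp add: verts_def)
  then obtain M where M: "\<And>p. p \<in> verts K \<Longrightarrow> corner K p (M p)" by metis
  let ?f = "\<lambda>x. \<Sum>p\<in>verts K. v p * hatval (matrix_inv (M p) *v (x - p))"
  have "?f differentiable (at x)"
    using finite_verts[OF par] differentiable_hatval_affine by (intro differentiable_sum) auto
  then obtain D where D: "(?f has_derivative D) (at x)" unfolding differentiable_def by blast
  have "?f y = v y" if "y \<in> interior K" for y
  proof -
    have "y \<in> K" using that interior_subset by blast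
    then have "v y = (\<Sum>p\<in>verts K. v p * hat {K} p y)" using v unfolding Q1_on_iff[OF par] by blast
    also have "\<dots> = ?f y" using hat_formula(1)[OF M \<open>y \<in> K\<close>] by (intro sum.cong) auto
    finally show ?thesis by simp
  qed
  then have "(v has_derivative D) (at x)"
    by (intro has_derivative_transform_within_open[OF D open_interior x])
  then show ?thesis unfolding differentiable_def by blast
qed

lemma grad_lincomb:
  assumes "v differentiable (at x)" "w differentiable (at x)"
  shows "grad (\<lambda>x. a * v x + b * w x) x = a *\<^sub>R grad v x + b *\<^sub>R grad w x"
proof -
  have "((\<lambda>x. a * v x + b * w x) has_derivative
     (\<lambda>h. a * frechet_derivative v (at x) h + b * frechet_derivative w (at x) h)) (at x)"
    using assms by (auto intro!: derivative_intros simp: frechet_derivative_works)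
  from frechet_derivative_at[OF this] show ?thesis
    by (simp add: grad_def vec_eq_iff fun_eq_iff)
qed

lemma grad_cong_on_open:
  assumes "open U" "x \<in> U" "\<And>y. y \<in> U \<Longrightarrow> v y = w y"
  shows "grad v x = grad w x"
proof -
  have "(v has_derivative D) (at x) \<longleftrightarrow> (w has_derivative D) (at x)" for D
    using has_derivative_transform_within_open[OF _ assms(1,2), of v D UNIV w]
      has_derivative_transform_within_open[OF _ assms(1,2), of w D UNIV v] assms(3) by auto
  then show ?thesis by (simp add: grad_def frechet_derivative_def)
qed

section \<open>The mesh and the finite element space\<close>

lemma interior_nonempty_of_cball:
  assumes "cball z r \<subseteq> K" "0 < r"
  shows "interior K \<noteq> {}"
proof -
  have "ball z r \<subseteq> interior K"
    using assms ball_subset_cball[of z r] by (intro interior_maximal) auto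
  then show ?thesis using assms(2) by (metis centre_in_ball empty_iff subset_iff)
qed

lemma measurable_lebesgue_on_spike:
  fixes f :: "'a::euclidean_space \<Rightarrow> real"
  assumes f: "f \<in> borel_measurable (lebesgue_on U)" and US: "U \<subseteq> S" "U \<in> sets lebesgue" "S \<in> sets lebesgue"
    and n: "negligible (S - U)"
  shows "f \<in> borel_measurable (lebesgue_on S)"
proof (rule measurableI)
  fix B :: "real set" assume B: "B \<in> sets borel"
  have "f -` B \<inter> U \<in> sets (lebesgue_on U)"
    using measurable_sets[OF f B] by (simp add: space_restrict_space)
  then have "f -` B \<inter> U \<in> sets lebesgue" using US by (simp add: sets_restrict_space_iff)
  moreover have "f -` B \<inter> (S - U) \<in> sets lebesgue"
    using n by (meson Int_lower2 negligible_imp_sets negligible_subset)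
  ultimately have "(f -` B \<inter> U) \<union> (f -` B \<inter> (S - U)) \<in> sets lebesgue" by (rule sets.Un)
  moreover have "(f -` B \<inter> U) \<union> (f -` B \<inter> (S - U)) = f -` B \<inter> S" using US by blast
  ultimately show "f -` B \<inter> space (lebesgue_on S) \<in> sets (lebesgue_on S)"
    using US by (simp add: space_restrict_space sets_restrict_space_iff)
qed simp

lemma AE_lebesgue_on_iff:
  fixes S :: "'a::euclidean_space set"
  assumes "S \<in> sets lebesgue"
  shows "(AE x in lebesgue_on S. P x) \<longleftrightarrow> (AE x in lebesgue. x \<in> S \<longrightarrow> P x)"
  using AE_restrict_space_iff[of S lebesgue P] assms by simp

lemma AE_lebesgue_on_subset:
  fixes S :: "'a::euclidean_space set"
  assumes "AE x in lebesgue_on S. P x" "S' \<subseteq> S" "S \<in> sets lebesgue" "S' \<in> sets lebesgue"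
  shows "AE x in lebesgue_on S'. P x"
  using assms(1) unfolding AE_lebesgue_on_iff[OF assms(3)] AE_lebesgue_on_iff[OF assms(4)]
  by eventually_elim (use assms(2) in blast)

lemma integrable_lebesgue_on_subset:
  fixes f :: "'a::euclidean_space \<Rightarrow> real"
  assumes "integrable (lebesgue_on S) f" "S' \<subseteq> S" "S \<in> sets lebesgue" "S' \<in> sets lebesgue"
  shows "integrable (lebesgue_on S') f"
proof -
  have "integrable lebesgue (\<lambda>x. indicator S x *\<^sub>R f x)"
    using assms by (subst (asm) integrable_restrict_space) auto
  then have "integrable lebesgue (\<lambda>x. indicator S' x *\<^sub>R (indicator S x *\<^sub>R f x))"
    using assms(4) integrable_mult_indicator by blast
  moreover have "indicator S' x *\<^sub>R (indicator S x *\<^sub>R f x) = indicator S' x *\<^sub>R f x" for x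
    using assms(2) by (auto simp: indicator_def)
  ultimately have "integrable lebesgue (\<lambda>x. indicator S' x *\<^sub>R f x)" by (simp only:)
  then show ?thesis using assms by (subst integrable_restrict_space) auto
qed

locale fe_mesh =
  fixes \<Omega> :: "(real^'d) set" and \<T> :: "(real^'d) set set" and \<sigma> :: real
  assumes poly: "lipschitz_polytope \<Omega>" and mesh: "regular_mesh \<sigma> \<Omega> \<T>" and \<sigma>_pos: "0 < \<sigma>"
begin

abbreviation "V \<equiv> Q1_space \<Omega> \<T>"
abbreviation "h \<equiv> mesh_size \<T>"

lemma open_dom: "open \<Omega>" and bounded_dom: "bounded \<Omega>" and lip_dom: "lipschitz_boundary \<Omega>"
  and dom_ne: "\<Omega> \<noteq> {}"
  using poly by (auto simp: lipschitz_polytope_def)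

lemma finite_mesh: "finite \<T>" and cover: "\<Union>\<T> = closure \<Omega>" and conf: "conforming \<T>"
  using mesh by (auto simp: regular_mesh_def conforming_def)

lemma par: "K \<in> \<T> \<Longrightarrow> parallelepiped K"
  using conf by (simp add: conforming_def)

lemma mesh_ne: "\<T> \<noteq> {}"
  using cover dom_ne closure_subset[of \<Omega>] by auto

lemma diameter_pos: 
  assumes "K \<in> \<T>"
  shows "0 < diameter K"
proof -
  obtain b M where c: "corner K b M" using par[OF assms] parallelepiped_corner by blast
  fix i :: 'd
  let ?x = "affine_map b M (axis i 1)"
  have "?x \<noteq> b" using c affine_map_eq_iff[of M b "axis i 1" 0] by (auto simp: corner_def axis_eq_0_iff)
  moreover have "?x \<in> K" "b \<in> K" using c corner_mem[OF c] by (auto simp: corner_def mem_unit_cube axis_def)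
  moreover have "bounded K" using compact_parallelepiped[OF par[OF assms]] compact_imp_bounded by blast
  ultimately show ?thesis using diameter_bounded_bound[of K ?x b] by (metis dist_pos_lt order_less_le_trans)
qed

lemma h_pos: "0 < h"
proof -
  obtain K where K: "K \<in> \<T>" using mesh_ne by blast
  then have "diameter K \<le> h" using finite_mesh by (simp add: mesh_size_def)
  then show ?thesis using diameter_pos[OF K] by linarith
qed

lemma inscribed_ball:
  assumes "K \<in> \<T>"
  shows "\<exists>z. cball z (\<sigma>\<^sup>2 * h) \<subseteq> K"
proof -
  obtain z where z: "cball z (\<sigma> * diameter K) \<subseteq> K" using mesh assms by (auto simp: regular_mesh_def)
  have "\<sigma> * h \<le> diameter K" using mesh assms by (auto simp: regular_mesh_def)
  then have "\<sigma>\<^sup>2 * h \<le> \<sigma> * diameter K" using \<sigma>_pos by (simp add: power2_eq_square mult.assoc)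
  then have "cball z (\<sigma>\<^sup>2 * h) \<subseteq> cball z (\<sigma> * diameter K)" by (rule subset_cball)
  then show ?thesis using z by blast
qed

lemma ball_radius_pos: "0 < \<sigma>\<^sup>2 * h"
  using h_pos \<sigma>_pos by simp

lemma elem_closure: "K \<in> \<T> \<Longrightarrow> closure (interior K) = K"
proof -
  assume K: "K \<in> \<T>"
  obtain z where "cball z (\<sigma>\<^sup>2 * h) \<subseteq> K" using inscribed_ball[OF K] by blast
  then have "interior K \<noteq> {}" using interior_nonempty_of_cball ball_radius_pos by blast
  then have "closure (interior K) = closure K"
    using convex_closure_interior[OF convex_parallelepiped[OF par[OF K]]] by blast
  also have "\<dots> = K" using compact_parallelepiped[OF par[OF K]] by (simp add: compact_imp_closed)
  finally show ?thesis .
qed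

lemma elem_interior_ne: "K \<in> \<T> \<Longrightarrow> interior K \<noteq> {}"
  using inscribed_ball interior_nonempty_of_cball ball_radius_pos by blast

lemma elem_interior_subset: "K \<in> \<T> \<Longrightarrow> interior K \<subseteq> \<Omega>"
  using lipschitz_boundary_interior_closure[OF open_dom lip_dom] cover
  by (metis Union_upper interior_mono)

text \<open>An interior point of \<open>K\<close> in \<open>L\<close> makes the common face equal to \<open>K\<close>. Then \<open>K\<close> is a face of
  \<open>L\<close>, and a face with interior points is not proper.\<close>
lemma elem_disjoint:
  assumes "K \<in> \<T>" "L \<in> \<T>" "K \<noteq> L"
  shows "interior K \<inter> L = {}"
proof (cases "K \<inter> L = K")
  case False
  have "(K \<inter> L) face_of K" using conf assms by (simp add: conforming_def)
  from face_of_disjoint_interior[OF this False] show ?thesis using interior_subset by blast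
next
  case True
  then have "K face_of L" using conf assms by (metis conforming_def)
  from face_of_disjoint_interior[OF this assms(3)] have "K \<inter> interior L = {}" .
  moreover have "interior K \<subseteq> interior L" using True by (intro interior_mono) auto
  ultimately show ?thesis using elem_interior_ne[OF assms(1)] interior_subset by blast
qed

lemma bounded_elem: "K \<in> \<T> \<Longrightarrow> bounded K"
  using compact_parallelepiped[OF par] compact_imp_bounded by blast

lemma interior_lmeasurable: "K \<in> \<T> \<Longrightarrow> interior K \<in> lmeasurable"
  using bounded_elem lmeasurable_interior by blast

lemma interior_measurable: "K \<in> \<T> \<Longrightarrow> interior K \<in> sets lebesgue"
  using interior_lmeasurable fmeasurableD by blast

lemma dom_lmeasurable: "\<Omega> \<in> lmeasurable"
  using bounded_dom open_dom lmeasurable_open by blast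

lemma dom_measurable: "\<Omega> \<in> sets lebesgue"
  using dom_lmeasurable fmeasurableD by blast

lemma negligible_skeleton: "negligible (\<Omega> - \<Union>(interior ` \<T>))"
proof -
  have "negligible (\<Union>(frontier ` \<T>))"
    using finite_mesh negligible_convex_frontier convex_parallelepiped par
    by (intro negligible_Union) auto
  moreover have "\<Omega> - \<Union>(interior ` \<T>) \<subseteq> \<Union>(frontier ` \<T>)"
  proof
    fix x assume x: "x \<in> \<Omega> - \<Union>(interior ` \<T>)"
    then obtain K where "K \<in> \<T>" "x \<in> K" using cover closure_subset[of \<Omega>] by blast
    moreover have "x \<in> closure K" using \<open>x \<in> K\<close> closure_subset by blast
    ultimately show "x \<in> \<Union>(frontier ` \<T>)" using x unfolding frontier_def by blast
  qed
  ultimately show ?thesis by (rule negligible_subset)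
qed

text \<open>The skeleton of the mesh is a null set, so integrals over unions of elements are sums over the
  open elements.\<close>
lemma integral_split_elements:
  fixes g :: "real^'d \<Rightarrow> real"
  assumes g: "integrable (lebesgue_on \<Omega>) g" and S: "S \<subseteq> \<Omega>" "S \<in> sets lebesgue" and KT: "\<K> \<subseteq> \<T>"
    and inside: "\<And>K. K \<in> \<K> \<Longrightarrow> interior K \<subseteq> S"
    and outside: "\<And>K. K \<in> \<T> - \<K> \<Longrightarrow> interior K \<inter> S = {}"
  shows "(\<integral>x. g x \<partial>lebesgue_on S) = (\<Sum>K\<in>\<K>. \<integral>x. g x \<partial>lebesgue_on (interior K))"
proof -
  have fin: "finite \<K>" using finite_subset[OF KT finite_mesh] .
  have int: "integrable lebesgue (\<lambda>x. indicator B x *\<^sub>R g x)" if B: "B \<subseteq> \<Omega>" "B \<in> sets lebesgue" for B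
  proof -
    have "integrable (lebesgue_on B) g"
      using integrable_lebesgue_on_subset[OF g B(1) dom_measurable B(2)] .
    then show ?thesis using B by (subst (asm) integrable_restrict_space) auto
  qed
  have intK: "integrable lebesgue (\<lambda>x. indicator (interior K) x *\<^sub>R g x)" if "K \<in> \<K>" for K
    using that KT by (intro int elem_interior_subset interior_measurable) auto
  have "(\<integral>x. g x \<partial>lebesgue_on S) = (\<integral>x. indicator S x *\<^sub>R g x \<partial>lebesgue)"
    using S by (subst integral_restrict_space) auto
  also have "\<dots> = (\<integral>x. (\<Sum>K\<in>\<K>. indicator (interior K) x *\<^sub>R g x) \<partial>lebesgue)"
  proof (rule integral_cong_AE)
    show "(\<lambda>x. indicator S x *\<^sub>R g x) \<in> borel_measurable lebesgue"
      using int[OF S] by (rule borel_measurable_integrable)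
    show "(\<lambda>x. \<Sum>K\<in>\<K>. indicator (interior K) x *\<^sub>R g x) \<in> borel_measurable lebesgue"
      using intK by (intro borel_measurable_sum borel_measurable_integrable) auto
    have "AE x in lebesgue. x \<notin> \<Omega> - \<Union>(interior ` \<T>)"
      using negligible_skeleton unfolding negligible_iff_null_sets by (rule AE_not_in)
    then show "AE x in lebesgue. indicator S x *\<^sub>R g x = (\<Sum>K\<in>\<K>. indicator (interior K) x *\<^sub>R g x)"
    proof eventually_elim
      case (elim x)
      show ?case
      proof (cases "x \<in> \<Union>(interior ` \<K>)")
        case True
        then obtain L where L: "L \<in> \<K>" "x \<in> interior L" by blast
        have "x \<notin> interior K" if "K \<in> \<K> - {L}" for K
          using elem_disjoint[of K L] L that KT interior_subset by blast
        then have "(\<Sum>K\<in>\<K>. indicator (interior K) x *\<^sub>R g x) = (\<Sum>K\<in>{L}. indicator (interior K) x *\<^sub>R g x)"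
          using L fin by (intro sum.mono_neutral_right) (auto simp: indicator_def)
        moreover have "x \<in> S" using inside L by blast
        ultimately show ?thesis using L by simp
      next
        case False
        then have "x \<notin> S" using elim outside S by blast
        moreover have "(\<Sum>K\<in>\<K>. indicator (interior K) x *\<^sub>R g x) = 0"
          using False by (intro sum.neutral) (auto simp: indicator_def)
        ultimately show ?thesis by simp
      qed
    qed
  qed
  also have "\<dots> = (\<Sum>K\<in>\<K>. \<integral>x. indicator (interior K) x *\<^sub>R g x \<partial>lebesgue)"
    using intK by (rule Bochner_Integration.integral_sum)
  also have "\<dots> = (\<Sum>K\<in>\<K>. \<integral>x. g x \<partial>lebesgue_on (interior K))"
    using interior_measurable KT by (intro sum.cong refl) (subst integral_restrict_space, auto)
  finally show ?thesis .
qed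

lemma V_D:
  assumes "v \<in> V"
  shows "continuous_on UNIV v" "\<And>x. x \<notin> \<Omega> \<Longrightarrow> v x = 0" "\<And>K. K \<in> \<T> \<Longrightarrow> Q1_on K v"
  using assms by (auto simp: Q1_space_def)

lemma V_lincomb:
  assumes "v \<in> V" "w \<in> V"
  shows "(\<lambda>x. a * v x + b * w x) \<in> V"
  using V_D[OF assms(1)] V_D[OF assms(2)] Q1_on_lincomb[OF par]
  by (auto simp: Q1_space_def intro!: continuous_intros)

lemma V_zero: "(\<lambda>x. 0) \<in> V"
  using Q1_on_nodal[OF par, of _ "\<lambda>x. 0" "\<lambda>x. 0"] by (auto simp: Q1_space_def)

lemma V_sum:
  assumes "finite P" "\<And>p. p \<in> P \<Longrightarrow> f p \<in> V"
  shows "(\<lambda>x. \<Sum>p\<in>P. c p * f p x) \<in> V"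
  using assms
proof (induction P)
  case (insert p P)
  then have "(\<lambda>x. c p * f p x + 1 * (\<Sum>p\<in>P. c p * f p x)) \<in> V" by (intro V_lincomb) auto
  then show ?case using insert by simp
qed (simp add: V_zero)

lemma V_nodal:
  assumes "v \<in> V" "K \<in> \<T>" "x \<in> K"
  shows "v x = (\<Sum>p\<in>verts K. v p * hat {K} p x)"
  using V_D(3)[OF assms(1,2)] assms(3) unfolding Q1_on_iff[OF par[OF assms(2)]] by blast

text \<open>The vertices on the boundary of the domain have no basis function in the space, but the nodal
  values there are zero.\<close>
lemma nodal_truncation:
  assumes w: "w \<in> V"
  shows "\<exists>v\<in>V. \<forall>K\<in>\<T>. \<forall>x\<in>K. v x = (\<Sum>p\<in>verts K. (if p \<in> R then w p else 0) * hat {K} p x)"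
proof -
  define P where "P = (\<Union>K\<in>\<T>. verts K) \<inter> R \<inter> \<Omega>"
  have fin: "finite P" unfolding P_def by (intro finite_Int disjI1 finite_UN_I finite_mesh finite_verts par)
  define v where "v = (\<lambda>x. \<Sum>p\<in>P. w p * hat \<T> p x)"
  have "v \<in> V" unfolding v_def
    using hat_in_Q1_space[OF open_dom lip_dom conf finite_mesh cover] fin
    by (intro V_sum) (auto simp: P_def)
  moreover have "v x = (\<Sum>p\<in>verts K. (if p \<in> R then w p else 0) * hat {K} p x)"
    if K: "K \<in> \<T>" and x: "x \<in> K" for K x
  proof -
    have "v x = (\<Sum>p\<in>P. w p * hat {K} p x)" by (simp add: v_def hat_local[OF conf K x])
    also have "\<dots> = (\<Sum>p\<in>P \<inter> verts K. w p * hat {K} p x)"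
      using fin hat_off[of _ K x] by (intro sum.mono_neutral_right) auto
    also have "\<dots> = (\<Sum>p\<in>P \<inter> verts K. (if p \<in> R then w p else 0) * hat {K} p x)"
      by (intro sum.cong) (auto simp: P_def)
    also have "\<dots> = (\<Sum>p\<in>verts K. (if p \<in> R then w p else 0) * hat {K} p x)"
      using finite_verts[OF par[OF K]] V_D(2)[OF w] K by (intro sum.mono_neutral_left) (auto simp: P_def)
    finally show ?thesis .
  qed
  ultimately show ?thesis by blast
qed

lemma V_differentiable: "v \<in> V \<Longrightarrow> K \<in> \<T> \<Longrightarrow> x \<in> interior K \<Longrightarrow> v differentiable (at x)"
  using Q1_on_differentiable[OF par V_D(3)] by blast

text \<open>The inverse estimate: each element contains a ball of radius \<open>\<sigma>\<^sup>2 h\<close> by shape regularity and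
  quasi-uniformity.\<close>
lemma grad_nodal_bound:
  assumes v: "v \<in> V" and nod: "\<And>x. x \<in> K \<Longrightarrow> v x = (\<Sum>p\<in>verts K. a p * hat {K} p x)"
    and K: "K \<in> \<T>" and x: "x \<in> interior K"
  shows "h * norm (grad v x) \<le> (real CARD('d))\<^sup>2 / (2 * \<sigma>\<^sup>2) * (\<Sum>p\<in>verts K. \<bar>a p\<bar>)"
proof -
  obtain z where z: "cball z (\<sigma>\<^sup>2 * h) \<subseteq> K" using inscribed_ball[OF K] by blast
  have "norm (grad v x) \<le> real CARD('d) * ((\<Sum>p\<in>verts K. \<bar>a p\<bar>) * (real CARD('d) / (2 * (\<sigma>\<^sup>2 * h))))"
    using nodal_lipschitz_bound[OF nod z ball_radius_pos]
    by (intro grad_bound[OF V_differentiable[OF v K x] x]) auto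
  then have "h * norm (grad v x)
      \<le> h * (real CARD('d) * ((\<Sum>p\<in>verts K. \<bar>a p\<bar>) * (real CARD('d) / (2 * (\<sigma>\<^sup>2 * h)))))"
    using h_pos by (intro mult_left_mono) auto
  also have "\<dots> = (real CARD('d))\<^sup>2 / (2 * \<sigma>\<^sup>2) * (\<Sum>p\<in>verts K. \<bar>a p\<bar>)"
    using h_pos by (simp add: power2_eq_square)
  finally show ?thesis .
qed

lemma V_grad_bounded:
  assumes "v \<in> V"
  shows "\<exists>B. \<forall>K\<in>\<T>. \<forall>x\<in>interior K. norm (grad v x) \<le> B"
proof -
  let ?b = "\<lambda>K. (real CARD('d))\<^sup>2 / (2 * \<sigma>\<^sup>2) * (\<Sum>p\<in>verts K. \<bar>v p\<bar>) / h"
  have "norm (grad v x) \<le> (\<Sum>K\<in>\<T>. ?b K)" if "K \<in> \<T>" "x \<in> interior K" for K x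
  proof -
    have "norm (grad v x) \<le> ?b K"
      using grad_nodal_bound[OF assms V_nodal[OF assms that(1)] that] h_pos
      by (simp only: pos_le_divide_eq mult.commute[of h])
    also have "\<dots> \<le> (\<Sum>K\<in>\<T>. ?b K)"
      using finite_mesh that h_pos by (intro member_le_sum) (auto intro!: divide_nonneg_pos mult_nonneg_nonneg sum_nonneg)
    finally show ?thesis .
  qed
  then show ?thesis by blast
qed

lemma grad_measurable:
  assumes v: "v \<in> V"
  shows "(\<lambda>x. grad v x $ i) \<in> borel_measurable (lebesgue_on \<Omega>)"
proof -
  let ?U = "\<Union>(interior ` \<T>)"
  have oU: "open ?U" by auto
  then have mU: "?U \<in> sets lebesgue" by (simp add: borel_open)
  let ?q = "\<lambda>n x. (v (x + (1 / real (Suc n)) *\<^sub>R axis i 1) - v x) / (1 / real (Suc n))"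
  have "(\<lambda>x. grad v x $ i) \<in> borel_measurable (lebesgue_on ?U)"
  proof (rule borel_measurable_LIMSEQ_real)
    show "(\<lambda>n. ?q n x) \<longlonglongrightarrow> grad v x $ i" if "x \<in> space (lebesgue_on ?U)" for x
      using that V_differentiable[OF v] by (intro grad_component_limit) (auto simp: space_restrict_space)
    show "?q n \<in> borel_measurable (lebesgue_on ?U)" for n
    proof (rule continuous_imp_measurable_on_sets_lebesgue[OF _ mU])
      show "continuous_on ?U (?q n)"
        by (intro continuous_intros continuous_on_compose2[OF V_D(1)[OF v]] continuous_on_subset[OF V_D(1)[OF v]]) auto
    qed
  qed
  then show ?thesis
    using elem_interior_subset by (intro measurable_lebesgue_on_spike[OF _ _ mU dom_measurable negligible_skeleton]) auto
qed

lemma AE_elements: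
  assumes "\<And>K x. K \<in> \<T> \<Longrightarrow> x \<in> interior K \<Longrightarrow> P x"
  shows "AE x in lebesgue_on \<Omega>. P x"
proof -
  have "AE x in lebesgue. x \<notin> \<Omega> - \<Union>(interior ` \<T>)"
    using negligible_skeleton unfolding negligible_iff_null_sets by (rule AE_not_in)
  then have "AE x in lebesgue. x \<in> \<Omega> \<longrightarrow> P x" by eventually_elim (use assms in blast)
  then show ?thesis by (simp add: AE_lebesgue_on_iff[OF dom_measurable])
qed

lemma V_product_integrable: "v \<in> V \<Longrightarrow> w \<in> V \<Longrightarrow> integrable (lebesgue_on \<Omega>) (\<lambda>x. v x * w x)"
  using V_D(1) by (intro continuous_bounded_integrable dom_lmeasurable bounded_dom continuous_intros) auto

end

section \<open>Energy forms and the decay across one layer\<close>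

lemma young_scalar:
  fixes a b c :: real
  assumes "0 < c"
  shows "a * b \<le> c * a\<^sup>2 + b\<^sup>2 / (4 * c)"
proof -
  have "0 \<le> (2 * c * a - b)\<^sup>2 / (4 * c)" using assms by simp
  also have "\<dots> = c * a\<^sup>2 - a * b + b\<^sup>2 / (4 * c)"
    using assms by (simp add: power2_eq_square field_simps)
  finally show ?thesis by simp
qed

lemma young_inner:
  fixes a b :: "'n::real_inner"
  assumes "0 < c"
  shows "\<bar>a \<bullet> b\<bar> \<le> c * (a \<bullet> a) + (b \<bullet> b) / (4 * c)"
proof -
  have "\<bar>a \<bullet> b\<bar> \<le> norm a * norm b" by (rule Cauchy_Schwarz_ineq2)
  also have "\<dots> \<le> c * (norm a)\<^sup>2 + (norm b)\<^sup>2 / (4 * c)" by (rule young_scalar[OF assms])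
  finally show ?thesis by (simp add: power2_norm_eq_inner)
qed

text \<open>The constant of \<open>eform_truncation_bound\<close>. The second summand comes from the bounds
  of the truncated function and its gradient by nodal values; the summand \<open>2\<close> makes the constant also dominate the
  coefficients of the energies off the ring in \<open>layer_decay\<close>.\<close>
definition truncation_const :: "nat \<Rightarrow> real \<Rightarrow> real \<Rightarrow> real" where
  "truncation_const d \<beta> \<sigma> = 2 + (1 / 2 + \<beta> / 8 * ((real d)\<^sup>2 / (2 * \<sigma>\<^sup>2))\<^sup>2) * nodal_const d"

locale fe_wave = fe_mesh \<Omega> \<T> \<sigma>
  for \<Omega> :: "(real^'d) set" and \<T> :: "(real^'d) set set" and \<sigma> :: real +
  fixes A :: "real^'d \<Rightarrow> real" and \<alpha> \<beta> \<tau> :: real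
  assumes coeff: "coefficient \<alpha> \<beta> \<Omega> A" and \<alpha>_pos: "0 < \<alpha>" and \<tau>_pos: "0 < \<tau>"
begin

abbreviation "\<kappa> \<equiv> \<tau>\<^sup>2 / 4"

definition density :: "real \<Rightarrow> (real^'d \<Rightarrow> real) \<Rightarrow> (real^'d \<Rightarrow> real) \<Rightarrow> real^'d \<Rightarrow> real" where
  "density k w z x = w x * z x + k * (A x * (grad w x \<bullet> grad z x))"

definition eform :: "real \<Rightarrow> (real^'d) set \<Rightarrow> (real^'d \<Rightarrow> real) \<Rightarrow> (real^'d \<Rightarrow> real) \<Rightarrow> real" where
  "eform k S w z = (\<integral>x. density k w z x \<partial>lebesgue_on S)"

abbreviation N :: "(real^'d) set \<Rightarrow> (real^'d \<Rightarrow> real) \<Rightarrow> real" where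
  "N K w \<equiv> eform \<kappa> (interior K) w w"

lemma \<kappa>_pos: "0 < \<kappa>" using \<tau>_pos by simp

lemma A_bounds: "AE x in lebesgue_on \<Omega>. 0 \<le> A x \<and> A x \<le> \<beta>"
proof -
  have "AE x in lebesgue_on \<Omega>. \<alpha> \<le> A x \<and> A x \<le> \<beta>" using coeff by (simp add: coefficient_def)
  then show ?thesis by eventually_elim (use \<alpha>_pos in auto)
qed

lemma A_bounds_elem: "K \<in> \<T> \<Longrightarrow> AE x in lebesgue_on (interior K). 0 \<le> A x \<and> A x \<le> \<beta>"
  by (rule AE_lebesgue_on_subset[OF A_bounds elem_interior_subset dom_measurable interior_measurable])

lemma energy_density_integrable:
  assumes w: "w \<in> V" and z: "z \<in> V"
  shows "integrable (lebesgue_on \<Omega>) (\<lambda>x. A x * (grad w x \<bullet> grad z x))"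
proof -
  obtain B where B: "\<And>K x. K \<in> \<T> \<Longrightarrow> x \<in> interior K \<Longrightarrow> norm (grad w x) \<le> B"
    using V_grad_bounded[OF w] by blast
  obtain C where C: "\<And>K x. K \<in> \<T> \<Longrightarrow> x \<in> interior K \<Longrightarrow> norm (grad z x) \<le> C"
    using V_grad_bounded[OF z] by blast
  have "A \<in> borel_measurable (lebesgue_on \<Omega>)" using coeff by (simp add: coefficient_def)
  then have "(\<lambda>x. A x * (grad w x \<bullet> grad z x)) \<in> borel_measurable (lebesgue_on \<Omega>)"
    unfolding inner_vec_def inner_real_def
    by (intro borel_measurable_times borel_measurable_sum grad_measurable w z)
  moreover have "AE x in lebesgue_on \<Omega>. norm (grad w x) \<le> B \<and> norm (grad z x) \<le> C"
    by (rule AE_elements) (use B C in auto)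
  then have "AE x in lebesgue_on \<Omega>. \<bar>A x * (grad w x \<bullet> grad z x)\<bar> \<le> \<beta> * (B * C)"
    using A_bounds
  proof eventually_elim
    case (elim x)
    have "\<bar>grad w x \<bullet> grad z x\<bar> \<le> norm (grad w x) * norm (grad z x)" by (rule Cauchy_Schwarz_ineq2)
    also have "\<dots> \<le> B * C" using elim by (intro mult_mono) (auto intro: order_trans[OF norm_ge_zero])
    finally show ?case unfolding abs_mult using elim by (intro mult_mono) auto
  qed
  ultimately show ?thesis by (rule bounded_measurable_integrable[OF dom_lmeasurable])
qed

lemma density_integrable: "w \<in> V \<Longrightarrow> z \<in> V \<Longrightarrow> integrable (lebesgue_on \<Omega>) (density k w z)"
  unfolding density_def
  by (intro Bochner_Integration.integrable_add integrable_mult_right V_product_integrable energy_density_integrable)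

lemma restrict_integrable:
  fixes g :: "real^'d \<Rightarrow> real"
  shows "integrable (lebesgue_on \<Omega>) g \<Longrightarrow> S \<subseteq> \<Omega> \<Longrightarrow> S \<in> sets lebesgue \<Longrightarrow> integrable (lebesgue_on S) g"
  using integrable_lebesgue_on_subset dom_measurable by blast

lemma eform_eq:
  assumes "w \<in> V" "z \<in> V" "S \<subseteq> \<Omega>" "S \<in> sets lebesgue"
  shows "eform k S w z = L2_inner S w z + k * energy_form A S w z"
proof -
  have "integrable (lebesgue_on S) (\<lambda>x. w x * z x)"
    "integrable (lebesgue_on S) (\<lambda>x. A x * (grad w x \<bullet> grad z x))"
    using restrict_integrable[OF V_product_integrable[OF assms(1,2)] assms(3,4)]
      restrict_integrable[OF energy_density_integrable[OF assms(1,2)] assms(3,4)] by auto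
  then show ?thesis by (simp add: eform_def density_def L2_inner_def energy_form_def)
qed

lemma L2_lincomb:
  assumes "u \<in> V" "w \<in> V" "z \<in> V"
  shows "L2_inner \<Omega> (\<lambda>x. a * u x + b * w x) z = a * L2_inner \<Omega> u z + b * L2_inner \<Omega> w z"
proof -
  have "L2_inner \<Omega> (\<lambda>x. a * u x + b * w x) z = (\<integral>x. a * (u x * z x) + b * (w x * z x) \<partial>lebesgue_on \<Omega>)"
    unfolding L2_inner_def by (intro Bochner_Integration.integral_cong) (auto simp: algebra_simps)
  then show ?thesis using V_product_integrable assms by (simp add: L2_inner_def)
qed

lemma energy_lincomb:
  assumes "u \<in> V" "w \<in> V" "z \<in> V"
  shows "energy_form A \<Omega> (\<lambda>x. a * u x + b * w x) z = a * energy_form A \<Omega> u z + b * energy_form A \<Omega> w z"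
proof -
  let ?u = "\<lambda>x. a * u x + b * w x"
  have "AE x in lebesgue_on \<Omega>. grad ?u x = a *\<^sub>R grad u x + b *\<^sub>R grad w x"
    using V_differentiable assms by (intro AE_elements grad_lincomb) auto
  then have "AE x in lebesgue_on \<Omega>. A x * (grad ?u x \<bullet> grad z x) =
      a * (A x * (grad u x \<bullet> grad z x)) + b * (A x * (grad w x \<bullet> grad z x))"
    by eventually_elim (simp add: inner_add_left algebra_simps)
  moreover have i: "integrable (lebesgue_on \<Omega>) (\<lambda>x. A x * (grad u x \<bullet> grad z x))"
    "integrable (lebesgue_on \<Omega>) (\<lambda>x. A x * (grad w x \<bullet> grad z x))"
    "integrable (lebesgue_on \<Omega>) (\<lambda>x. A x * (grad ?u x \<bullet> grad z x))"
    using assms V_lincomb by (auto intro!: energy_density_integrable)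
  ultimately have "(\<integral>x. A x * (grad ?u x \<bullet> grad z x) \<partial>lebesgue_on \<Omega>) =
      (\<integral>x. a * (A x * (grad u x \<bullet> grad z x)) + b * (A x * (grad w x \<bullet> grad z x)) \<partial>lebesgue_on \<Omega>)"
    by (intro integral_cong_AE) auto
  then show ?thesis using i by (simp add: energy_form_def)
qed

lemma eform_split:
  assumes "w \<in> V" "z \<in> V" "S \<subseteq> \<Omega>" "S \<in> sets lebesgue" "\<K> \<subseteq> \<T>"
    and "\<And>K. K \<in> \<K> \<Longrightarrow> interior K \<subseteq> S" "\<And>K. K \<in> \<T> - \<K> \<Longrightarrow> interior K \<inter> S = {}"
  shows "eform k S w z = (\<Sum>K\<in>\<K>. eform k (interior K) w z)"
  unfolding eform_def using assms by (intro integral_split_elements density_integrable)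

lemma eform_elem_cong:
  assumes "\<And>x. x \<in> interior K \<Longrightarrow> w x = w' x" "\<And>x. x \<in> interior K \<Longrightarrow> z x = z' x"
  shows "eform k (interior K) w z = eform k (interior K) w' z'"
  unfolding eform_def
proof (rule Bochner_Integration.integral_cong)
  fix x assume "x \<in> space (lebesgue_on (interior K))"
  then have x: "x \<in> interior K" by (simp add: space_restrict_space)
  show "density k w z x = density k w' z' x"
    using grad_cong_on_open[OF open_interior x, of w w'] grad_cong_on_open[OF open_interior x, of z z'] assms x
    by (simp add: density_def)
qed simp

lemma eform_zero [simp]: "eform k S (\<lambda>x. 0) z = 0" "eform k S w (\<lambda>x. 0) = 0"
proof -
  have "grad (\<lambda>x. 0) x = 0" for x :: "real^'d" by (simp add: grad_def vec_eq_iff)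
  then show "eform k S (\<lambda>x. 0) z = 0" "eform k S w (\<lambda>x. 0) = 0"
    by (simp_all add: eform_def density_def)
qed

lemma elem_integrable:
  assumes "K \<in> \<T>" "w \<in> V" "z \<in> V"
  shows "integrable (lebesgue_on (interior K)) (density k w z)"
    and "integrable (lebesgue_on (interior K)) (\<lambda>x. w x * z x)"
    and "integrable (lebesgue_on (interior K)) (\<lambda>x. A x * (grad w x \<bullet> grad z x))"
proof -
  note r = restrict_integrable[OF _ elem_interior_subset[OF assms(1)] interior_measurable[OF assms(1)]]
  show "integrable (lebesgue_on (interior K)) (density k w z)"
    by (rule r[OF density_integrable[OF assms(2,3)]])
  show "integrable (lebesgue_on (interior K)) (\<lambda>x. w x * z x)"
    by (rule r[OF V_product_integrable[OF assms(2,3)]])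
  show "integrable (lebesgue_on (interior K)) (\<lambda>x. A x * (grad w x \<bullet> grad z x))"
    by (rule r[OF energy_density_integrable[OF assms(2,3)]])
qed

lemma N_nonneg: "K \<in> \<T> \<Longrightarrow> 0 \<le> N K w"
proof -
  assume K: "K \<in> \<T>"
  have "AE x in lebesgue_on (interior K). 0 \<le> density \<kappa> w w x"
    using A_bounds_elem[OF K] by eventually_elim (auto simp: density_def)
  then show ?thesis unfolding eform_def by (rule integral_nonneg_AE)
qed

lemma N_parts:
  assumes K: "K \<in> \<T>" and w: "w \<in> V"
  shows "N K w = (\<integral>x. (w x)\<^sup>2 \<partial>lebesgue_on (interior K)) + \<kappa> * (\<integral>x. A x * (grad w x \<bullet> grad w x) \<partial>lebesgue_on (interior K))"
    and "0 \<le> (\<integral>x. (w x)\<^sup>2 \<partial>lebesgue_on (interior K))"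
    and "0 \<le> (\<integral>x. A x * (grad w x \<bullet> grad w x) \<partial>lebesgue_on (interior K))"
proof -
  show "N K w = (\<integral>x. (w x)\<^sup>2 \<partial>lebesgue_on (interior K)) + \<kappa> * (\<integral>x. A x * (grad w x \<bullet> grad w x) \<partial>lebesgue_on (interior K))"
    using elem_integrable(2,3)[OF K w w] by (simp add: eform_def density_def power2_eq_square)
  show "0 \<le> (\<integral>x. (w x)\<^sup>2 \<partial>lebesgue_on (interior K))" by simp
  have "AE x in lebesgue_on (interior K). 0 \<le> A x * (grad w x \<bullet> grad w x)"
    using A_bounds_elem[OF K] by eventually_elim auto
  then show "0 \<le> (\<integral>x. A x * (grad w x \<bullet> grad w x) \<partial>lebesgue_on (interior K))" by (rule integral_nonneg_AE)
qed

lemma eform_young: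
  assumes K: "K \<in> \<T>" and w: "w \<in> V" and z: "z \<in> V" and c: "0 < c" and k: "\<bar>k\<bar> = \<kappa>"
  shows "\<bar>eform k (interior K) z w\<bar> \<le> c * N K z + N K w / (4 * c)"
proof -
  let ?M = "lebesgue_on (interior K)"
  have "\<bar>eform k (interior K) z w\<bar> \<le> (\<integral>x. \<bar>density k z w x\<bar> \<partial>?M)"
    unfolding eform_def by (rule integral_abs_bound)
  also have "\<dots> \<le> (\<integral>x. c * density \<kappa> z z x + (1 / (4 * c)) * density \<kappa> w w x \<partial>?M)"
  proof (rule integral_mono_AE)
    show "AE x in ?M. \<bar>density k z w x\<bar> \<le> c * density \<kappa> z z x + (1 / (4 * c)) * density \<kappa> w w x"
      using A_bounds_elem[OF K]
    proof eventually_elim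
      case (elim x)
      have "\<bar>density k z w x\<bar> \<le> \<bar>z x * w x\<bar> + \<bar>k * (A x * (grad z x \<bullet> grad w x))\<bar>"
        unfolding density_def by (rule abs_triangle_ineq)
      also have "\<dots> = \<bar>z x\<bar> * \<bar>w x\<bar> + \<kappa> * A x * \<bar>grad z x \<bullet> grad w x\<bar>"
        using elim k by (simp add: abs_mult)
      also have "\<dots> \<le> (c * \<bar>z x\<bar>\<^sup>2 + \<bar>w x\<bar>\<^sup>2 / (4 * c))
          + \<kappa> * A x * (c * (grad z x \<bullet> grad z x) + (grad w x \<bullet> grad w x) / (4 * c))"
        using young_scalar[OF c, of "\<bar>z x\<bar>" "\<bar>w x\<bar>"] young_inner[OF c, of "grad z x" "grad w x"] elim
        by (intro add_mono mult_left_mono) auto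
      also have "\<dots> = c * density \<kappa> z z x + (1 / (4 * c)) * density \<kappa> w w x"
        by (simp add: density_def power2_eq_square algebra_simps add_divide_distrib)
      finally show ?case .
    qed
  qed (use elem_integrable(1)[OF K] w z in auto)
  also have "\<dots> = c * N K z + N K w / (4 * c)"
    using elem_integrable(1)[OF K] w z by (simp add: eform_def)
  finally show ?thesis .
qed

definition ring_const :: real where
  "ring_const = truncation_const CARD('d) \<beta> \<sigma>"

lemma \<beta>_nonneg: "0 \<le> \<beta>"
proof (rule ccontr)
  assume n: "\<not> 0 \<le> \<beta>"
  have "AE x in lebesgue_on \<Omega>. False" using A_bounds by eventually_elim (use n in auto)
  then have "AE x in lebesgue. x \<notin> \<Omega>" by (simp add: AE_lebesgue_on_iff[OF dom_measurable])
  then have "\<Omega> \<in> null_sets lebesgue" using dom_measurable by (subst AE_iff_null_sets) auto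
  then have "negligible \<Omega>" by (simp add: negligible_iff_null_sets)
  then show False using open_not_negligible[OF open_dom dom_ne] by simp
qed

lemma ring_const_ge: "2 \<le> ring_const"
proof -
  have "0 \<le> nodal_const CARD('d)" by (simp add: nodal_const_def shrink_ratio_def)
  then show ?thesis using \<beta>_nonneg by (simp add: ring_const_def truncation_const_def)
qed

text \<open>The parameter of Young's inequality for the gradient term is \<open>\<tau>/(2h)\<close>. The energy density of \<open>z\<close>
  gets this factor, and the one of \<open>v\<close> gets \<open>\<kappa> h/(2\<tau>) = \<tau>h/8\<close>, which equals \<open>(\<tau>/h) h\<^sup>2/8\<close> and
  is matched by the inverse estimate for \<open>h\<^sup>2 \<parallel>\<nabla>v\<parallel>\<^sup>2\<close>. In this way the bound is linear in
  \<open>\<tau>/h\<close>.\<close>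
lemma eform_truncation_bound:
  assumes K: "K \<in> \<T>" and w: "w \<in> V" and v: "v \<in> V" and z: "z \<in> V" and k: "\<bar>k\<bar> = \<kappa>"
    and nod: "\<And>x. x \<in> K \<Longrightarrow> v x = (\<Sum>p\<in>verts K. a p * hat {K} p x)"
    and a: "\<And>p. \<bar>a p\<bar> \<le> \<bar>w p\<bar>"
  shows "\<bar>eform k (interior K) z v\<bar> \<le> ring_const * (1 + \<tau> / h) * (N K z + N K w)"
proof -
  let ?M = "lebesgue_on (interior K)" and ?m = "measure lebesgue (interior K)"
  let ?s = "\<tau> / h" and ?nc = "nodal_const CARD('d)"
  define S where "S = (\<Sum>p\<in>verts K. \<bar>w p\<bar>)"
  define g where "g = (real CARD('d))\<^sup>2 / (2 * \<sigma>\<^sup>2)"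
  have s: "0 < ?s" using h_pos \<tau>_pos by simp
  have aS: "(\<Sum>p\<in>verts K. \<bar>a p\<bar>) \<le> S" unfolding S_def by (intro sum_mono a)
  have g0: "0 \<le> g" by (simp add: g_def)
  have nc0: "0 \<le> ?nc" by (simp add: nodal_const_def shrink_ratio_def)
  have vb: "\<bar>v x\<bar> \<le> S" if "x \<in> interior K" for x
    using nodal_sup_bound[of K v a x, OF nod] aS that interior_subset by fastforce
  have gb: "h * norm (grad v x) \<le> g * S" if "x \<in> interior K" for x
  proof -
    have "h * norm (grad v x) \<le> g * (\<Sum>p\<in>verts K. \<bar>a p\<bar>)"
      using grad_nodal_bound[OF v nod K that] by (simp add: g_def)
    also have "\<dots> \<le> g * S" using aS g0 by (intro mult_left_mono)
    finally show ?thesis .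
  qed
  define c where "c = S\<^sup>2 / 2 + ?s / 8 * \<beta> * (g * S)\<^sup>2"
  have "\<bar>eform k (interior K) z v\<bar> \<le> (\<integral>x. \<bar>density k z v x\<bar> \<partial>?M)"
    unfolding eform_def by (rule integral_abs_bound)
  also have "\<dots> \<le> (\<integral>x. (1 / 2) * (z x)\<^sup>2 + (?s / 2 * \<kappa>) * (A x * (grad z x \<bullet> grad z x)) + c \<partial>?M)"
  proof (rule integral_mono_AE)
    show "AE x in ?M. \<bar>density k z v x\<bar> \<le> (1 / 2) * (z x)\<^sup>2 + (?s / 2 * \<kappa>) * (A x * (grad z x \<bullet> grad z x)) + c"
      using A_bounds_elem[OF K] AE_space
    proof eventually_elim
      case (elim x)
      then have x: "x \<in> interior K" by (simp add: space_restrict_space)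
      have "\<bar>density k z v x\<bar> \<le> \<bar>z x * v x\<bar> + \<bar>k * (A x * (grad z x \<bullet> grad v x))\<bar>"
        unfolding density_def by (rule abs_triangle_ineq)
      also have "\<dots> = \<bar>z x\<bar> * \<bar>v x\<bar> + \<kappa> * A x * \<bar>grad z x \<bullet> grad v x\<bar>"
        using elim k by (simp add: abs_mult)
      also have "\<dots> \<le> (1 / 2 * \<bar>z x\<bar>\<^sup>2 + \<bar>v x\<bar>\<^sup>2 / (4 * (1 / 2)))
          + \<kappa> * A x * (?s / 2 * (grad z x \<bullet> grad z x) + (grad v x \<bullet> grad v x) / (4 * (?s / 2)))"
        using young_scalar[of "1/2" "\<bar>z x\<bar>" "\<bar>v x\<bar>"] young_inner[of "?s / 2" "grad z x" "grad v x"] elim s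
        by (intro add_mono mult_left_mono) auto
      also have "\<dots> = (1 / 2) * (z x)\<^sup>2 + (?s / 2 * \<kappa>) * (A x * (grad z x \<bullet> grad z x))
          + (\<bar>v x\<bar>\<^sup>2 / 2 + ?s / 8 * A x * (h * norm (grad v x))\<^sup>2)"
      proof -
        have "\<kappa> / (4 * (?s / 2)) = ?s / 8 * h\<^sup>2"
          using h_pos \<tau>_pos by (simp add: power2_eq_square field_simps)
        moreover have "\<kappa> * A x * ((grad v x \<bullet> grad v x) / (4 * (?s / 2)))
            = \<kappa> / (4 * (?s / 2)) * (A x * (grad v x \<bullet> grad v x))"
          by (simp only: times_divide_eq_left times_divide_eq_right mult_ac)
        ultimately have e: "\<kappa> * A x * ((grad v x \<bullet> grad v x) / (4 * (?s / 2)))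
            = ?s / 8 * A x * (h * norm (grad v x))\<^sup>2"
          by (simp add: power_mult_distrib power2_norm_eq_inner mult_ac)
        show ?thesis unfolding distrib_left e by simp
      qed
      also have "\<dots> \<le> (1 / 2) * (z x)\<^sup>2 + (?s / 2 * \<kappa>) * (A x * (grad z x \<bullet> grad z x)) + c"
      proof -
        have "\<bar>v x\<bar>\<^sup>2 \<le> S\<^sup>2" using vb[OF x] by (intro power_mono) auto
        moreover have "(h * norm (grad v x))\<^sup>2 \<le> (g * S)\<^sup>2"
          using gb[OF x] h_pos by (intro power_mono) auto
        then have "?s / 8 * A x * (h * norm (grad v x))\<^sup>2 \<le> ?s / 8 * \<beta> * (g * S)\<^sup>2"
          using elim s \<beta>_nonneg h_pos \<tau>_pos by (intro mult_mono) auto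
        ultimately show ?thesis unfolding c_def by linarith
      qed
      finally show ?case .
    qed
    show "integrable ?M (\<lambda>x. \<bar>density k z v x\<bar>)" using elem_integrable(1)[OF K z v] by (rule integrable_abs)
    show "integrable ?M (\<lambda>x. (1 / 2) * (z x)\<^sup>2 + (?s / 2 * \<kappa>) * (A x * (grad z x \<bullet> grad z x)) + c)"
      using elem_integrable(2,3)[OF K z z] finite_measure.integrable_const[OF finite_measure_lebesgue_on[OF interior_lmeasurable[OF K]]]
      unfolding power2_eq_square
      by (intro Bochner_Integration.integrable_add integrable_mult_right)
  qed
  also have "\<dots> = 1 / 2 * (\<integral>x. (z x)\<^sup>2 \<partial>?M) + ?s / 2 * (\<kappa> * (\<integral>x. A x * (grad z x \<bullet> grad z x) \<partial>?M)) + c * ?m"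
  proof -
    have "measure ?M (interior K) = ?m"
      using interior_measurable[OF K] by (simp add: measure_restrict_space)
    then have "(\<integral>x. c \<partial>?M) = c * ?m" by (simp add: space_restrict_space mult.commute)
    moreover have "integrable ?M (\<lambda>x. (z x)\<^sup>2)" "integrable ?M (\<lambda>x. A x * (grad z x \<bullet> grad z x))" "integrable ?M (\<lambda>x. c)"
      using elem_integrable(2,3)[OF K z z] finite_measure.integrable_const[OF finite_measure_lebesgue_on[OF interior_lmeasurable[OF K]]]
      by (simp_all add: power2_eq_square)
    ultimately show ?thesis by (simp add: mult.assoc del: lebesgue_integral_const)
  qed
  also have "\<dots> \<le> (1 + ?s) * N K z + (1 + ?s) * ((1 / 2 + \<beta> / 8 * g\<^sup>2) * ?nc * N K w)"
  proof -
    let ?Lz = "\<integral>x. (z x)\<^sup>2 \<partial>?M" and ?Gz = "\<kappa> * (\<integral>x. A x * (grad z x \<bullet> grad z x) \<partial>?M)"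
    have nz: "N K z = ?Lz + ?Gz" "0 \<le> ?Lz" "0 \<le> ?Gz"
      using N_parts[OF K z] \<kappa>_pos by auto
    have "1 / 2 * p + r / 2 * q \<le> (1 + r) * (p + q)" if "0 \<le> p" "0 \<le> q" "0 < r" for p q r :: real
    proof -
      have "0 \<le> r * p" "0 \<le> r * q" using that by auto
      then show ?thesis using that(1,2) by (simp add: algebra_simps)
    qed
    from this[OF nz(2,3) s] have 1: "1 / 2 * ?Lz + ?s / 2 * ?Gz \<le> (1 + ?s) * N K z"
      unfolding nz(1) .
    have "\<kappa> * (\<integral>x. A x * (grad w x \<bullet> grad w x) \<partial>?M) \<ge> 0" using N_parts(3)[OF K w] \<kappa>_pos by simp
    then have Lw: "(\<integral>x. (w x)\<^sup>2 \<partial>?M) \<le> N K w" using N_parts(1)[OF K w] by linarith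
    have "S\<^sup>2 * ?m \<le> ?nc * (\<integral>x. (w x)\<^sup>2 \<partial>?M)"
      unfolding S_def by (rule nodal_values_bound[OF par[OF K] V_D(3)[OF w K] V_D(1)[OF w]])
    also have "\<dots> \<le> ?nc * N K w" using Lw nc0 by (rule mult_left_mono)
    finally have Sm: "S\<^sup>2 * ?m \<le> ?nc * N K w" .
    have "c * ?m = (1 / 2 + ?s * (\<beta> / 8 * g\<^sup>2)) * (S\<^sup>2 * ?m)"
      by (simp add: c_def power_mult_distrib algebra_simps)
    also have "\<dots> \<le> ((1 + ?s) * (1 / 2 + \<beta> / 8 * g\<^sup>2)) * (?nc * N K w)"
    proof (rule mult_mono[OF _ Sm])
      have "0 \<le> \<beta> / 8 * g\<^sup>2" using \<beta>_nonneg by simp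
      moreover have "1 / 2 + r * b \<le> (1 + r) * (1 / 2 + b)" if "0 \<le> b" "0 < r" for r b :: real
      proof -
        have "(1 + r) * (1 / 2 + b) = 1 / 2 + r * b + (r / 2 + b)" by (simp add: field_simps)
        then show ?thesis using that by simp
      qed
      ultimately show "1 / 2 + ?s * (\<beta> / 8 * g\<^sup>2) \<le> (1 + ?s) * (1 / 2 + \<beta> / 8 * g\<^sup>2)"
        using s by blast
      show "0 \<le> (1 + ?s) * (1 / 2 + \<beta> / 8 * g\<^sup>2)"
        using s \<beta>_nonneg by (intro mult_nonneg_nonneg add_nonneg_nonneg) auto
    qed simp
    finally have "c * ?m \<le> (1 + ?s) * ((1 / 2 + \<beta> / 8 * g\<^sup>2) * ?nc * N K w)" by (simp only: mult.assoc)
    then show ?thesis using 1 by linarith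
  qed
  also have "\<dots> \<le> (1 + ?s) * (ring_const * N K z) + (1 + ?s) * (ring_const * N K w)"
  proof -
    have "(1 / 2 + \<beta> / 8 * g\<^sup>2) * ?nc \<le> ring_const" by (simp add: ring_const_def truncation_const_def g_def)
    then have "(1 / 2 + \<beta> / 8 * g\<^sup>2) * ?nc * N K w \<le> ring_const * N K w"
      using N_nonneg[OF K] by (rule mult_right_mono)
    moreover have "1 * N K z \<le> ring_const * N K z"
      using N_nonneg[OF K] ring_const_ge by (intro mult_right_mono) auto
    ultimately show ?thesis using s by (intro add_mono mult_left_mono) auto
  qed
  also have "\<dots> = ring_const * (1 + ?s) * (N K z + N K w)"
  proof -
    have "r * (b * x) + r * (b * y) = b * r * (x + y)" for r b x y :: real by (simp add: algebra_simps)
    then show ?thesis .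
  qed
  finally show ?thesis .
qed

text \<open>The squared triple norm on the complement of the union of \<open>\<K>\<close>.\<close>
definition outside_energy :: "(real^'d) set set \<Rightarrow> (real^'d \<Rightarrow> real) \<Rightarrow> real" where
  "outside_energy \<K> w = (\<Sum>K\<in>\<T> - \<K>. N K w)"

definition enlarge :: "(real^'d) set set \<Rightarrow> (real^'d) set set" where
  "enlarge \<K> = {K \<in> \<T>. K \<inter> \<Union>\<K> \<noteq> {}}"

lemma outside_energy_nonneg: "0 \<le> outside_energy \<K> w"
  unfolding outside_energy_def by (intro sum_nonneg N_nonneg) auto

lemma eform_dom: "w \<in> V \<Longrightarrow> z \<in> V \<Longrightarrow> eform k \<Omega> w z = (\<Sum>K\<in>\<T>. eform k (interior K) w z)"
  using elem_interior_subset dom_measurable by (intro eform_split) auto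

text \<open>Test with the truncation \<open>v\<close> of \<open>w\<close> by the vertices off \<open>\<K>\<close>. On the ring between \<open>\<K>\<close> and
  \<open>enlarge \<K>\<close> all terms are bounded by \<open>eform_truncation_bound\<close>; further outside \<open>v\<close> equals \<open>w\<close>, and
  Young's inequality leaves at most half of the energy of \<open>w\<close> there. The energy on the ring is the
  difference of the energies off \<open>\<K>\<close> and off \<open>enlarge \<K>\<close>; moving its negative part to the left-hand side
  fills the hole.\<close>
lemma layer_decay:
  assumes \<K>: "\<K> \<subseteq> \<T>" and w: "w \<in> V" and z: "z \<in> V" and z': "z' \<in> V"
    and eq: "\<And>v. v \<in> V \<Longrightarrow> (\<And>K x. K \<in> \<K> \<Longrightarrow> x \<in> K \<Longrightarrow> v x = 0) \<Longrightarrow>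
      eform \<kappa> \<Omega> w v = 2 * eform (- \<kappa>) \<Omega> z v - eform \<kappa> \<Omega> z' v"
    and C: "5 * (ring_const * (1 + \<tau> / h)) \<le> C"
  shows "outside_energy (enlarge \<K>) w \<le>
    (C + 1 / 2) / (1 + C) * (outside_energy \<K> w + (outside_energy \<K> z + outside_energy \<K> z') / 2)"
proof -
  define D where "D = ring_const * (1 + \<tau> / h)"
  have "0 < \<tau> / h" using h_pos \<tau>_pos by simp
  then have D2: "2 \<le> D"
    using mult_mono[of 2 ring_const 1 "1 + \<tau> / h"] ring_const_ge by (simp add: D_def)
  have DC: "5 * D \<le> C" using C by (simp add: D_def)
  have sub: "\<K> \<subseteq> enlarge \<K>"
  proof
    fix K assume K: "K \<in> \<K>"
    then have "K \<noteq> {}" using elem_interior_ne \<K> interior_subset by blast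
    then show "K \<in> enlarge \<K>" using K \<K> by (auto simp: enlarge_def)
  qed
  define R where "R = enlarge \<K> - \<K>"
  have split: "\<T> = \<K> \<union> (R \<union> (\<T> - enlarge \<K>))" "\<T> - \<K> = R \<union> (\<T> - enlarge \<K>)"
    using \<K> sub by (auto simp: R_def enlarge_def)
  have disj: "R \<inter> (\<T> - enlarge \<K>) = {}" "\<K> \<inter> (R \<union> (\<T> - enlarge \<K>)) = {}" using sub by (auto simp: R_def)
  have RT: "R \<subseteq> \<T>" by (auto simp: R_def enlarge_def)
  have fin: "finite R" "finite (\<T> - enlarge \<K>)" "finite \<K>"
    using finite_mesh finite_subset RT \<K> by blast+
  obtain v where v: "v \<in> V" and nod: "\<And>K x. K \<in> \<T> \<Longrightarrow> x \<in> K \<Longrightarrow>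
      v x = (\<Sum>p\<in>verts K. (if p \<in> - \<Union>\<K> then w p else 0) * hat {K} p x)"
    using nodal_truncation[OF w, of "- \<Union>\<K>"] by blast
  have v_in: "v x = 0" if "K \<in> \<K>" "x \<in> K" for K x
  proof -
    have "verts K \<subseteq> \<Union>\<K>" using that(1) corner_mem by (auto simp: verts_def)
    then have "(\<Sum>p\<in>verts K. (if p \<in> - \<Union>\<K> then w p else 0) * hat {K} p x) = 0"
      by (intro sum.neutral) auto
    then show ?thesis using nod[of K x] that \<K> by auto
  qed
  have v_out: "v x = w x" if "K \<in> \<T> - enlarge \<K>" "x \<in> K" for K x
  proof -
    have "verts K \<subseteq> - \<Union>\<K>" using that(1) corner_mem by (fastforce simp: verts_def enlarge_def)
    then have "(\<Sum>p\<in>verts K. (if p \<in> - \<Union>\<K> then w p else 0) * hat {K} p x) = (\<Sum>p\<in>verts K. w p * hat {K} p x)"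
      by (intro sum.cong) auto
    then have "v x = (\<Sum>p\<in>verts K. w p * hat {K} p x)"
      using nod[of K x] that by auto
    then show ?thesis using V_nodal[OF w, of K x] that by simp
  qed
  have decomp: "eform k \<Omega> y v = (\<Sum>K\<in>R. eform k (interior K) y v) + (\<Sum>K\<in>\<T> - enlarge \<K>. eform k (interior K) y w)"
    if y: "y \<in> V" for k y
  proof -
    have "eform k (interior K) y v = 0" if "K \<in> \<K>" for K
    proof -
      have "v x = (\<lambda>x. 0) x" if "x \<in> interior K" for x
        using v_in \<open>K \<in> \<K>\<close> that interior_subset by blast
      then have "eform k (interior K) y v = eform k (interior K) y (\<lambda>x. 0)"
        by (intro eform_elem_cong) auto
      then show ?thesis by simp
    qed
    then have z: "(\<Sum>K\<in>\<K>. eform k (interior K) y v) = 0" by simp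
    have "eform k \<Omega> y v = (\<Sum>K\<in>\<K> \<union> (R \<union> (\<T> - enlarge \<K>)). eform k (interior K) y v)"
      using eform_dom[OF y v] split(1) by simp
    also have "\<dots> = (\<Sum>K\<in>R. eform k (interior K) y v) + (\<Sum>K\<in>\<T> - enlarge \<K>. eform k (interior K) y v)"
      using fin disj z by (simp add: sum.union_disjoint)
    also have "(\<Sum>K\<in>\<T> - enlarge \<K>. eform k (interior K) y v) = (\<Sum>K\<in>\<T> - enlarge \<K>. eform k (interior K) y w)"
    proof (intro sum.cong refl eform_elem_cong)
      fix K x assume "K \<in> \<T> - enlarge \<K>" "x \<in> interior K"
      then show "v x = w x" using v_out interior_subset by blast
    qed
    finally show ?thesis .
  qed
  \<comment> \<open>energies off the enlarged set and on the ring\<close>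
  define Eo where "Eo = (\<lambda>y. \<Sum>K\<in>\<T> - enlarge \<K>. N K y)"
  define Er where "Er = (\<lambda>y. \<Sum>K\<in>R. N K y)"
  have OQ: "outside_energy \<K> y = Er y + Eo y" "outside_energy (enlarge \<K>) y = Eo y" for y
    unfolding outside_energy_def split(2) Eo_def Er_def using fin disj by (simp_all add: sum.union_disjoint)
  have pos: "0 \<le> Eo y" "0 \<le> Er y" for y
    unfolding Eo_def Er_def using RT by (auto intro!: sum_nonneg N_nonneg)
  have ring: "\<bar>\<Sum>K\<in>R. eform k (interior K) y v\<bar> \<le> D * (Er y + Er w)" if y: "y \<in> V" and k: "\<bar>k\<bar> = \<kappa>" for k y
  proof -
    have "\<bar>\<Sum>K\<in>R. eform k (interior K) y v\<bar> \<le> (\<Sum>K\<in>R. \<bar>eform k (interior K) y v\<bar>)" by (rule sum_abs)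
    also have "\<dots> \<le> (\<Sum>K\<in>R. D * (N K y + N K w))"
      unfolding D_def using RT by (intro sum_mono eform_truncation_bound[OF _ w v y k nod]) auto
    finally show ?thesis by (simp add: Er_def sum.distrib flip: sum_distrib_left)
  qed
  have outer: "\<bar>\<Sum>K\<in>\<T> - enlarge \<K>. eform k (interior K) y w\<bar> \<le> c * Eo y + Eo w / (4 * c)"
    if y: "y \<in> V" and k: "\<bar>k\<bar> = \<kappa>" and c: "0 < c" for k y c
  proof -
    have "\<bar>\<Sum>K\<in>\<T> - enlarge \<K>. eform k (interior K) y w\<bar> \<le> (\<Sum>K\<in>\<T> - enlarge \<K>. \<bar>eform k (interior K) y w\<bar>)"
      by (rule sum_abs)
    also have "\<dots> \<le> (\<Sum>K\<in>\<T> - enlarge \<K>. c * N K y + N K w / (4 * c))"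
      by (intro sum_mono eform_young w y c k) auto
    finally show ?thesis by (simp add: Eo_def sum.distrib sum_divide_distrib flip: sum_distrib_left)
  qed
  have \<kappa>: "\<bar>\<kappa>\<bar> = \<kappa>" "\<bar>- \<kappa>\<bar> = \<kappa>" by auto
  have id: "eform \<kappa> \<Omega> w v = 2 * eform (- \<kappa>) \<Omega> z v - eform \<kappa> \<Omega> z' v" by (rule eq[OF v v_in])
  \<comment> \<open>Young's inequality off the ring with the weights \<open>2\<close> for \<open>z\<close> and \<open>1\<close> for \<open>z'\<close> costs one quarter of the energy of \<open>w\<close> each\<close>
  have main: "Eo w \<le> Eo w / 2 + 4 * Eo z + Eo z' + D * (5 * Er w + 2 * Er z + Er z')"
  proof -
    have "Eo w = (\<Sum>K\<in>\<T> - enlarge \<K>. eform \<kappa> (interior K) w w)" by (simp add: Eo_def)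
    then have "Eo w = 2 * ((\<Sum>K\<in>R. eform (- \<kappa>) (interior K) z v) + (\<Sum>K\<in>\<T> - enlarge \<K>. eform (- \<kappa>) (interior K) z w))
       - ((\<Sum>K\<in>R. eform \<kappa> (interior K) z' v) + (\<Sum>K\<in>\<T> - enlarge \<K>. eform \<kappa> (interior K) z' w))
       - (\<Sum>K\<in>R. eform \<kappa> (interior K) w v)"
      using id unfolding decomp[OF w] decomp[OF z] decomp[OF z'] by linarith
    then show ?thesis
      using ring[OF w \<kappa>(1)] ring[OF z \<kappa>(2)] ring[OF z' \<kappa>(1)] outer[OF z \<kappa>(2), of 2] outer[OF z' \<kappa>(1), of 1]
      unfolding distrib_left by (simp add: abs_le_iff)
  qed
  have C0: "0 < 1 + C" using D2 DC by linarith
  have "4 * Eo z \<le> 2 * D * Eo z" "1 * Eo z' \<le> D * Eo z'"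
    using D2 pos by (intro mult_right_mono; simp)+
  then have "Eo w \<le> Eo w / 2 + 5 * D * Er w + 2 * D * (Eo z + Er z) + D * (Eo z' + Er z')"
    using main by (simp add: algebra_simps)
  also have "\<dots> \<le> Eo w / 2 + C * Er w + C / 2 * (Eo z + Er z) + C / 2 * (Eo z' + Er z')"
    using D2 DC pos by (intro add_mono mult_right_mono add_nonneg_nonneg order_refl) auto
  finally have "Eo w \<le> Eo w / 2 + C * Er w + C / 2 * (Eo z + Er z) + C / 2 * (Eo z' + Er z')" .
  moreover have "(1 + C) * p \<le> (C + 1 / 2) * p + C * q + C / 2 * (a + b)"
    if "p \<le> p / 2 + C * q + C / 2 * a + C / 2 * b" for p q a b :: real
  proof -
    have "(C + 1 / 2) * p + C * q + C / 2 * (a + b) - (1 + C) * p = p / 2 + C * q + C / 2 * a + C / 2 * b - p"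
      by (simp add: field_simps)
    then show ?thesis using that by simp
  qed
  ultimately have "(1 + C) * Eo w \<le> (C + 1 / 2) * Eo w + C * Er w + C / 2 * (Eo z + Er z + (Eo z' + Er z'))"
    by blast
  also have "\<dots> \<le> (C + 1 / 2) * Eo w + (C + 1 / 2) * Er w + (C + 1 / 2) / 2 * (Eo z + Er z + (Eo z' + Er z'))"
    using pos by (intro add_mono mult_right_mono add_nonneg_nonneg order_refl) auto
  also have "\<dots> = (C + 1 / 2) * ((Er w + Eo w) + ((Er z + Eo z) + (Er z' + Eo z')) / 2)"
    by (simp add: algebra_simps)
  finally show ?thesis
    unfolding OQ using C0 by (simp add: pos_le_divide_eq mult.commute)
qed

end

section \<open>Patches, supports and the decay estimate\<close>

context fe_wave
begin

fun layer :: "(real^'d) set set \<Rightarrow> nat \<Rightarrow> (real^'d) set set" where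
  "layer \<S> 0 = \<S>"
| "layer \<S> (Suc l) = enlarge (layer \<S> l)"

lemma layer_subset: "\<S> \<subseteq> \<T> \<Longrightarrow> layer \<S> l \<subseteq> \<T>"
  by (cases l) (auto simp: enlarge_def)

text \<open>Each element is the closure of its interior. This identifies the closures in the definition of
  the patches with unions of elements.\<close>
lemma closure_interior_union:
  assumes "\<K> \<subseteq> \<T>" "interior (\<Union>\<K>) \<inter> \<Omega> \<subseteq> X" "X \<subseteq> \<Union>\<K>"
  shows "closure X = \<Union>\<K>"
proof (rule subset_antisym)
  have "closed (\<Union>\<K>)"
    using assms(1) finite_subset[OF assms(1) finite_mesh] compact_parallelepiped[OF par] compact_imp_closed
    by (intro closed_Union) auto
  then show "closure X \<subseteq> \<Union>\<K>" using assms(3) by (rule closure_minimal[rotated])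
  show "\<Union>\<K> \<subseteq> closure X"
  proof
    fix x assume "x \<in> \<Union>\<K>"
    then obtain K where K: "K \<in> \<K>" "x \<in> K" by blast
    then have KT: "K \<in> \<T>" using assms(1) by blast
    have "interior K \<subseteq> X"
      using elem_interior_subset[OF KT] interior_mono[of K "\<Union>\<K>"] K(1) assms(2) by blast
    then have "closure (interior K) \<subseteq> closure X" by (rule closure_mono)
    then show "x \<in> closure X" using elem_closure[OF KT] K(2) by blast
  qed
qed

lemma patches_layer:
  assumes S: "\<S> \<subseteq> \<T>" and \<omega>: "\<omega> = \<Omega> \<inter> \<Union>\<S>"
  shows "patches \<T> (Suc l) \<omega> = interior (\<Union>(layer \<S> (Suc l)))"
proof (induction l)
  case 0
  have "closure \<omega> = \<Union>\<S>"
    using interior_subset by (intro closure_interior_union[OF S]) (auto simp: \<omega>)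
  then show ?case by (simp add: patch_def enlarge_def)
next
  case (Suc l)
  have "closure (patches \<T> (Suc l) \<omega>) = \<Union>(layer \<S> (Suc l))"
    unfolding Suc using interior_subset by (intro closure_interior_union[OF layer_subset[OF S]]) auto
  then show ?case by (simp add: patch_def enlarge_def)
qed

lemma triple_norm_patches:
  assumes S: "\<S> \<subseteq> \<T>" and \<omega>: "\<omega> = \<Omega> \<inter> \<Union>\<S>" and w: "w \<in> V"
  shows "triple_norm A \<tau> (\<Omega> - patches \<T> l \<omega>) w = sqrt (outside_energy (layer \<S> l) w)"
proof -
  let ?P = "patches \<T> l \<omega>"
  have P: "open ?P" "?P \<subseteq> \<Union>(layer \<S> l)" "\<And>K. K \<in> layer \<S> l \<Longrightarrow> interior K \<subseteq> ?P"
  proof -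
    have "open ?P \<and> ?P \<subseteq> \<Union>(layer \<S> l) \<and> (\<forall>K\<in>layer \<S> l. interior K \<subseteq> ?P)"
    proof (cases l)
      case 0
      have "interior K \<subseteq> interior \<omega>" if "K \<in> \<S>" for K
        using elem_interior_subset[of K] that S interior_subset[of K] \<omega> by (intro interior_maximal) auto
      moreover have "interior \<omega> \<subseteq> \<Union>\<S>" using interior_subset \<omega> by blast
      ultimately show ?thesis using 0 by auto
    next
      case (Suc m)
      have "\<forall>K\<in>layer \<S> l. interior K \<subseteq> interior (\<Union>(layer \<S> l))"
        by (intro ballI interior_mono Union_upper)
      moreover have "?P = interior (\<Union>(layer \<S> l))" using patches_layer[OF S \<omega>, of m] Suc by simp
      ultimately show ?thesis using interior_subset[of "\<Union>(layer \<S> l)"] by simp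
    qed
    then show "open ?P" "?P \<subseteq> \<Union>(layer \<S> l)" "\<And>K. K \<in> layer \<S> l \<Longrightarrow> interior K \<subseteq> ?P" by blast+
  qed
  have m: "\<Omega> - ?P \<in> sets lebesgue" using P(1) dom_measurable by (intro sets.Diff) (auto simp: borel_open)
  have "eform \<kappa> (\<Omega> - ?P) w w = (\<Sum>K\<in>\<T> - layer \<S> l. N K w)"
  proof (rule eform_split[OF w w _ m])
    fix K assume K: "K \<in> \<T> - layer \<S> l"
    have "interior K \<inter> L = {}" if "L \<in> layer \<S> l" for L
      using elem_disjoint[of K L] K that layer_subset[OF S, of l] by blast
    then show "interior K \<subseteq> \<Omega> - ?P" using P(2) elem_interior_subset[of K] K by blast
  next
    fix K assume "K \<in> \<T> - (\<T> - layer \<S> l)"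
    then show "interior K \<inter> (\<Omega> - ?P) = {}" using P(3) by blast
  qed auto
  then show ?thesis
    using eform_eq[OF w w _ m, of \<kappa>] by (simp add: triple_norm_def outside_energy_def)
qed

lemma triple_norm_dom:
  assumes w: "w \<in> V"
  shows "triple_norm A \<tau> \<Omega> w = sqrt (outside_energy {} w)"
  using eform_eq[OF w w _ dom_measurable, of \<kappa>] eform_dom[OF w w, of \<kappa>]
  by (simp add: triple_norm_def outside_energy_def)

lemma outside_energy_le_total: "outside_energy \<K> w \<le> outside_energy {} w"
  unfolding outside_energy_def using finite_mesh N_nonneg by (intro sum_mono2) auto

text \<open>By continuity, vanishing almost everywhere on an open element means vanishing everywhere.\<close>
lemma supported_vanishes:
  assumes S: "\<S> \<subseteq> \<T>" and \<omega>: "\<omega> = \<Omega> \<inter> \<Union>\<S>" and u: "u \<in> V" and supp: "supported_in \<Omega> \<omega> u"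
    and K: "K \<in> \<T> - \<S>" and x: "x \<in> interior K"
  shows "u x = 0"
proof (rule ccontr)
  assume nz: "u x \<noteq> 0"
  define U where "U = interior K \<inter> {y. u y \<noteq> 0}"
  have "open {y. u y \<noteq> 0}"
    using V_D(1)[OF u] by (intro open_Collect_neq) (auto intro: continuous_on_const)
  then have "open U" by (auto simp: U_def)
  moreover have "U \<noteq> {}" using nz x by (auto simp: U_def)
  moreover have "negligible U"
  proof -
    have "AE y in lebesgue. y \<in> \<Omega> \<longrightarrow> y \<notin> \<omega> \<longrightarrow> u y = 0"
      using supp by (simp add: supported_in_def AE_lebesgue_on_iff[OF dom_measurable])
    moreover have "U \<subseteq> \<Omega>" using elem_interior_subset K by (auto simp: U_def)
    moreover have "interior K \<inter> \<omega> = {}"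
    proof -
      have "interior K \<inter> L = {}" if "L \<in> \<S>" for L using elem_disjoint[of K L] K S that by blast
      then show ?thesis using \<omega> by blast
    qed
    ultimately have "AE y in lebesgue. y \<notin> U"
      by (elim AE_mp) (auto simp: U_def)
    then have "U \<in> null_sets lebesgue"
      using \<open>open U\<close> by (subst AE_iff_null_sets) (auto simp: borel_open)
    then show ?thesis by (simp add: negligible_iff_null_sets)
  qed
  ultimately show False using open_not_negligible by blast
qed

lemma L2_inner_disjoint:
  assumes \<omega>: "\<omega> = \<Omega> \<inter> \<Union>\<S>" and supp: "supported_in \<Omega> \<omega> g"
    and v: "\<And>K x. K \<in> \<S> \<Longrightarrow> x \<in> K \<Longrightarrow> v x = 0"
  shows "L2_inner \<Omega> g v = 0"
proof -
  have "AE x in lebesgue_on \<Omega>. x \<notin> \<omega> \<longrightarrow> g x = 0" using supp by (simp add: supported_in_def)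
  then have "AE x in lebesgue_on \<Omega>. g x * v x = 0"
    by eventually_elim (use v \<omega> in \<open>auto simp: space_restrict_space\<close>)
  then show ?thesis unfolding L2_inner_def by (rule integral_eq_zero_AE)
qed

lemma energy_form_disjoint:
  assumes S: "\<S> \<subseteq> \<T>" and \<omega>: "\<omega> = \<Omega> \<inter> \<Union>\<S>" and u: "u \<in> V" and supp: "supported_in \<Omega> \<omega> u"
    and v: "\<And>K x. K \<in> \<S> \<Longrightarrow> x \<in> K \<Longrightarrow> v x = 0"
  shows "energy_form A \<Omega> u v = 0"
proof -
  have z: "grad (\<lambda>x. 0) x = 0" for x :: "real^'d" by (simp add: grad_def vec_eq_iff)
  have "(A x *\<^sub>R grad u x) \<bullet> grad v x = 0" if K: "K \<in> \<T>" and x: "x \<in> interior K" for K x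
  proof (cases "K \<in> \<S>")
    case True
    have "grad v x = grad (\<lambda>x. 0) x"
      by (rule grad_cong_on_open[OF open_interior x]) (use v True interior_subset in blast)
    then show ?thesis by (simp add: z)
  next
    case False
    have "grad u x = grad (\<lambda>x. 0) x"
      by (rule grad_cong_on_open[OF open_interior x]) (use supported_vanishes[OF S \<omega> u supp] False K in blast)
    then show ?thesis by (simp add: z)
  qed
  then show ?thesis unfolding energy_form_def by (intro integral_eq_zero_AE AE_elements)
qed

lemma half_step_in_V:
  assumes "\<And>n. u n \<in> V"
  shows "half_step u n \<in> V"
proof -
  have "half_step u n = (\<lambda>x. (1 / 2) * u (n + 1) x + (1 / 2) * u n x)" by (auto simp: half_step_def)
  then show ?thesis using V_lincomb[OF assms assms] by metis
qed

lemma eform_half_step: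
  assumes u: "\<And>n. u n \<in> V" and v: "v \<in> V"
  shows "eform k \<Omega> (half_step u n) v = (L2_inner \<Omega> (u (n + 1)) v + L2_inner \<Omega> (u n) v) / 2
    + k * ((energy_form A \<Omega> (u (n + 1)) v + energy_form A \<Omega> (u n) v) / 2)"
proof -
  have h: "half_step u n = (\<lambda>x. (1 / 2) * u (n + 1) x + (1 / 2) * u n x)" by (auto simp: half_step_def)
  show ?thesis
    unfolding eform_eq[OF half_step_in_V[OF u] v order_refl dom_measurable]
    unfolding h L2_lincomb[OF u u v] energy_lincomb[OF u u v] by (simp add: add_divide_distrib)
qed

lemma second_diff_inner:
  assumes u: "\<And>n. u n \<in> V" and v: "v \<in> V"
  shows "L2_inner \<Omega> (second_diff \<tau> u n) v
    = (L2_inner \<Omega> (u (n + 1)) v - 2 * L2_inner \<Omega> (u n) v + L2_inner \<Omega> (u (n - 1)) v) / \<tau>\<^sup>2"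
proof -
  have "second_diff \<tau> u n = (\<lambda>x. 1 * ((1 / \<tau>\<^sup>2) * u (n + 1) x + (- 2 / \<tau>\<^sup>2) * u n x) + (1 / \<tau>\<^sup>2) * u (n - 1) x)"
    by (auto simp: second_diff_def add_divide_distrib diff_divide_distrib)
  then show ?thesis
    by (simp only: L2_lincomb[OF V_lincomb[OF u u] u v] L2_lincomb[OF u u v])
      (simp add: add_divide_distrib diff_divide_distrib)
qed

lemma weighted_avg_forms:
  assumes u: "\<And>n. u n \<in> V" and v: "v \<in> V"
  shows "L2_inner \<Omega> (weighted_avg u n) v
      = (L2_inner \<Omega> (u (n + 1)) v + 2 * L2_inner \<Omega> (u n) v + L2_inner \<Omega> (u (n - 1)) v) / 4" (is ?A)
    and "energy_form A \<Omega> (weighted_avg u n) v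
      = (energy_form A \<Omega> (u (n + 1)) v + 2 * energy_form A \<Omega> (u n) v + energy_form A \<Omega> (u (n - 1)) v) / 4" (is ?B)
proof -
  have w: "weighted_avg u n = (\<lambda>x. 1 * ((1 / 4) * u (n + 1) x + (1 / 2) * u n x) + (1 / 4) * u (n - 1) x)"
    by (auto simp: weighted_avg_def add_divide_distrib)
  show ?A unfolding w
    by (simp only: L2_lincomb[OF V_lincomb[OF u u] u v] L2_lincomb[OF u u v]) (simp add: add_divide_distrib)
  show ?B unfolding w
    by (simp only: energy_lincomb[OF V_lincomb[OF u u] u v] energy_lincomb[OF u u v]) (simp add: add_divide_distrib)
qed

text \<open>The scheme at step \<open>n\<close> reads \<open>B\<^sub>\<kappa>(w n + w (n-1), v) = 2 (u n, v)\<close>. Adding the same identity at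
  step \<open>n + 1\<close> turns the right-hand side into \<open>4 (w n, v)\<close>, and
  \<open>4 (w n, v) - 2 B\<^sub>\<kappa>(w n, v) = 2 B\<^bsub>-\<kappa>\<^esub>(w n, v)\<close>.\<close>
lemma half_step_recurrence:
  assumes u: "\<And>n. u n \<in> V" and v: "v \<in> V"
    and hom: "\<And>n. 1 \<le> n \<Longrightarrow> L2_inner \<Omega> (second_diff \<tau> u n) v + energy_form A \<Omega> (weighted_avg u n) v = 0"
    and n: "1 \<le> n"
  shows "eform \<kappa> \<Omega> (half_step u (n + 1)) v
    = 2 * eform (- \<kappa>) \<Omega> (half_step u n) v - eform \<kappa> \<Omega> (half_step u (n - 1)) v"
proof -
  define a where "a = (\<lambda>n. L2_inner \<Omega> (u n) v)"
  define e where "e = (\<lambda>n. energy_form A \<Omega> (u n) v)"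
  have cn: "a (m + 1) - 2 * a m + a (m - 1) = - (\<kappa> * (e (m + 1) + 2 * e m + e (m - 1)))" if "1 \<le> m" for m
  proof -
    have "(a (m + 1) - 2 * a m + a (m - 1)) / \<tau>\<^sup>2 + (e (m + 1) + 2 * e m + e (m - 1)) / 4 = 0"
      using hom[OF that] unfolding second_diff_inner[OF u v] weighted_avg_forms[OF u v] a_def e_def .
    then show ?thesis using \<tau>_pos by (simp add: field_simps)
  qed
  have B: "eform k \<Omega> (half_step u m) v = (a (m + 1) + a m) / 2 + k * ((e (m + 1) + e m) / 2)" for k m
    unfolding a_def e_def by (rule eform_half_step[OF u v])
  have alg: "(a3 + a2) / 2 + k * ((e3 + e2) / 2)
      = 2 * ((a2 + a1) / 2 + (- k) * ((e2 + e1) / 2)) - ((a1 + a0) / 2 + k * ((e1 + e0) / 2))"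
    if "a2 - 2 * a1 + a0 = - (k * (e2 + 2 * e1 + e0))" "a3 - 2 * a2 + a1 = - (k * (e3 + 2 * e2 + e1))"
    for a0 a1 a2 a3 e0 e1 e2 e3 k :: real
  proof -
    have "(a3 + a2) / 2 + k * ((e3 + e2) / 2)
        - (2 * ((a2 + a1) / 2 + (- k) * ((e2 + e1) / 2)) - ((a1 + a0) / 2 + k * ((e1 + e0) / 2)))
      = ((a2 - 2 * a1 + a0) + k * (e2 + 2 * e1 + e0)) / 2 + ((a3 - 2 * a2 + a1) + k * (e3 + 2 * e2 + e1)) / 2"
      by (simp add: field_simps)
    then show ?thesis using that by simp
  qed
  have n1: "n - 1 + 1 = n" "n + 1 - 1 = n" using n by simp_all
  show ?thesis
    using alg[OF cn[OF n] cn[of "n + 1", unfolded n1]] by (simp only: B n1 le_add2)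
qed

text \<open>The recurrence starts with \<open>w 0 = 0\<close> off \<open>\<omega>\<close> and \<open>B\<^sub>\<kappa>(w 1, v) = 0\<close>, since the initial values are
  supported in \<open>\<omega>\<close>. The first step is thus an instance of the general one with zero predecessors.\<close>
lemma energy_decay:
  assumes S: "\<S> \<subseteq> \<T>" and \<omega>: "\<omega> = \<Omega> \<inter> \<Union>\<S>"
    and u: "\<And>n. u n \<in> V" and supp: "supported_in \<Omega> \<omega> (u 0)" "supported_in \<Omega> \<omega> (u 1)"
    and hom: "\<And>n v. 1 \<le> n \<Longrightarrow> v \<in> V \<Longrightarrow> (\<And>K x. K \<in> \<S> \<Longrightarrow> x \<in> K \<Longrightarrow> v x = 0) \<Longrightarrow>
      L2_inner \<Omega> (second_diff \<tau> u n) v + energy_form A \<Omega> (weighted_avg u n) v = 0"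
    and C: "5 * (ring_const * (1 + \<tau> / h)) \<le> C"
    and E: "\<And>k. k \<le> n \<Longrightarrow> outside_energy {} (half_step u k) \<le> E"
  shows "outside_energy (layer \<S> l) (half_step u n) \<le> (real l + 1) ^ n * ((C + 1 / 2) / (1 + C)) ^ l * E"
proof -
  define q where "q = (C + 1 / 2) / (1 + C)"
  have "0 < \<tau> / h" using h_pos \<tau>_pos by simp
  then have "0 \<le> ring_const * (1 + \<tau> / h)" using ring_const_ge by (intro mult_nonneg_nonneg) auto
  then have "0 \<le> C" using C by linarith
  then have q: "0 < q" by (simp add: q_def)
  have E0: "0 \<le> E" using E[of 0] outside_energy_nonneg order_trans by blast
  have SL: "\<S> \<subseteq> layer \<S> l" for l
  proof (induction l)
    case (Suc l)
    have "K \<noteq> {}" if "K \<in> \<S>" for K using elem_interior_ne that S interior_subset by blast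
    then have "K \<inter> \<Union>(layer \<S> l) \<noteq> {}" if "K \<in> \<S>" for K using Suc that by blast
    then show ?case using S unfolding layer.simps enlarge_def by blast
  qed simp
  have hV: "half_step u n \<in> V" for n by (rule half_step_in_V[OF u])
  have "\<forall>l. outside_energy (layer \<S> l) (half_step u k) \<le> (real l + 1) ^ k * q ^ l * E" if "k \<le> n" for k
    using that
  proof (induction k rule: less_induct)
    case (less k)
    show ?case
    proof (cases k)
      case 0
      have "N K (half_step u 0) = 0" if "K \<in> \<T> - layer \<S> l" for K l
      proof -
        have K: "K \<in> \<T> - \<S>" using that SL by blast
        have "half_step u 0 x = (\<lambda>x. 0) x" if "x \<in> interior K" for x
          using supported_vanishes[OF S \<omega> u supp(1) K that] supported_vanishes[OF S \<omega> u supp(2) K that]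
          by (simp add: half_step_def)
        then have "N K (half_step u 0) = N K (\<lambda>x. 0)" by (intro eform_elem_cong) auto
        then show ?thesis by simp
      qed
      then have "outside_energy (layer \<S> l) (half_step u 0) = 0" for l
        unfolding outside_energy_def by (intro sum.neutral ballI)
      then show ?thesis using 0 q E0 by (simp add: zero_le_mult_iff)
    next
      case (Suc m)
      \<comment> \<open>zero predecessors in the first step\<close>
      define z where "z = (if m = 0 then (\<lambda>x. 0) else half_step u m)"
      define z' where "z' = (if m = 0 then (\<lambda>x. 0) else half_step u (m - 1))"
      have zV: "z \<in> V" "z' \<in> V" by (simp_all add: z_def z'_def V_zero hV)
      have zb: "outside_energy (layer \<S> l) z \<le> (real l + 1) ^ m * q ^ l * E" for l
      proof (cases "m = 0")
        case True
        then show ?thesis using q E0 by (simp add: z_def outside_energy_def)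
      next
        case False
        then show ?thesis using less.IH[of m] less.prems Suc by (simp add: z_def)
      qed
      have zb': "outside_energy (layer \<S> l) z' \<le> (real l + 1) ^ m * q ^ l * E" for l
      proof (cases "m = 0")
        case True
        then show ?thesis using q E0 by (simp add: z'_def outside_energy_def)
      next
        case False
        then have "outside_energy (layer \<S> l) z' \<le> (real l + 1) ^ (m - 1) * q ^ l * E"
          using less.IH[of "m - 1"] less.prems Suc by (simp add: z'_def)
        also have "\<dots> \<le> (real l + 1) ^ m * q ^ l * E"
          using q E0 by (intro mult_right_mono power_increasing) auto
        finally show ?thesis .
      qed
      have eq: "eform \<kappa> \<Omega> (half_step u k) v = 2 * eform (- \<kappa>) \<Omega> z v - eform \<kappa> \<Omega> z' v"
        if v: "v \<in> V" "\<And>K x. K \<in> \<S> \<Longrightarrow> x \<in> K \<Longrightarrow> v x = 0" for v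
      proof (cases "m = 0")
        case False
        have "L2_inner \<Omega> (second_diff \<tau> u i) v + energy_form A \<Omega> (weighted_avg u i) v = 0" if "1 \<le> i" for i
          using hom[OF that v] by simp
        from half_step_recurrence[OF u v(1) this, where n = m] show ?thesis
          using False Suc by (simp add: z_def z'_def)
      next
        case True
        have "L2_inner \<Omega> (u i) v = 0 \<and> energy_form A \<Omega> (u i) v = 0" if "supported_in \<Omega> \<omega> (u i)" for i
          using L2_inner_disjoint[OF \<omega> that, of v] energy_form_disjoint[OF S \<omega> u that, of v] v(2) by simp
        from this[OF supp(1)] this[OF supp(2)]
        have 0: "L2_inner \<Omega> (u 0) v = 0" "L2_inner \<Omega> (u 1) v = 0"
          "energy_form A \<Omega> (u 0) v = 0" "energy_form A \<Omega> (u 1) v = 0" by simp_all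
        have "(L2_inner \<Omega> (u 2) v) / \<tau>\<^sup>2 + energy_form A \<Omega> (u 2) v / 4 = 0"
          using hom[OF order_refl v] 0
          unfolding second_diff_inner[OF u v(1)] weighted_avg_forms[OF u v(1)] by (simp add: numeral_2_eq_2)
        then have "L2_inner \<Omega> (u 2) v + \<kappa> * energy_form A \<Omega> (u 2) v = 0"
          using \<tau>_pos by (simp add: field_simps)
        then have "eform \<kappa> \<Omega> (half_step u k) v = 0"
          unfolding eform_half_step[OF u v(1)] using 0 Suc True by (simp add: numeral_2_eq_2)
        then show ?thesis using True by (simp add: z_def z'_def)
      qed
      have "outside_energy (layer \<S> l) (half_step u k) \<le> (real l + 1) ^ k * q ^ l * E" for l
      proof (induction l)
        case 0
        show ?case using order_trans[OF outside_energy_le_total E[OF less.prems]] by simp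
      next
        case (Suc l)
        let ?Y = "(real l + 1) ^ m * q ^ l * E"
        have "outside_energy (layer \<S> (Suc l)) (half_step u k)
            \<le> q * (outside_energy (layer \<S> l) (half_step u k)
              + (outside_energy (layer \<S> l) z + outside_energy (layer \<S> l) z') / 2)"
          unfolding layer.simps q_def
          by (rule layer_decay[OF layer_subset[OF S] hV zV eq C]) (use SL in blast)+
        also have "\<dots> \<le> q * ((real l + 1) ^ k * q ^ l * E + (?Y + ?Y) / 2)"
          using Suc zb[of l] zb'[of l] q by (intro mult_left_mono add_mono divide_right_mono) auto
        also have "\<dots> = ((real l + 1) ^ m * (real l + 2)) * (q ^ Suc l * E)"
          using \<open>k = Suc m\<close> by (simp add: algebra_simps)
        also have "\<dots> \<le> ((real l + 2) ^ m * (real l + 2)) * (q ^ Suc l * E)"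
          using q E0 by (intro mult_right_mono power_mono mult_nonneg_nonneg) auto
        also have "\<dots> = (real (Suc l) + 1) ^ k * q ^ Suc l * E"
          using \<open>k = Suc m\<close> by (simp add: algebra_simps)
        finally show ?case .
      qed
      then show ?thesis by blast
    qed
  qed
  then show ?thesis unfolding q_def by blast
qed

end

lemma sqrt_power_eq_powr: "0 < x \<Longrightarrow> sqrt (x ^ n) = x powr (real n / 2)"
  by (simp add: powr_half_sqrt[symmetric] powr_powr flip: powr_realpow)

text \<open>The constant \<open>C\<close> is the multiple of \<open>\<tau>/h + h/\<tau>\<close> that dominates \<open>5 r (1 + \<tau>/h)\<close> as required by
  \<open>layer_decay\<close>; here \<open>1 \<le> (\<tau>/h + h/\<tau>)/2\<close> is used. The factor \<open>\<beta>/\<alpha>\<close> is fixed together with \<open>\<alpha>\<close>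
  and \<open>\<beta>\<close>, so it is absorbed in \<open>c\<close>.\<close>
theorem lemma3p1:
  fixes \<alpha> \<beta> \<sigma> \<delta> :: real
  assumes "0 < \<alpha>" "\<alpha> \<le> \<beta>" "0 < \<sigma>" "0 < \<delta>"
  shows "\<exists>(C :: real \<Rightarrow> real \<Rightarrow> real) c\<^sub>1 c\<^sub>2. 0 < c\<^sub>1 \<and> 0 < c\<^sub>2 \<and>
    (\<forall>\<tau>>0. \<forall>h>0.
       c\<^sub>1 * (\<beta> / \<alpha> * (\<tau> / h + h / \<tau>)) \<le> C \<tau> h \<and>
       C \<tau> h \<le> c\<^sub>2 * (\<beta> / \<alpha> * (\<tau> / h + h / \<tau>))) \<and>
    (\<forall>(\<Omega> :: (real^'d) set) \<T> \<tau> h \<gamma>.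
       lipschitz_polytope \<Omega> \<and> 1 / \<delta> \<le> diameter \<Omega> \<and> diameter \<Omega> \<le> \<delta> \<and>
       regular_mesh \<sigma> \<Omega> \<T> \<and> h = mesh_size \<T> \<and> 0 < \<tau> \<and>
       \<gamma> = sqrt ((C \<tau> h + 1 / 2) / (1 + C \<tau> h)) \<longrightarrow>
       0 < \<gamma> \<and> \<gamma> < 1 \<and>
       (\<forall>A t\<^sub>f\<^sub>i\<^sub>n f f\<^sub>h u \<omega>.
          coefficient \<alpha> \<beta> \<Omega> A \<and>
          0 < t\<^sub>f\<^sub>i\<^sub>n \<and> Linf_L2 t\<^sub>f\<^sub>i\<^sub>n \<Omega> f \<and>
          union_of_elements \<Omega> \<T> \<omega> \<and>
          (\<forall>t\<ge>0. supported_in \<Omega> \<omega> (f t)) \<and>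
          (\<forall>k. rhs_approx \<Omega> (Q1_space \<Omega> \<T>) \<omega> (f (real k * \<tau>)) (f\<^sub>h k)) \<and>
          supported_in \<Omega> \<omega> (u 1) \<and> supported_in \<Omega> \<omega> (u 0) \<and>
          crank_nicolson \<Omega> (Q1_space \<Omega> \<T>) A \<tau> f\<^sub>h u \<longrightarrow>
          (\<forall>n l. triple_norm A \<tau> (\<Omega> - patches \<T> l \<omega>) (half_step u n)
                 \<le> (real l + 1) powr (real n / 2) * \<gamma> ^ l *
                   (MAX k\<in>{..n}. triple_norm A \<tau> \<Omega> (half_step u k)))))"
proof -
  define r where "r = truncation_const CARD('d) \<beta> \<sigma>"
  define C where "C = (\<lambda>\<tau> h :: real. 15 / 2 * r * (\<tau> / h + h / \<tau>))"
  define c where "c = 15 / 2 * r * \<alpha> / \<beta>"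
  have \<beta>: "0 < \<beta>" using assms by simp
  have "0 \<le> nodal_const CARD('d)" by (simp add: nodal_const_def shrink_ratio_def)
  then have r: "2 \<le> r" using \<beta> by (simp add: r_def truncation_const_def)
  have "0 < c" using r assms \<beta> by (simp add: c_def)
  have scal: "C \<tau> h = c * (\<beta> / \<alpha> * (\<tau> / h + h / \<tau>))" for \<tau> h
    using assms \<beta> by (simp add: C_def c_def)
  have C0: "0 < C \<tau> h" and CD: "5 * (r * (1 + \<tau> / h)) \<le> C \<tau> h" if "0 < \<tau>" "0 < h" for \<tau> h
  proof -
    have "0 \<le> (\<tau> - h)\<^sup>2 / (\<tau> * h)" using that by simp
    also have "\<dots> = \<tau> / h + h / \<tau> - 2" using that by (simp add: power2_eq_square field_simps)
    finally have "0 \<le> \<tau> / h + h / \<tau> - 2" .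
    moreover have "0 < h / \<tau>" using that by simp
    ultimately have "1 + \<tau> / h \<le> 3 / 2 * (\<tau> / h + h / \<tau>)" unfolding distrib_left by linarith
    then have "5 * r * (1 + \<tau> / h) \<le> 5 * r * (3 / 2 * (\<tau> / h + h / \<tau>))" using r by (intro mult_left_mono) auto
    then show "5 * (r * (1 + \<tau> / h)) \<le> C \<tau> h" by (simp add: C_def algebra_simps)
    have "0 < \<tau> / h + h / \<tau>" using that by (simp add: add_pos_pos)
    then show "0 < C \<tau> h" using r by (simp add: C_def)
  qed
  have main: "0 < \<gamma> \<and> \<gamma> < 1 \<and>
       (\<forall>A t\<^sub>f\<^sub>i\<^sub>n f f\<^sub>h u \<omega>.
          coefficient \<alpha> \<beta> \<Omega> A \<and>
          0 < t\<^sub>f\<^sub>i\<^sub>n \<and> Linf_L2 t\<^sub>f\<^sub>i\<^sub>n \<Omega> f \<and>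
          union_of_elements \<Omega> \<T> \<omega> \<and>
          (\<forall>t\<ge>0. supported_in \<Omega> \<omega> (f t)) \<and>
          (\<forall>k. rhs_approx \<Omega> (Q1_space \<Omega> \<T>) \<omega> (f (real k * \<tau>)) (f\<^sub>h k)) \<and>
          supported_in \<Omega> \<omega> (u 1) \<and> supported_in \<Omega> \<omega> (u 0) \<and>
          crank_nicolson \<Omega> (Q1_space \<Omega> \<T>) A \<tau> f\<^sub>h u \<longrightarrow>
          (\<forall>n l. triple_norm A \<tau> (\<Omega> - patches \<T> l \<omega>) (half_step u n)
                 \<le> (real l + 1) powr (real n / 2) * \<gamma> ^ l *
                   (MAX k\<in>{..n}. triple_norm A \<tau> \<Omega> (half_step u k))))"
    if hyp: "lipschitz_polytope \<Omega>" "regular_mesh \<sigma> \<Omega> \<T>" "0 < \<tau>"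
      and \<gamma>: "\<gamma> = sqrt ((C \<tau> (mesh_size \<T>) + 1 / 2) / (1 + C \<tau> (mesh_size \<T>)))"
    for \<Omega> :: "(real^'d) set" and \<T> \<tau> \<gamma>
  proof -
    interpret fe_mesh \<Omega> \<T> \<sigma> using hyp assms by unfold_locales
    define q where "q = (C \<tau> h + 1 / 2) / (1 + C \<tau> h)"
    have "0 < C \<tau> h" using C0[OF hyp(3) h_pos] .
    then have q: "0 < q" "q < 1" by (auto simp: q_def)
    have \<gamma>q: "\<gamma> = sqrt q" using \<gamma> by (simp add: q_def)
    show ?thesis
    proof (intro conjI allI impI)
      show "0 < \<gamma>" "\<gamma> < 1" using q by (simp_all add: \<gamma>q)
      fix A t\<^sub>f\<^sub>i\<^sub>n f f\<^sub>h u \<omega> n l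
      assume H: "coefficient \<alpha> \<beta> \<Omega> A \<and>
          0 < t\<^sub>f\<^sub>i\<^sub>n \<and> Linf_L2 t\<^sub>f\<^sub>i\<^sub>n \<Omega> f \<and>
          union_of_elements \<Omega> \<T> \<omega> \<and>
          (\<forall>t\<ge>0. supported_in \<Omega> \<omega> (f t)) \<and>
          (\<forall>k. rhs_approx \<Omega> (Q1_space \<Omega> \<T>) \<omega> (f (real k * \<tau>)) (f\<^sub>h k)) \<and>
          supported_in \<Omega> \<omega> (u 1) \<and> supported_in \<Omega> \<omega> (u 0) \<and>
          crank_nicolson \<Omega> (Q1_space \<Omega> \<T>) A \<tau> f\<^sub>h u"
      interpret fe_wave \<Omega> \<T> \<sigma> A \<alpha> \<beta> \<tau> using H hyp assms by unfold_locales auto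
      obtain \<S> where S: "\<S> \<subseteq> \<T>" and \<omega>: "\<omega> = \<Omega> \<inter> \<Union>\<S>"
        using H unfolding union_of_elements_def by blast
      have u: "u n \<in> V" for n using H by (simp add: crank_nicolson_def)
      have fV: "f\<^sub>h k \<in> V" for k using H by (simp add: rhs_approx_def)
      have hom: "L2_inner \<Omega> (second_diff \<tau> u n) v + energy_form A \<Omega> (weighted_avg u n) v = 0"
        if n: "1 \<le> n" and v: "v \<in> V" "\<And>K x. K \<in> \<S> \<Longrightarrow> x \<in> K \<Longrightarrow> v x = 0" for n v
      proof -
        have "L2_inner \<Omega> (f\<^sub>h k) v = 0" for k
        proof -
          have "L2_projection \<Omega> V (f (real k * \<tau>)) (f\<^sub>h k) \<or> supported_in \<Omega> \<omega> (f\<^sub>h k)"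
            using H by (simp add: rhs_approx_def)
          then show ?thesis
          proof
            assume "L2_projection \<Omega> V (f (real k * \<tau>)) (f\<^sub>h k)"
            then have "L2_inner \<Omega> (f\<^sub>h k) v = L2_inner \<Omega> (f (real k * \<tau>)) v"
              using v(1) by (simp add: L2_projection_def)
            moreover have "supported_in \<Omega> \<omega> (f (real k * \<tau>))" using H hyp(3) by simp
            ultimately show ?thesis using L2_inner_disjoint[OF \<omega> _ v(2)] by simp
          next
            assume "supported_in \<Omega> \<omega> (f\<^sub>h k)"
            then show ?thesis by (rule L2_inner_disjoint[OF \<omega> _ v(2)])
          qed
        qed
        then have "L2_inner \<Omega> (weighted_avg f\<^sub>h n) v = 0" by (simp add: weighted_avg_forms(1)[OF fV v(1)])
        then show ?thesis using H n v(1) by (simp add: crank_nicolson_def)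
      qed
      define M where "M = (MAX k\<in>{..n}. triple_norm A \<tau> \<Omega> (half_step u k))"
      have hV: "half_step u k \<in> V" for k by (rule half_step_in_V[OF u])
      have M: "triple_norm A \<tau> \<Omega> (half_step u k) \<le> M" if "k \<le> n" for k
        unfolding M_def using that by (intro Max_ge) auto
      have "0 \<le> triple_norm A \<tau> \<Omega> (half_step u 0)"
        using outside_energy_nonneg by (simp add: triple_norm_dom[OF hV])
      then have M0: "0 \<le> M" using M[of 0] by simp
      have E: "outside_energy {} (half_step u k) \<le> M\<^sup>2" if "k \<le> n" for k
        using M[OF that] unfolding triple_norm_dom[OF hV] by (rule sqrt_le_D)
      have "outside_energy (layer \<S> l) (half_step u n) \<le> (real l + 1) ^ n * q ^ l * M\<^sup>2"
        unfolding q_def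
        by (rule energy_decay[OF S \<omega> u _ _ hom _ E])
          (use H CD[OF hyp(3) h_pos] in \<open>auto simp: r_def ring_const_def\<close>)
      then have "triple_norm A \<tau> (\<Omega> - patches \<T> l \<omega>) (half_step u n) \<le> sqrt ((real l + 1) ^ n * q ^ l * M\<^sup>2)"
        unfolding triple_norm_patches[OF S \<omega> hV] by (rule real_sqrt_le_mono)
      also have "\<dots> = (real l + 1) powr (real n / 2) * \<gamma> ^ l * M"
        using M0 q sqrt_power_eq_powr[of "real l + 1" n] by (simp add: real_sqrt_mult real_sqrt_power \<gamma>q)
      finally show "triple_norm A \<tau> (\<Omega> - patches \<T> l \<omega>) (half_step u n)
                 \<le> (real l + 1) powr (real n / 2) * \<gamma> ^ l *
                   (MAX k\<in>{..n}. triple_norm A \<tau> \<Omega> (half_step u k))" unfolding M_def .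
    qed
  qed
  show ?thesis
  proof (rule exI[of _ C], rule exI[of _ c], rule exI[of _ c], intro conjI)
    show "0 < c" "0 < c" by fact+
    show "\<forall>\<tau>>0. \<forall>h>0. c * (\<beta> / \<alpha> * (\<tau> / h + h / \<tau>)) \<le> C \<tau> h \<and>
        C \<tau> h \<le> c * (\<beta> / \<alpha> * (\<tau> / h + h / \<tau>))"
      by (simp only: scal order_refl simp_thms)
  qed (intro allI impI, elim conjE, rule main, simp_all only:)
qed

end
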